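(* Let $\alpha\in(0,1)$, $\eta\ge0$, $\gamma>0$, $a>0$, $b\in\mathbb R\setminus\{0\}$. For every $U_0\in\mathcal H$, the problem $U_t=\mathcal AU$, $U(0)=U_0$ admits a unique weak solution $U\in C^0(\mathbb R^+,\mathcal H)$. Moreover, if $U_0\in D(\mathcal A)$, the problem admits a unique strong solution $U\in C^1(\mathbb R^+,\mathcal H)\cap C^0(\mathbb R^+,D(\mathcal A))$.
   Context: Let $\mu(\xi)=|\xi|^{\frac{2\alpha-1}{2}}$ and $\kappa(\alpha)=\frac{\sin(\alpha\pi)}{\pi}$. Let $H^1_L(0,1)=\{u\in H^1(0,1):u(0)=0\}$. $\mathcal H=H^1_L(0,1)\times L^2(0,1)\times H^1_0(0,1)\times L^2(0,1)\times L^2(\mathbb R)$ with inner product $\langle(u,v,y,z,\omega),(\tilde u,\tilde v,\tilde y,\tilde z,\tilde\omega)\rangle_{\mathcal H}=\int_0^1(v\bar{\tilde v}+u_x\bar{\tilde u}_x+z\bar{\tilde z}+a y_x\bar{\tilde y}_x)dx+\gamma\kappa(\alpha)\int_{\mathbb R}\omega\bar{\tilde\omega}\,d\xi$. $D(\mathcal A)$ is the set of $(u,v,y,z,\omega)\in\mathcal H$ with $u\in H^2(0,1)\cap H^1_L(0,1)$, $y\in H^2(0,1)\cap H^1_0(0,1)$, $v\in H^1_L(0,1)$, $z\in H^1_0(0,1)$, $-(\xi^2+\eta)\omega+v(1)\mu(\xi)\in L^2(\mathbb R)$, $|\xi|\omega\in L^2(\mathbb R)$, $u_x(1)+\gamma\kappa(\alpha)\int_{\mathbb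 R}\mu(\xi)\omega(\xi)d\xi=0$, and $\mathcal A(u,v,y,z,\omega)=(v,\,u_{xx}-bz,\,z,\,ay_{xx}+bv,\,-(\xi^2+\eta)\omega+v(1)\mu(\xi))$. *)

theory Defs
  imports "HOL-Analysis.Analysis"
begin

text \<open>States U = (u,v,y,z,omega); all components are complex-valued functions on the reals.
  Components u,v,y,z are only relevant on [0,1]; omega lives on the whole real line.\<close>

type_synonym state =
  "(real \<Rightarrow> complex) \<times> (real \<Rightarrow> complex) \<times> (real \<Rightarrow> complex) \<times> (real \<Rightarrow> complex) \<times> (real \<Rightarrow> complex)"

definition mu :: "real \<Rightarrow> real \<Rightarrow> real" where
  "mu \<alpha> \<xi> = \<bar>\<xi>\<bar> powr ((2 * \<alpha> - 1) / 2)"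

definition kappa :: "real \<Rightarrow> real" where
  "kappa \<alpha> = sin (\<alpha> * pi) / pi"

definition L2 :: "real set \<Rightarrow> (real \<Rightarrow> complex) \<Rightarrow> bool" where
  "L2 S f \<longleftrightarrow> set_borel_measurable lborel S f \<and>
     set_integrable lborel S (\<lambda>x. (cmod (f x))\<^sup>2)"

text \<open>g is the (weak) derivative of u on [0,1], u being its continuous (absolutely continuous)
  representative: u(x) = u(0) + int_0^x g.\<close>
definition is_deriv01 :: "(real \<Rightarrow> complex) \<Rightarrow> (real \<Rightarrow> complex) \<Rightarrow> bool" where
  "is_deriv01 u g \<longleftrightarrow> L2 {0..1} g \<and>
     (\<forall>x\<in>{0..1}. u x = u 0 + (LINT s:{0..x}|lborel. g s))"

definition H1 :: "(real \<Rightarrow> complex) \<Rightarrow> bool" where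
  "H1 u \<longleftrightarrow> (\<exists>g. is_deriv01 u g)"

definition H1L :: "(real \<Rightarrow> complex) \<Rightarrow> bool" where
  "H1L u \<longleftrightarrow> H1 u \<and> u 0 = 0"

definition H10 :: "(real \<Rightarrow> complex) \<Rightarrow> bool" where
  "H10 u \<longleftrightarrow> H1 u \<and> u 0 = 0 \<and> u 1 = 0"

definition H2 :: "(real \<Rightarrow> complex) \<Rightarrow> bool" where
  "H2 u \<longleftrightarrow> (\<exists>g h. is_deriv01 u g \<and> is_deriv01 g h)"

text \<open>first derivative (in L^2, a.e. determined)\<close>
definition dx :: "(real \<Rightarrow> complex) \<Rightarrow> real \<Rightarrow> complex" where
  "dx u = (SOME g. is_deriv01 u g)"

text \<open>continuous representative of the first derivative of an H^2 function\<close>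
definition dxc :: "(real \<Rightarrow> complex) \<Rightarrow> real \<Rightarrow> complex" where
  "dxc u = (SOME g. is_deriv01 u g \<and> (\<exists>h. is_deriv01 g h))"

definition dxx :: "(real \<Rightarrow> complex) \<Rightarrow> real \<Rightarrow> complex" where
  "dxx u = (SOME h. is_deriv01 (dxc u) h)"

definition inH :: "state \<Rightarrow> bool" where
  "inH U = (case U of (u, v, y, z, \<omega>) \<Rightarrow>
     H1L u \<and> L2 {0..1} v \<and> H10 y \<and> L2 {0..1} z \<and> L2 UNIV \<omega>)"

definition Hinner :: "real \<Rightarrow> real \<Rightarrow> real \<Rightarrow> state \<Rightarrow> state \<Rightarrow> complex" where
  "Hinner a \<gamma> \<alpha> U W = (case U of (u, v, y, z, \<omega>) \<Rightarrow> case W of (u', v', y', z', \<omega>') \<Rightarrow>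
     (LINT x:{0..1}|lborel. v x * cnj (v' x) + dx u x * cnj (dx u' x) + z x * cnj (z' x)
                            + complex_of_real a * dx y x * cnj (dx y' x))
     + complex_of_real (\<gamma> * kappa \<alpha>) * (LINT \<xi>|lborel. \<omega> \<xi> * cnj (\<omega>' \<xi>)))"

definition Hnorm :: "real \<Rightarrow> real \<Rightarrow> real \<Rightarrow> state \<Rightarrow> real" where
  "Hnorm a \<gamma> \<alpha> U = sqrt (Re (Hinner a \<gamma> \<alpha> U U))"

definition Hsub :: "state \<Rightarrow> state \<Rightarrow> state" where
  "Hsub U W = (case U of (u, v, y, z, \<omega>) \<Rightarrow> case W of (u', v', y', z', \<omega>') \<Rightarrow>
     (\<lambda>x. u x - u' x, \<lambda>x. v x - v' x, \<lambda>x. y x - y' x, \<lambda>x. z x - z' x, \<lambda>x. \<omega> x - \<omega>' x))"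

definition Hscale :: "real \<Rightarrow> state \<Rightarrow> state" where
  "Hscale c U = (case U of (u, v, y, z, \<omega>) \<Rightarrow>
     (\<lambda>x. of_real c * u x, \<lambda>x. of_real c * v x, \<lambda>x. of_real c * y x,
      \<lambda>x. of_real c * z x, \<lambda>x. of_real c * \<omega> x))"

definition inDA :: "real \<Rightarrow> real \<Rightarrow> real \<Rightarrow> real \<Rightarrow> state \<Rightarrow> bool" where
  "inDA a \<gamma> \<alpha> \<eta> U = (case U of (u, v, y, z, \<omega>) \<Rightarrow>
     inH U \<and> H2 u \<and> H1L u \<and> H2 y \<and> H10 y \<and> H1L v \<and> H10 z \<and>
     L2 UNIV (\<lambda>\<xi>. - complex_of_real (\<xi>\<^sup>2 + \<eta>) * \<omega> \<xi> + v 1 * complex_of_real (mu \<alpha> \<xi>)) \<and>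
     L2 UNIV (\<lambda>\<xi>. complex_of_real \<bar>\<xi>\<bar> * \<omega> \<xi>) \<and>
     dxc u 1 + complex_of_real (\<gamma> * kappa \<alpha>) * (LINT \<xi>|lborel. complex_of_real (mu \<alpha> \<xi>) * \<omega> \<xi>) = 0)"

definition Aop :: "real \<Rightarrow> real \<Rightarrow> real \<Rightarrow> real \<Rightarrow> state \<Rightarrow> state" where
  "Aop a b \<alpha> \<eta> U = (case U of (u, v, y, z, \<omega>) \<Rightarrow>
     (v,
      \<lambda>x. dxx u x - complex_of_real b * z x,
      z,
      \<lambda>x. complex_of_real a * dxx y x + complex_of_real b * v x,
      \<lambda>\<xi>. - complex_of_real (\<xi>\<^sup>2 + \<eta>) * \<omega> \<xi> + v 1 * complex_of_real (mu \<alpha> \<xi>)))"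

text \<open>Weak solution in the sense of Ball (equivalent to the mild/semigroup solution):
  U in C^0([0,oo),\<H>), U(0) = U0, and for every Phi in D(A^*) with A^* Phi = Psi,
  <U(t),Phi> = <U0,Phi> + int_0^t <U(s),Psi> ds.\<close>
definition weak_sol :: "real \<Rightarrow> real \<Rightarrow> real \<Rightarrow> real \<Rightarrow> real \<Rightarrow> (real \<Rightarrow> state) \<Rightarrow> state \<Rightarrow> bool" where
  "weak_sol a b \<gamma> \<alpha> \<eta> U U0 \<longleftrightarrow>
     U 0 = U0 \<and>
     (\<forall>t\<ge>0. inH (U t)) \<and>
     (\<forall>t\<ge>0. ((\<lambda>s. Hnorm a \<gamma> \<alpha> (Hsub (U s) (U t))) \<longlongrightarrow> 0) (at t within {0..})) \<and>
     (\<forall>\<Phi> \<Psi>. inH \<Phi> \<and> inH \<Psi> \<and>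
        (\<forall>V. inDA a \<gamma> \<alpha> \<eta> V \<longrightarrow> Hinner a \<gamma> \<alpha> (Aop a b \<alpha> \<eta> V) \<Phi> = Hinner a \<gamma> \<alpha> V \<Psi>)
      \<longrightarrow> (\<forall>t\<ge>0. Hinner a \<gamma> \<alpha> (U t) \<Phi> =
                   Hinner a \<gamma> \<alpha> U0 \<Phi> + (LINT s:{0..t}|lborel. Hinner a \<gamma> \<alpha> (U s) \<Psi>)))"

definition strong_sol :: "real \<Rightarrow> real \<Rightarrow> real \<Rightarrow> real \<Rightarrow> real \<Rightarrow> (real \<Rightarrow> state) \<Rightarrow> state \<Rightarrow> bool" where
  "strong_sol a b \<gamma> \<alpha> \<eta> U U0 \<longleftrightarrow>
     U 0 = U0 \<and>
     (\<forall>t\<ge>0. inDA a \<gamma> \<alpha> \<eta> (U t)) \<and>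
     (\<forall>t\<ge>0. ((\<lambda>s. Hnorm a \<gamma> \<alpha> (Hsub (U s) (U t))) \<longlongrightarrow> 0) (at t within {0..})) \<and>
     (\<forall>t\<ge>0. ((\<lambda>s. Hnorm a \<gamma> \<alpha> (Hsub (Aop a b \<alpha> \<eta> (U s)) (Aop a b \<alpha> \<eta> (U t)))) \<longlongrightarrow> 0)
               (at t within {0..})) \<and>
     (\<forall>t\<ge>0. ((\<lambda>s. Hnorm a \<gamma> \<alpha> (Hsub (Hscale (1 / (s - t)) (Hsub (U s) (U t))) (Aop a b \<alpha> \<eta> (U t))))
               \<longlongrightarrow> 0) (at t within {0..}))"

end

(* Writing U in terms of u_x, v, y_x, z, omega identifies the state space with a product of L^2 spaces,
   in which the operator is dissipative: the boundary term u_x(1) conj(v(1)) is cancelled by the coupling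
   with omega. For b = 0 the equation l U - A U = F reduces to two boundary value problems
   u'' = m^2 u - h that are solved by variation of constants, and the coupling by b is a bounded skew
   perturbation, so l - A is onto for l > |b|. The Yosida approximations then converge to the
   solutions (the domain is dense because a vector orthogonal to it is killed by the resolvent).
   A weak solution with zero data vanishes because its image under the resolvent of A is a strong
   solution: test with the range of the adjoint of the resolvent. *)

theory Submission
  imports Defs
begin

text \<open>States are plain functions, so \<open>Hnorm\<close> is only a seminorm on them. The
  theory of dissipative operators is therefore carried out in a real Hilbert space of classes,
  reached through \<open>emb\<close>, and the results are transported back. Working over the reals
  loses nothing, because Im (U, W) = Re (U, iW) and the domain is closed under multiplication by i.
  In this picture u(0) = 0 puts no condition on u_x, while y(0) = y(1) = 0 becomes mean zero of y_x.
  The operator involves traces and second derivatives, so its independence of the representative has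
  to be proved. The weight enters the resolvent through M, the integral of mu^2 / (l + eta + xi^2),
  which is finite for 0 < alpha < 1. Eliminating omega turns the coupling at x = 1 into a Robin
  condition with coefficient delta M l >= 0, delta being gamma kappa, and this sign guarantees
  solvability. The fixed point that absorbs the coupling by b contracts only for l > |b|, whence the
  threshold \<open>c\<close> carried through the abstract part. A weak solution need not enter the
  domain, so its energy cannot be differentiated directly; this is why uniqueness goes through the
  resolvent.\<close>

section \<open>Hilbert space preliminaries: projection, Riesz representation, density, energy
  inequality\<close>

text \<open>A minimizing sequence for the distance to \<open>S\<close> is Cauchy, by the
  parallelogram law and the fact that midpoints stay in \<open>S\<close>. Closedness keeps the limit
  in \<open>S\<close>, and minimality makes the residual orthogonal.\<close>

lemma orthogonal_projection_exists:
  fixes S :: "'a::{real_inner,banach} set"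
  assumes "subspace S" "closed S"
  obtains y where "y \<in> S" "\<And>z. z \<in> S \<Longrightarrow> inner (x - y) z = 0"
proof -
  let ?Q = "(\<lambda>y. (norm (x - y))\<^sup>2) ` S"
  define d where "d = Inf ?Q"
  define r where "r n = inverse (real (Suc n))" for n
  have bdd: "bdd_below ?Q" by (auto intro!: bdd_belowI[of _ 0])
  have ne: "?Q \<noteq> {}" using subspace_0[OF assms(1)] by blast
  have d_le: "d \<le> (norm (x - y))\<^sup>2" if "y \<in> S" for y
    unfolding d_def using that bdd by (intro cInf_lower) auto
  have "\<exists>y\<in>S. (norm (x - y))\<^sup>2 < d + r n" for n
    using cInf_lessD[OF ne, of "d + r n"] by (auto simp: d_def r_def)
  then obtain y where yS: "\<And>n. y n \<in> S"
    and y: "\<And>n. (norm (x - y n))\<^sup>2 < d + r n" by metis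
  have par: "(norm (y n - y m))\<^sup>2 \<le> 2 * (r n + r m)" for n m
  proof -
    define w where "w = (1/2) *\<^sub>R (y n + y m)"
    have "w \<in> S"
      using assms(1) yS unfolding w_def by (simp add: subspace_add subspace_scale)
    from d_le[OF this] have "d \<le> (norm (x - w))\<^sup>2" .
    moreover have "(norm (y n - y m))\<^sup>2 =
        2 * (norm (x - y n))\<^sup>2 + 2 * (norm (x - y m))\<^sup>2 - 4 * (norm (x - w))\<^sup>2"
      unfolding power2_norm_eq_inner w_def
      by (simp add: inner_diff inner_add algebra_simps inner_commute)
    ultimately show ?thesis unfolding distrib_left using y[of n] y[of m] by linarith
  qed
  have "Cauchy y"
  proof (rule metric_CauchyI)
    fix e :: real assume "e > 0"
    then obtain N where N: "r N < e\<^sup>2 / 4"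
      using reals_Archimedean[of "e\<^sup>2/4"] by (auto simp: r_def)
    have "dist (y m) (y n) < e" if "m \<ge> N" "n \<ge> N" for m n
    proof -
      have "r m \<le> r N" "r n \<le> r N"
        using that unfolding r_def by (auto intro!: le_imp_inverse_le)
      with par[of m n, unfolded distrib_left] N have "(norm (y m - y n))\<^sup>2 < e\<^sup>2" by linarith
      then show ?thesis using \<open>e > 0\<close> by (simp add: dist_norm power_less_imp_less_base)
    qed
    then show "\<exists>M. \<forall>m\<ge>M. \<forall>n\<ge>M. dist (y m) (y n) < e" by blast
  qed
  then obtain p where p: "y \<longlonglongrightarrow> p" using Cauchy_convergent convergent_def by blast
  have pS: "p \<in> S" using closed_sequentially[OF assms(2) _ p] yS by blast
  have "(\<lambda>n. (norm (x - y n))\<^sup>2) \<longlonglongrightarrow> (norm (x - p))\<^sup>2" by (intro tendsto_intros p)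
  moreover have "(\<lambda>n. d + r n) \<longlonglongrightarrow> d + 0"
    unfolding r_def by (intro tendsto_intros LIMSEQ_inverse_real_of_nat)
  ultimately have min: "(norm (x - p))\<^sup>2 \<le> d"
    using y by (intro LIMSEQ_le[of _ "(norm (x - p))\<^sup>2" _ d]) (auto intro: less_imp_le)
  have "inner (x - p) z = 0" if "z \<in> S" for z
  proof (cases "z = 0")
    case False
    \<comment> \<open>This \<open>t\<close> minimizes the squared distance from x to the line p + t
      z. The gain over p is the square of \<open>inner (x - p) z\<close> divided by
      \<open>inner z z\<close>, and minimality of p forces it to be zero.\<close>
    define t where "t = inner (x - p) z / inner z z"
    have "p + t *\<^sub>R z \<in> S" using assms(1) pS that by (simp add: subspace_add subspace_scale)
    from d_le[OF this] min have "inner (x - p) (x - p) \<le> inner (x - (p + t *\<^sub>R z)) (x - (p + t *\<^sub>R z))"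
      unfolding power2_norm_eq_inner by linarith
    also have "\<dots> = inner (x - p) (x - p) - 2 * t * inner (x - p) z + t * t * inner z z"
      by (simp add: inner_diff inner_add algebra_simps inner_commute)
    also have "\<dots> = inner (x - p) (x - p) - (inner (x - p) z)\<^sup>2 / inner z z"
      using False by (simp add: t_def field_simps power2_eq_square)
    finally have "(inner (x - p) z)\<^sup>2 / inner z z \<le> 0" by simp
    moreover have "inner z z > 0" using False by simp
    ultimately show ?thesis by (simp add: divide_le_0_iff)
  qed simp
  with pS that show ?thesis by blast
qed

text \<open>The kernel of f is a closed subspace. For \<open>a\<close> outside it, the residual e =
  a - p spans the orthogonal complement, and a suitable multiple of e represents f.\<close>

lemma riesz_representation:
  fixes f :: "'a::{real_inner,banach} \<Rightarrow> real"
  assumes "bounded_linear f"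
  obtains y where "\<And>x. f x = inner x y"
proof (cases "\<forall>x. f x = 0")
  case True
  then show ?thesis using that[of 0] by simp
next
  case False
  interpret f: bounded_linear f by fact
  obtain a where a: "f a \<noteq> 0" using False by blast
  let ?S = "{x. f x = 0}"
  have "subspace ?S" by (auto simp: subspace_def f.add f.scaleR f.zero)
  moreover have "closed ?S"
    by (intro closed_Collect_eq continuous_on_const linear_continuous_on assms)
  ultimately obtain p where p: "f p = 0" and orth: "\<And>z. f z = 0 \<Longrightarrow> inner (a - p) z = 0"
    using orthogonal_projection_exists[of ?S a] by auto
  define e where "e = a - p"
  have fe: "f e = f a" unfolding e_def by (simp add: f.diff p)
  then have e0: "e \<noteq> 0" using a f.zero by auto
  have "f x = inner x ((f e / inner e e) *\<^sub>R e)" for x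
  proof -
    have "f (x - (f x / f e) *\<^sub>R e) = 0" using a fe by (simp add: f.diff f.scaleR)
    from orth[OF this] have "inner e x = f x / f e * inner e e"
      unfolding e_def by (simp add: inner_diff_right)
    then show ?thesis using e0 a fe by (simp add: inner_commute field_simps)
  qed
  then show ?thesis using that by blast
qed

lemma subspace_closure:
  fixes S :: "'a::real_normed_vector set"
  assumes "subspace S"
  shows "subspace (closure S)"
proof (rule subspaceI)
  show "0 \<in> closure S" using subspace_0[OF assms] closure_subset by blast
next
  fix x y assume "x \<in> closure S" "y \<in> closure S"
  then obtain f g where "\<And>n. f n \<in> S" "f \<longlonglongrightarrow> x" "\<And>n. g n \<in> S" "g \<longlonglongrightarrow> y"
    unfolding closure_sequential by metis
  then show "x + y \<in> closure S" unfolding closure_sequential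
    using assms by (intro exI[of _ "\<lambda>n. f n + g n"]) (auto intro: tendsto_add subspace_add)
next
  fix c x assume "x \<in> closure S"
  then obtain f where "\<And>n. f n \<in> S" "f \<longlonglongrightarrow> x"
    unfolding closure_sequential by metis
  then show "c *\<^sub>R x \<in> closure S" unfolding closure_sequential
    using assms by (intro exI[of _ "\<lambda>n. c *\<^sub>R f n"]) (auto intro: tendsto_scaleR subspace_scale)
qed

text \<open>The residual of the projection onto the closure of \<open>S\<close> is orthogonal to
  \<open>S\<close>, hence zero.\<close>

lemma dense_if_orthogonal_trivial:
  fixes S :: "'a::{real_inner,banach} set"
  assumes "subspace S" "\<And>x. (\<And>z. z \<in> S \<Longrightarrow> inner x z = 0) \<Longrightarrow> x = 0"
  shows "closure S = UNIV"
proof -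
  have "x \<in> closure S" for x
  proof -
    obtain y where y: "y \<in> closure S" "\<And>z. z \<in> closure S \<Longrightarrow> inner (x - y) z = 0"
      using orthogonal_projection_exists[OF subspace_closure[OF assms(1)] closed_closure] by metis
    then have "x - y = 0" using closure_subset by (intro assms(2)) blast
    with y show ?thesis by simp
  qed
  then show ?thesis by blast
qed

text \<open>Mean value theorem for energies that are differentiable only from the right at 0. With c
  = 0 it gives decay, with a general c the linear growth bound in \<open>u_diff_le\<close>.\<close>

lemma nonincreasing_on_halfline:
  fixes f :: "real \<Rightarrow> real"
  assumes "\<And>s. s \<ge> 0 \<Longrightarrow> (f has_real_derivative f' s) (at s within {0..})"
    and "\<And>s. s \<ge> 0 \<Longrightarrow> f' s \<le> c" and "t \<ge> 0"
  shows "f t \<le> f 0 + c * t"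
proof (cases "t = 0")
  case False
  then have "t > 0" using assms(3) by simp
  have "\<And>x. 0 \<le> x \<Longrightarrow> x \<le> t \<Longrightarrow> (f has_derivative (\<lambda>h. f' x * h)) (at x within {0..t})"
    using assms(1) unfolding has_field_derivative_def
    by (meson has_derivative_subset atLeastAtMost_iff atLeast_iff subsetI)
  then obtain \<xi> where "0 < \<xi>" "\<xi> < t" "f t - f 0 = f' \<xi> * (t - 0)"
    using mvt_simple[OF \<open>t > 0\<close>, of f "\<lambda>x h. f' x * h"] by auto
  moreover have "f' \<xi> * t \<le> c * t" using assms(2)[of \<xi>] \<open>t > 0\<close> \<open>0 < \<xi>\<close> by (intro mult_right_mono) auto
  ultimately show ?thesis unfolding diff_0_right by linarith
qed simp

lemma power2_norm_has_real_derivative: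
  fixes u :: "real \<Rightarrow> 'a::real_inner"
  assumes "(u has_vector_derivative u') (at t within S)"
  shows "((\<lambda>t. (norm (u t))\<^sup>2) has_real_derivative 2 * inner u' (u t)) (at t within S)"
proof -
  have "((\<lambda>t. inner (u t) (u t)) has_derivative (\<lambda>h. inner (u t) (h *\<^sub>R u') + inner (h *\<^sub>R u') (u t))) (at t within S)"
    using assms unfolding has_vector_derivative_def by (intro has_derivative_inner) auto
  then show ?thesis unfolding has_field_derivative_def power2_norm_eq_inner
    by (rule has_derivative_eq_rhs) (auto simp: fun_eq_iff inner_commute)
qed

section \<open>The semigroup generated by a contraction minus the identity\<close>

text \<open>Yosida approximations have the form l (K - 1) with a contraction K, so their
  exponentials are rescalings of e^(t (K - 1)) = e^(-t) e^(t K). The bound on K makes the power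
  series converge.\<close>

locale contraction =
  fixes K :: "'a::{real_inner,banach} \<Rightarrow> 'a"
  assumes linear: "linear K" and norm_le: "\<And>x. norm (K x) \<le> norm x"
begin

lemma linear_funpow: "linear (K ^^ n)"
  by (induction n) (auto intro: linear_compose linear simp: linear_id[unfolded id_def] o_def[symmetric] simp del: o_apply)

lemma norm_funpow_le: "norm ((K ^^ n) x) \<le> norm x"
  by (induction n) (auto intro: order_trans[OF norm_le])

definition tm :: "real \<Rightarrow> 'a \<Rightarrow> nat \<Rightarrow> 'a"
  where "tm t x n = (t ^ n / fact n) *\<^sub>R (K ^^ n) x"

definition E :: "real \<Rightarrow> 'a \<Rightarrow> 'a" where "E t x = (\<Sum>n. tm t x n)"

lemma norm_tm_le: "norm (tm t x n) \<le> (\<bar>t\<bar> ^ n / fact n) * norm x"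
  unfolding tm_def norm_scaleR by (intro mult_mono norm_funpow_le) (auto simp: power_abs)

lemma summable_exp_bound: "summable (\<lambda>n. (s ^ n / fact n) * r)" for s r :: real
  using summable_mult2[OF summable_exp[of s], of r] by (simp add: field_simps)

lemma summable_norm_tm: "summable (\<lambda>n. norm (tm t x n))"
  by (rule summable_comparison_test'[OF summable_exp_bound[of "\<bar>t\<bar>" "norm x"], of 0])
     (use norm_tm_le in auto)

lemma summable_tm: "summable (tm t x)"
  using summable_norm_tm summable_norm_cancel by blast

lemma norm_E_le: "norm (E t x) \<le> exp \<bar>t\<bar> * norm x"
proof -
  have "norm (E t x) \<le> (\<Sum>n. norm (tm t x n))"
    unfolding E_def by (rule summable_norm[OF summable_norm_tm])
  also have "\<dots> \<le> (\<Sum>n. (\<bar>t\<bar> ^ n / fact n) * norm x)"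
    by (intro suminf_le summable_norm_tm summable_exp_bound norm_tm_le)
  also have "\<dots> = exp \<bar>t\<bar> * norm x"
    using suminf_mult2[OF summable_exp[of "\<bar>t\<bar>"], of "norm x"]
    by (simp add: exp_def field_simps)
  finally show ?thesis .
qed

lemma linear_E: "linear (E t)"
proof (rule linearI)
  show "E t (x + y) = E t x + E t y" for x y
    using suminf_add[OF summable_tm[of t x] summable_tm[of t y]]
    by (simp add: E_def tm_def[abs_def] linear_add[OF linear_funpow] scaleR_add_right)
  show "E t (r *\<^sub>R x) = r *\<^sub>R E t x" for r x
    using suminf_scaleR_right[OF summable_tm[of t x], of r]
    by (simp add: E_def tm_def[abs_def] linear_scale[OF linear_funpow] mult.commute)
qed

lemma K_E: "K (E t x) = E t (K x)"
proof -
  interpret bounded_linear K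
    by (rule bounded_linear_intro[where K=1]) (use linear norm_le in \<open>auto simp: linear_add linear_scale\<close>)
  have "K (E t x) = (\<Sum>n. K (tm t x n))" unfolding E_def by (rule suminf[OF summable_tm])
  also have "(\<lambda>n. K (tm t x n)) = tm t (K x)"
    by (simp add: tm_def scaleR fun_eq_iff funpow_swap1[of K] del: funpow.simps)
  finally show ?thesis by (simp add: E_def)
qed

lemma E_0: "E 0 x = x"
proof -
  have "tm 0 x sums (\<Sum>n\<in>{0}. tm 0 x n)"
    by (rule sums_finite) (auto simp: tm_def)
  then show ?thesis unfolding E_def by (simp add: tm_def sums_iff)
qed

text \<open>Termwise differentiation of the power series, justified by the M-test for the derived
  series on an interval that contains t and also 0, where convergence of the original series is
  anchored.\<close>

lemma E_has_vector_derivative: "((\<lambda>t. E t x) has_vector_derivative E t (K x)) (at t)"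
proof -
  define T where "T = \<bar>t\<bar> + 1"
  let ?S = "{-T<..<T}"
  \<comment> \<open>Differentiation shifts the index: the constant term drops out, and every other
    term becomes the preceding one evaluated at \<open>K x\<close>.\<close>
  define f' where "f' n s = (case n of 0 \<Rightarrow> 0 | Suc m \<Rightarrow> tm s (K x) m)" for n s
  have sums': "(\<lambda>n. f' n s) sums E s (K x)" for s
    using sums_Suc_iff[of "\<lambda>n. f' n s" "E s (K x)"] summable_sums[OF summable_tm[of s "K x"]]
    by (simp add: f'_def E_def)
  have ul: "uniform_limit ?S (\<lambda>n s. \<Sum>i<n. f' i s) (\<lambda>s. E s (K x)) sequentially"
  proof -
    let ?M = "\<lambda>n. case n of 0 \<Rightarrow> 0 | Suc m \<Rightarrow> (T ^ m / fact m) * norm (K x)"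
    have "summable ?M"
      using summable_exp_bound[of T "norm (K x)"] by (subst summable_Suc_iff[symmetric]) simp
    moreover have "norm (f' n s) \<le> ?M n" if "s \<in> ?S" for n s
    proof (cases n)
      case (Suc m)
      have "(\<bar>s\<bar> ^ m / fact m) * norm (K x) \<le> (T ^ m / fact m) * norm (K x)"
        using that by (intro mult_right_mono divide_right_mono power_mono) auto
      then show ?thesis using norm_tm_le[of s "K x" m] Suc by (simp add: f'_def)
    qed (simp add: f'_def)
    ultimately have "uniform_limit ?S (\<lambda>n s. \<Sum>i<n. f' i s) (\<lambda>s. suminf (\<lambda>i. f' i s)) sequentially"
      by (intro Weierstrass_m_test)
    then show ?thesis using sums' by (simp add: sums_iff)
  qed
  have "\<exists>g. \<forall>s\<in>?S. (\<lambda>n. tm s x n) sums g s \<and> (g has_derivative (\<lambda>h. h *\<^sub>R E s (K x))) (at s within ?S)"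
  proof (rule has_derivative_series)
    show "convex ?S" by simp
    show "0 \<in> ?S" unfolding T_def greaterThanLessThan_iff by (intro conjI; linarith)
    show "(\<lambda>n. tm 0 x n) sums E 0 x" unfolding E_def by (rule summable_sums[OF summable_tm])
    show "((\<lambda>s. tm s x n) has_derivative (\<lambda>h. h *\<^sub>R f' n s)) (at s within ?S)" for n s
    proof (cases n)
      case 0
      then show ?thesis by (simp add: tm_def f'_def)
    next
      case (Suc m)
      have "((\<lambda>s. s ^ n / fact n) has_real_derivative (real n * s ^ m / fact n)) (at s within ?S)"
        using DERIV_cdivide[OF DERIV_power[OF DERIV_ident, of n s], of "fact n"] Suc by simp
      also have "real n * s ^ m / fact n = s ^ m / fact m" using Suc by (simp del: of_nat_Suc)
      finally have "((\<lambda>s. s ^ n / fact n) has_derivative (*) (s ^ m / fact m)) (at s within ?S)"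
        unfolding has_field_derivative_def .
      then have "((\<lambda>s. s ^ n / fact n) has_derivative (\<lambda>h. h * (s ^ m / fact m))) (at s within ?S)"
        by (rule has_derivative_eq_rhs) (simp add: fun_eq_iff)
      then have "((\<lambda>s. (s ^ n / fact n) *\<^sub>R (K ^^ n) x) has_derivative
          (\<lambda>h. (h * (s ^ m / fact m)) *\<^sub>R (K ^^ n) x)) (at s within ?S)"
        by (rule has_derivative_scaleR_left)
      then show ?thesis using Suc by (simp add: tm_def f'_def funpow_swap1[of K] mult.commute)
    qed
    show "\<forall>\<^sub>F n in sequentially. \<forall>s\<in>?S. \<forall>h. norm ((\<Sum>i<n. h *\<^sub>R f' i s) - h *\<^sub>R E s (K x)) \<le> e * norm h"
      if "e > 0" for e :: real
    proof -
      have "\<forall>\<^sub>F n in sequentially. \<forall>s\<in>?S. dist (\<Sum>i<n. f' i s) (E s (K x)) < e"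
        using ul that unfolding uniform_limit_iff by blast
      then show ?thesis
      proof eventually_elim
        case (elim n)
        show ?case
        proof (intro ballI allI)
          fix s h assume "s \<in> ?S"
          with elim have "norm ((\<Sum>i<n. f' i s) - E s (K x)) \<le> e" by (auto simp: dist_norm less_imp_le)
          then show "norm ((\<Sum>i<n. h *\<^sub>R f' i s) - h *\<^sub>R E s (K x)) \<le> e * norm h"
            unfolding scaleR_sum_right[symmetric] scaleR_diff_right[symmetric] norm_scaleR
            unfolding mult.commute[of e] real_norm_def by (intro mult_left_mono) auto
        qed
      qed
    qed
  qed
  then obtain g where sums: "\<And>s. s \<in> ?S \<Longrightarrow> (\<lambda>n. tm s x n) sums g s"
    and g': "\<And>s. s \<in> ?S \<Longrightarrow> (g has_vector_derivative E s (K x)) (at s within ?S)"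
    unfolding has_vector_derivative_def by blast
  have g: "g s = E s x" if "s \<in> ?S" for s
    using sums_unique[OF sums[OF that]] by (simp add: E_def)
  have t: "t \<in> ?S" unfolding T_def greaterThanLessThan_iff by (intro conjI; linarith)
  have "(g has_vector_derivative E t (K x)) (at t)"
    using g'[OF t] unfolding at_within_open[OF t open_greaterThanLessThan] .
  then show ?thesis
    by (rule has_vector_derivative_transform_within_open[of _ _ _ ?S]) (use t g in auto)
qed

text \<open>The exponential of t (K - 1). For t >= 0 the prefactor absorbs exactly the growth e^t of
  \<open>E\<close>, so \<open>S\<close> is a contraction.\<close>

definition S :: "real \<Rightarrow> 'a \<Rightarrow> 'a" where "S t x = exp (-t) *\<^sub>R E t x"

lemma S_0: "S 0 x = x" by (simp add: S_def E_0)

lemma norm_S_le: "t \<ge> 0 \<Longrightarrow> norm (S t x) \<le> norm x"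
  using norm_E_le[of t x] by (simp add: S_def exp_minus field_simps)

lemma linear_S: "linear (S t)"
  unfolding S_def using linear_E
  by (intro linearI) (auto simp: linear_add linear_scale scaleR_add_right)

lemma K_S: "K (S t x) = S t (K x)"
  by (simp add: S_def linear_scale[OF linear] K_E)

lemma S_has_vector_derivative: "((\<lambda>t. S t x) has_vector_derivative S t (K x - x)) (at t)"
proof -
  have "((\<lambda>t. exp (-t)) has_real_derivative - exp (-t)) (at t)"
    by (auto intro!: derivative_eq_intros)
  from has_vector_derivative_scaleR[OF this E_has_vector_derivative[of x t]]
  show ?thesis by (simp add: S_def linear_diff[OF linear_E] scaleR_diff_right)
qed

end

text \<open>Testing against all y identifies f with the integral of g; since g is continuous, the
  fundamental theorem upgrades the weak identity to a derivative in norm.\<close>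

lemma has_vector_derivative_if_weak:
  fixes f g :: "real \<Rightarrow> 'a::{real_inner,banach}"
  assumes "continuous_on {0..} g"
    and int: "\<And>t y. t \<ge> 0 \<Longrightarrow> ((\<lambda>s. inner (g s) y) has_integral inner (f t) y) {0..t}"
    and "t \<ge> 0"
  shows "(f has_vector_derivative g t) (at t within {0..})"
proof -
  have cont: "continuous_on {0..r} g" for r by (rule continuous_on_subset[OF assms(1)]) auto
  have eq: "f r = integral {0..r} g" if "r \<ge> 0" for r
  proof -
    have "inner (f r) y = inner (integral {0..r} g) y" for y
    proof (rule has_integral_unique[OF int[OF that]])
      have "(g has_integral integral {0..r} g) {0..r}"
        by (intro integrable_integral integrable_continuous_real cont)
      from has_integral_linear[OF this bounded_linear_inner_left]
      show "((\<lambda>s. inner (g s) y) has_integral inner (integral {0..r} g) y) {0..r}" by (simp add: o_def)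
    qed
    then show ?thesis by (metis inner_eq_zero_iff inner_diff_left right_minus_eq)
  qed
  have t: "t \<in> {0..t+1}" using assms(3) by simp
  have "(f has_vector_derivative g t) (at t within {0..t+1})"
    by (rule has_vector_derivative_transform[OF t _ integral_has_vector_derivative[OF cont t]]) (simp add: eq)
  moreover have "at t within {0..t+1} = at t within {0..}"
    using assms by (intro at_within_nhd[of _ "{..<t+1}"]) auto
  ultimately show ?thesis by simp
qed

section \<open>Maximal dissipative operators\<close>

text \<open>Dissipativity bounds the resolvent for every l > 0. The constant \<open>c\<close>
  restricts surjectivity only: for the coupled system it comes from a fixed point argument that
  contracts for large l.\<close>

locale max_dissipative =
  fixes D :: "'a::{real_inner,banach} set" and A :: "'a \<Rightarrow> 'a" and c :: real
  assumes subspace_D: "subspace D"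
    and A_add: "x \<in> D \<Longrightarrow> y \<in> D \<Longrightarrow> A (x + y) = A x + A y"
    and A_scaleR: "x \<in> D \<Longrightarrow> A (r *\<^sub>R x) = r *\<^sub>R A x"
    and dissipative: "x \<in> D \<Longrightarrow> inner (A x) x \<le> 0"
    and c_nonneg: "0 \<le> c"
    and range: "l > c \<Longrightarrow> \<exists>x\<in>D. l *\<^sub>R x - A x = f"
begin

lemma A_0: "A 0 = 0"
  using A_scaleR[OF subspace_0[OF subspace_D], of 0] by simp

lemma A_diff: "x \<in> D \<Longrightarrow> y \<in> D \<Longrightarrow> A (x - y) = A x - A y"
  using A_add[of x "- y"] A_scaleR[of y "-1"] subspace_neg[OF subspace_D] by simp

lemma norm_resolvent_le:
  assumes "x \<in> D" "l > 0"
  shows "l * norm x \<le> norm (l *\<^sub>R x - A x)"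
proof (rule power2_le_imp_le)
  have "(norm (l *\<^sub>R x - A x))\<^sup>2 = (l * norm x)\<^sup>2 - 2 * l * inner (A x) x + (norm (A x))\<^sup>2"
    unfolding power_mult_distrib power2_norm_eq_inner
    by (simp add: inner_diff algebra_simps inner_commute power2_eq_square)
  moreover have "2 * l * inner (A x) x \<le> 0"
    using dissipative[OF assms(1)] assms(2) by (simp add: mult_le_0_iff)
  ultimately show "(l * norm x)\<^sup>2 \<le> (norm (l *\<^sub>R x - A x))\<^sup>2"
    using zero_le_power2[of "norm (A x)"] by linarith
qed simp

lemma resolvent_unique:
  assumes "x \<in> D" "y \<in> D" "l > 0" "l *\<^sub>R x - A x = l *\<^sub>R y - A y"
  shows "x = y"
proof -
  have "l * norm (x - y) \<le> norm (l *\<^sub>R (x - y) - A (x - y))"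
    by (rule norm_resolvent_le) (use assms subspace_diff[OF subspace_D] in auto)
  also have "l *\<^sub>R (x - y) - A (x - y) = (l *\<^sub>R x - A x) - (l *\<^sub>R y - A y)"
    by (simp add: A_diff assms(1,2) algebra_simps)
  finally have "l * norm (x - y) \<le> 0" using assms by simp
  then show ?thesis using assms(3) by (simp add: mult_le_0_iff)
qed

definition R :: "real \<Rightarrow> 'a \<Rightarrow> 'a"
  where "R l f = (SOME x. x \<in> D \<and> l *\<^sub>R x - A x = f)"

lemma R:
  assumes "l > c" shows R_in_D: "R l f \<in> D" and R_eq: "l *\<^sub>R R l f - A (R l f) = f"
  using someI_ex[of "\<lambda>x. x \<in> D \<and> l *\<^sub>R x - A x = f"] range[OF assms, of f]
  by (auto simp: R_def)

lemma R_eqI: "l > c \<Longrightarrow> x \<in> D \<Longrightarrow> l *\<^sub>R x - A x = f \<Longrightarrow> R l f = x"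
  using resolvent_unique[of "R l f" x l] R[of l f] c_nonneg by simp

lemma A_R: "l > c \<Longrightarrow> A (R l f) = l *\<^sub>R R l f - f"
  using R_eq[of l f] by (simp add: algebra_simps)

lemma linear_R: "l > c \<Longrightarrow> linear (R l)"
  by (intro linearI R_eqI)
     (auto simp: subspace_add[OF subspace_D] subspace_scale[OF subspace_D] R_in_D A_add A_scaleR A_R algebra_simps)

lemma norm_R_le: "l > c \<Longrightarrow> l * norm (R l f) \<le> norm f"
  using norm_resolvent_le[of "R l f" l] R[of l f] c_nonneg by simp

lemma bounded_linear_R:
  assumes "l > c" shows "bounded_linear (R l)"
proof (rule bounded_linear_intro[where K="1/l"])
  show "norm (R l x) \<le> norm x * (1 / l)" for x
    using norm_R_le[OF assms, of x] assms c_nonneg by (simp add: field_simps)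
qed (use linear_R[OF assms] in \<open>auto simp: linear_add linear_scale\<close>)

lemma dense: "closure D = UNIV"
proof (rule dense_if_orthogonal_trivial[OF subspace_D])
  fix x assume x: "\<And>z. z \<in> D \<Longrightarrow> inner x z = 0"
  define l where "l = c + 1"
  have l: "l > c" "l > 0" using c_nonneg by (auto simp: l_def)
  let ?v = "R l x"
  have "0 = inner (l *\<^sub>R ?v - A ?v) ?v" using x[OF R_in_D] R_eq l by simp
  also have "\<dots> = l * (norm ?v)\<^sup>2 - inner (A ?v) ?v"
    by (simp add: inner_diff power2_norm_eq_inner)
  finally have "l * (norm ?v)\<^sup>2 \<le> 0" using dissipative[OF R_in_D[OF l(1), of x]] by linarith
  then have "?v = 0" using l by (simp add: mult_le_0_iff)
  then show "x = 0" using R_eq[OF l(1), of x] A_0 by simp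
qed

subsection \<open>Yosida approximation\<close>

text \<open>In operator notation \<open>K l\<close> is l (l - A)^-1, an approximation of the
  identity with values in D, and \<open>Y l\<close> = A (K l) is the Yosida approximation, a bounded
  operator on the whole space.\<close>

definition K :: "real \<Rightarrow> 'a \<Rightarrow> 'a" where "K l x = l *\<^sub>R R l x"
definition Y :: "real \<Rightarrow> 'a \<Rightarrow> 'a" where "Y l x = l *\<^sub>R (K l x - x)"

lemma contraction_K: "l > c \<Longrightarrow> contraction (K l)"
  unfolding K_def using norm_R_le[of l] c_nonneg linear_R[of l]
  by (unfold_locales) (auto intro!: linearI simp: linear_add linear_scale scaleR_add_right)

lemma K_in_D: "l > c \<Longrightarrow> K l x \<in> D"
  by (simp add: K_def subspace_scale[OF subspace_D] R_in_D)

lemma A_K: "l > c \<Longrightarrow> A (K l x) = Y l x"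
  by (simp add: K_def Y_def A_scaleR R_in_D A_R algebra_simps)

lemma K_A: "l > c \<Longrightarrow> x \<in> D \<Longrightarrow> K l (A x) = Y l x"
proof -
  assume l: "l > c" and x: "x \<in> D"
  have "R l (l *\<^sub>R x - A x) = x" using l x by (intro R_eqI) auto
  then have "R l (A x) = l *\<^sub>R R l x - x"
    using linear_R[OF l] by (simp add: linear_diff linear_scale algebra_simps)
  then show ?thesis by (simp add: K_def Y_def)
qed

lemma norm_Y_le: "l > c \<Longrightarrow> x \<in> D \<Longrightarrow> norm (Y l x) \<le> norm (A x)"
  using contraction.norm_le[OF contraction_K, of l "A x"] K_A[of l x] by simp

lemma diff_K: "l > c \<Longrightarrow> x - K l x = - (1/l) *\<^sub>R Y l x"
  using c_nonneg by (simp add: Y_def algebra_simps)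

text \<open>The flow e^(t Y) x with Y = \<open>Y l\<close>, because t (Y l) = (l t) (K l -
  1).\<close>

definition u :: "real \<Rightarrow> 'a \<Rightarrow> real \<Rightarrow> 'a"
  where "u l x t = contraction.S (K l) (l * t) x"

context
  fixes l assumes l: "l > c"
begin

interpretation contraction "K l" by (rule contraction_K[OF l])

lemma l_pos: "l > 0" using l c_nonneg by simp

lemma u_0: "u l x 0 = x" by (simp add: u_def S_0)

lemma norm_u_le: "t \<ge> 0 \<Longrightarrow> norm (u l x t) \<le> norm x"
  using l_pos by (simp add: u_def norm_S_le)

lemma u_add: "u l (x + y) t = u l x t + u l y t"
  and u_diff: "u l (x - y) t = u l x t - u l y t"
  and u_scaleR: "u l (r *\<^sub>R x) t = r *\<^sub>R u l x t"
  by (auto simp: u_def linear_add linear_diff linear_scale linear_S)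

lemma Y_u: "Y l (u l x t) = u l (Y l x) t"
  by (simp add: Y_def u_def K_S linear_diff[OF linear_S] linear_scale[OF linear_S])

lemma u_has_vector_derivative: "(u l x has_vector_derivative u l (Y l x) t) (at t within T)"
proof -
  have "((\<lambda>t. S t x) \<circ> (\<lambda>t. l * t) has_vector_derivative l *\<^sub>R S (l * t) (K l x - x)) (at t)"
    by (rule vector_diff_chain_at) (auto intro!: derivative_eq_intros S_has_vector_derivative)
  then show ?thesis
    by (auto simp: o_def u_def[abs_def] Y_def linear_scale[OF linear_S] intro: has_vector_derivative_at_within)
qed

lemma norm_Y_u_le: "t \<ge> 0 \<Longrightarrow> x \<in> D \<Longrightarrow> norm (Y l (u l x t)) \<le> norm (A x)"
  using norm_u_le[of t "Y l x"] norm_Y_le[OF l, of x] by (simp add: Y_u)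

end

text \<open>Dissipativity is available only inside D. So x - y is split into K l x - K m y, which A
  maps to Y l x - Y m y, and the two defects Y l x / l and Y m y / m, which are small for large l
  and m.\<close>

lemma Yosida_energy:
  assumes "l > c" "m > c"
  shows "inner (x - y) (Y l x - Y m y) \<le> (norm (Y l x) + norm (Y m y))\<^sup>2 * (1/l + 1/m)"
proof -
  let ?a = "Y l x" and ?b = "Y m y"
  have pos: "l > 0" "m > 0" using assms c_nonneg by auto
  have eq: "x - y = (K l x - K m y) + ((1/m) *\<^sub>R ?b - (1/l) *\<^sub>R ?a)"
  proof -
    have "x - y = (K l x - K m y) + ((x - K l x) - (y - K m y))" by simp
    then show ?thesis unfolding diff_K[OF assms(1)] diff_K[OF assms(2)] by simp
  qed
  have "inner (K l x - K m y) (?a - ?b) = inner (A (K l x - K m y)) (K l x - K m y)"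
    using A_K K_in_D assms by (simp add: A_diff inner_commute)
  also have "\<dots> \<le> 0" using K_in_D assms by (intro dissipative subspace_diff[OF subspace_D])
  finally have "inner (x - y) (?a - ?b) \<le> inner ((1/m) *\<^sub>R ?b - (1/l) *\<^sub>R ?a) (?a - ?b)"
    by (subst eq) (simp add: inner_add_left)
  also have "\<dots> \<le> norm ((1/m) *\<^sub>R ?b - (1/l) *\<^sub>R ?a) * norm (?a - ?b)" by (rule norm_cauchy_schwarz)
  also have "\<dots> \<le> ((1/m) * norm ?b + (1/l) * norm ?a) * (norm ?a + norm ?b)"
    using pos norm_triangle_ineq4[of "(1/m) *\<^sub>R ?b" "(1/l) *\<^sub>R ?a"]
    by (intro mult_mono norm_triangle_ineq4) auto
  also have "\<dots> \<le> ((1/m) * (norm ?a + norm ?b) + (1/l) * (norm ?a + norm ?b)) * (norm ?a + norm ?b)"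
    using pos by (intro mult_right_mono add_mono mult_left_mono) auto
  finally show ?thesis by (simp add: power2_eq_square algebra_simps)
qed

text \<open>Both flows start at x, so the energy of their difference starts at 0. Along the flows
  the norms of Y stay below \<open>norm (A x)\<close>; hence the energy grows at a rate of at most 2
  (2 |A x|)^2 (1/l + 1/m), which is the factor 8.\<close>

lemma u_diff_le:
  assumes "l > c" "m > c" "x \<in> D" "t \<ge> 0"
  shows "(norm (u l x t - u m x t))\<^sup>2 \<le> 8 * (norm (A x))\<^sup>2 * (1/l + 1/m) * t"
proof -
  let ?w = "\<lambda>t. u l x t - u m x t" and ?w' = "\<lambda>t. Y l (u l x t) - Y m (u m x t)"
  have "((\<lambda>t. (norm (?w t))\<^sup>2) has_real_derivative 2 * inner (?w' s) (?w s)) (at s within {0..})" for s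
    using assms by (intro power2_norm_has_real_derivative has_vector_derivative_diff)
      (simp_all add: Y_u u_has_vector_derivative)
  moreover have "2 * inner (?w' s) (?w s) \<le> 8 * (norm (A x))\<^sup>2 * (1/l + 1/m)" if "s \<ge> 0" for s
  proof -
    have "inner (?w s) (?w' s) \<le> (norm (Y l (u l x s)) + norm (Y m (u m x s)))\<^sup>2 * (1/l + 1/m)"
      using assms by (intro Yosida_energy)
    also have "\<dots> \<le> (norm (A x) + norm (A x))\<^sup>2 * (1/l + 1/m)"
      using assms that c_nonneg by (intro mult_right_mono power_mono add_mono norm_Y_u_le) auto
    also have "(norm (A x) + norm (A x))\<^sup>2 * (1/l + 1/m) = 4 * (norm (A x))\<^sup>2 * (1/l + 1/m)"
      by (simp add: power2_eq_square)
    finally show ?thesis unfolding inner_commute[of "?w s"] by linarith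
  qed
  ultimately have "(norm (?w t))\<^sup>2 \<le> (norm (?w 0))\<^sup>2 + 8 * (norm (A x))\<^sup>2 * (1/l + 1/m) * t"
    using assms(4) by (intro nonincreasing_on_halfline)
  then show ?thesis using assms by (simp add: u_0)
qed

definition l :: "nat \<Rightarrow> real" where "l n = c + real (Suc n)"

lemma l_gt: "l n > c" by (simp add: l_def)

lemma inverse_l: "(\<lambda>n. 1 / l n) \<longlonglongrightarrow> 0"
proof -
  have "filterlim (\<lambda>n. c + real (Suc n)) at_top sequentially"
    by (intro filterlim_tendsto_add_at_top[OF tendsto_const]
        filterlim_compose[OF filterlim_real_sequentially filterlim_Suc])
  then show ?thesis unfolding l_def by (intro tendsto_divide_0[OF tendsto_const] filterlim_at_top_imp_at_infinity)
qed

text \<open>The bound of \<open>u_diff_le\<close> needs a starting point in D. A general x is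
  replaced by some y in D closer than e/4; by contraction each of the two flows of x - y costs less
  than e/4, uniformly in time.\<close>

lemma u_uniformly_Cauchy:
  assumes "T \<ge> 0"
  shows "uniformly_Cauchy_on {0..T} (\<lambda>n. u (l n) x)"
proof (rule uniformly_Cauchy_onI)
  fix e :: real assume e: "e > 0"
  obtain y where y: "y \<in> D" "dist y x < e / 4"
    using dense e closure_approachable[of x D] by (auto dest: spec[of _ "e/4"])
  define M where "M = 8 * (norm (A y))\<^sup>2 * T"
  have "(\<lambda>n. M * (1 / l n)) \<longlonglongrightarrow> M * 0" by (intro tendsto_intros inverse_l)
  then have "\<forall>\<^sub>F n in sequentially. M * (1 / l n) < e\<^sup>2 / 8"
    using e by (intro order_tendstoD(2)[where y="M * 0"]) auto
  then obtain N where N: "\<And>n. n \<ge> N \<Longrightarrow> M * (1 / l n) < e\<^sup>2 / 8"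
    unfolding eventually_sequentially by blast
  have "dist (u (l m) x t) (u (l n) x t) < e" if "m \<ge> N" "n \<ge> N" "t \<in> {0..T}" for m n t
  proof -
    have "(norm (u (l m) y t - u (l n) y t))\<^sup>2 \<le> 8 * (norm (A y))\<^sup>2 * (1 / l m + 1 / l n) * t"
      using that y by (intro u_diff_le l_gt) auto
    also have "\<dots> \<le> 8 * (norm (A y))\<^sup>2 * (1 / l m + 1 / l n) * T"
      using that l_pos[OF l_gt] by (intro mult_left_mono) (auto simp: less_imp_le)
    also have "\<dots> = M * (1 / l m) + M * (1 / l n)" by (simp add: M_def algebra_simps)
    also have "\<dots> < e\<^sup>2 / 4" using N[OF that(1)] N[OF that(2)] by linarith
    also have "\<dots> = (e/2)\<^sup>2" by (simp add: power_divide)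
    finally have 1: "norm (u (l m) y t - u (l n) y t) < e / 2"
      by (rule power_less_imp_less_base) (use e in simp)
    have 2: "norm (u (l k) (x - y) t) < e / 4" for k
      using norm_u_le[OF l_gt, of t k "x - y"] that y by (simp add: dist_norm norm_minus_commute)
    have "u (l m) x t - u (l n) x t =
        (u (l m) y t - u (l n) y t) + (u (l m) (x - y) t - u (l n) (x - y) t)"
      by (simp add: u_diff l_gt)
    also have "norm \<dots> < e / 2 + (e / 4 + e / 4)"
      using 1 2[of m] 2[of n] norm_triangle_ineq4[of "u (l m) (x - y) t" "u (l n) (x - y) t"]
      by (intro order_le_less_trans[OF norm_triangle_ineq]) linarith
    finally show ?thesis by (simp add: dist_norm)
  qed
  then show "\<exists>M. \<forall>t\<in>{0..T}. \<forall>m\<ge>M. \<forall>n\<ge>M. dist (u (l m) x t) (u (l n) x t) < e" by blast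
qed

definition T :: "real \<Rightarrow> 'a \<Rightarrow> 'a" where "T t x = lim (\<lambda>n. u (l n) x t)"

lemma T_uniform_limit:
  assumes "r \<ge> 0" shows "uniform_limit {0..r} (\<lambda>n. u (l n) x) (\<lambda>t. T t x) sequentially"
  using Cauchy_uniformly_convergent[OF u_uniformly_Cauchy[OF assms]]
  unfolding uniformly_convergent_uniform_limit_iff T_def .

lemma T_LIMSEQ: "t \<ge> 0 \<Longrightarrow> (\<lambda>n. u (l n) x t) \<longlonglongrightarrow> T t x"
  using tendsto_uniform_limitI[OF T_uniform_limit[of t x], of t] by simp

lemma T_0: "T 0 x = x"
  using T_LIMSEQ[of 0 x] by (simp add: u_0 l_gt LIMSEQ_const_iff)

lemma T_diff: "t \<ge> 0 \<Longrightarrow> T t (x - y) = T t x - T t y"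
  using T_LIMSEQ[of t "x - y"] tendsto_diff[OF T_LIMSEQ[of t x] T_LIMSEQ[of t y]]
  by (simp add: u_diff l_gt LIMSEQ_unique)

lemma norm_T_le: "t \<ge> 0 \<Longrightarrow> norm (T t x) \<le> norm x"
  by (rule Lim_bounded[OF tendsto_norm[OF T_LIMSEQ]]) (auto intro: norm_u_le l_gt)

lemma continuous_T: "continuous_on {0..} (\<lambda>t. T t x)"
proof -
  have "continuous_on {0..r} (\<lambda>t. T t x)" if "r \<ge> 0" for r
    by (rule uniform_limit_theorem[OF _ T_uniform_limit[OF that]])
       (auto intro!: always_eventually simp: continuous_on_eq_continuous_within
          intro: has_vector_derivative_continuous[OF u_has_vector_derivative[OF l_gt]])
  note * = this
  have "continuous (at t within {0..}) (\<lambda>t. T t x)" if "t \<ge> 0" for t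
  proof -
    have "continuous (at t within {0..t+1}) (\<lambda>t. T t x)"
      using *[of "t+1"] that by (auto simp: continuous_on_eq_continuous_within)
    moreover have "at t within {0..t+1} = at t within {0..}"
      using that by (intro at_within_nhd[of _ "{..<t+1}"]) auto
    ultimately show ?thesis by simp
  qed
  then show ?thesis by (simp add: continuous_on_eq_continuous_within)
qed

text \<open>On D the defect K l y - y = Y l y / l is at most |A y| / l. As A x need not lie in D, it
  is approximated from D, the maps K l being contractions; finally K l (A x) = Y l x.\<close>

lemma Y_LIMSEQ: assumes "x \<in> D" shows "(\<lambda>n. Y (l n) x) \<longlonglongrightarrow> A x"
proof -
  have K: "(\<lambda>n. K (l n) y) \<longlonglongrightarrow> y" if "y \<in> D" for y
  proof -
    have "(\<lambda>n. norm (y - K (l n) y)) \<longlonglongrightarrow> 0"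
    proof (rule tendsto_sandwich[of "\<lambda>_. 0" _ _ "\<lambda>n. (1 / l n) * norm (A y)"])
      show "\<forall>\<^sub>F n in sequentially. norm (y - K (l n) y) \<le> (1 / l n) * norm (A y)"
        using norm_Y_le[OF l_gt that] l_pos[OF l_gt]
        by (auto simp: diff_K[OF l_gt] abs_of_pos less_imp_le intro!: divide_right_mono always_eventually)
      show "(\<lambda>n. (1 / l n) * norm (A y)) \<longlonglongrightarrow> 0" by (rule tendsto_mult_left_zero[OF inverse_l])
    qed auto
    then have "(\<lambda>n. K (l n) y - y) \<longlonglongrightarrow> 0"
      by (subst tendsto_norm_zero_iff[symmetric]) (simp add: norm_minus_commute)
    then show ?thesis by (rule LIM_zero_cancel)
  qed
  have "(\<lambda>n. K (l n) (A x)) \<longlonglongrightarrow> A x"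
  proof (rule metric_LIMSEQ_I)
    fix e :: real assume e: "e > 0"
    obtain y where y: "y \<in> D" "dist y (A x) < e / 4"
      using dense e closure_approachable[of "A x" D] by (auto dest: spec[of _ "e/4"])
    obtain N where N: "\<And>n. n \<ge> N \<Longrightarrow> dist (K (l n) y) y < e / 2"
      using metric_LIMSEQ_D[OF K[OF y(1)], of "e/2"] e by auto
    have "dist (K (l n) (A x)) (A x) < e" if "n \<ge> N" for n
    proof -
      interpret contraction "K (l n)" by (rule contraction_K[OF l_gt])
      have "norm (K (l n) (A x - y)) \<le> norm (A x - y)" by (rule norm_le)
      then have "dist (K (l n) (A x)) (K (l n) y) \<le> dist y (A x)"
        by (simp add: dist_norm linear_diff[OF linear] norm_minus_commute)
      moreover have "dist (K (l n) (A x)) (A x) \<le> dist (K (l n) (A x)) (K (l n) y) + dist (K (l n) y) y + dist y (A x)"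
        using dist_triangle[of "K (l n) (A x)" "A x" "K (l n) y"] dist_triangle[of "K (l n) y" "A x" y]
        by linarith
      ultimately show ?thesis using y N[OF that] by linarith
    qed
    then show "\<exists>N. \<forall>n\<ge>N. dist (K (l n) (A x)) (A x) < e" by blast
  qed
  then show ?thesis by (simp add: K_A l_gt assms)
qed

text \<open>The starting vector varies with n. Replacing \<open>Y (l n) x\<close> by its limit
  \<open>A x\<close> costs no more than their distance, uniformly in time, and for a fixed starting
  vector the limit is known.\<close>

lemma Y_u_LIMSEQ:
  assumes "x \<in> D" "r \<ge> 0"
  shows "uniform_limit {0..r} (\<lambda>n t. u (l n) (Y (l n) x) t) (\<lambda>t. T t (A x)) sequentially"
proof -
  have "uniform_limit {0..r} (\<lambda>n t. u (l n) (Y (l n) x - A x) t) (\<lambda>t. 0) sequentially"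
    unfolding uniform_limit_iff
  proof (intro allI impI)
    fix e :: real assume "e > 0"
    then have "\<forall>\<^sub>F n in sequentially. dist (Y (l n) x) (A x) < e"
      using Y_LIMSEQ[OF assms(1)] by (rule tendstoD[rotated])
    then show "\<forall>\<^sub>F n in sequentially. \<forall>t\<in>{0..r}. dist (u (l n) (Y (l n) x - A x) t) 0 < e"
      by eventually_elim (auto simp: dist_norm intro: order_le_less_trans[OF norm_u_le[OF l_gt]])
  qed
  from uniform_limit_add[OF this T_uniform_limit[OF assms(2), of "A x"]]
  show ?thesis by (simp add: u_add[symmetric] l_gt)
qed

text \<open>Each x n equals R k (k x n - A (x n)), and the bounded resolvent lets the right-hand
  side pass to the limit.\<close>

lemma closed_graph:
  assumes "\<And>n. x n \<in> D" "x \<longlonglongrightarrow> y" "(\<lambda>n. A (x n)) \<longlonglongrightarrow> z"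
  shows "y \<in> D \<and> A y = z"
proof -
  define k where "k = c + 1"
  have k: "k > c" by (simp add: k_def)
  have "x = (\<lambda>n. R k (k *\<^sub>R x n - A (x n)))" using assms(1) k by (auto intro!: R_eqI[symmetric])
  moreover have "(\<lambda>n. R k (k *\<^sub>R x n - A (x n))) \<longlonglongrightarrow> R k (k *\<^sub>R y - z)"
    by (intro bounded_linear.tendsto[OF bounded_linear_R[OF k]] tendsto_intros assms)
  ultimately have "y = R k (k *\<^sub>R y - z)" using assms(2) LIMSEQ_unique by metis
  then show ?thesis using R_in_D[OF k] A_R[OF k, of "k *\<^sub>R y - z"] by (metis add_diff_cancel_left' diff_add_cancel)
qed

text \<open>The approximate flow need not lie in D, but its image under K l does. The two differ by
  Y l u / l, which tends to 0, and A maps K l u to Y l u, which tends to T t (A x); the closed graph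
  does the rest.\<close>

lemma T_in_D:
  assumes "x \<in> D" "t \<ge> 0" shows "T t x \<in> D \<and> A (T t x) = T t (A x)"
proof (rule closed_graph[of "\<lambda>n. K (l n) (u (l n) x t)"])
  show "K (l n) (u (l n) x t) \<in> D" for n by (rule K_in_D[OF l_gt])
  have Y: "(\<lambda>n. Y (l n) (u (l n) x t)) \<longlonglongrightarrow> T t (A x)"
    using tendsto_uniform_limitI[OF Y_u_LIMSEQ[OF assms], of t] assms(2) by (simp add: Y_u l_gt)
  then show "(\<lambda>n. A (K (l n) (u (l n) x t))) \<longlonglongrightarrow> T t (A x)" by (simp add: A_K l_gt)
  have "K k y = y + (1 / k) *\<^sub>R Y k y" if "k > c" for k y
    using diff_K[OF that, of y] by (simp add: algebra_simps)
  then have "(\<lambda>n. K (l n) (u (l n) x t)) = (\<lambda>n. u (l n) x t + (1 / l n) *\<^sub>R Y (l n) (u (l n) x t))"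
    using l_gt by blast
  moreover have "\<dots> \<longlonglongrightarrow> T t x + 0 *\<^sub>R T t (A x)"
    using assms(2) by (intro tendsto_intros T_LIMSEQ inverse_l Y)
  ultimately show "(\<lambda>n. K (l n) (u (l n) x t)) \<longlonglongrightarrow> T t x" by simp
qed

text \<open>Flows converge and their derivatives converge uniformly on {0..t+1}, so the limit may be
  differentiated there. The extra unit makes the filter at t agree with that of the
  half-line.\<close>

lemma T_has_vector_derivative:
  assumes "x \<in> D" "t \<ge> 0"
  shows "((\<lambda>t. T t x) has_vector_derivative A (T t x)) (at t within {0..})"
proof -
  let ?S = "{0..t+1}"
  have "\<exists>g. \<forall>s\<in>?S. (\<lambda>n. u (l n) x s) \<longlonglongrightarrow> g s \<and> (g has_derivative (\<lambda>h. h *\<^sub>R T s (A x))) (at s within ?S)"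
  proof (rule has_derivative_sequence)
    show "(u (l n) x has_derivative (\<lambda>h. h *\<^sub>R u (l n) (Y (l n) x) s)) (at s within ?S)" for n s
      using u_has_vector_derivative[OF l_gt] by (simp add: has_vector_derivative_def)
    show "(\<lambda>n. u (l n) x 0) \<longlonglongrightarrow> x" by (simp add: u_0 l_gt)
    show "\<forall>\<^sub>F n in sequentially. \<forall>s\<in>?S. \<forall>h.
        norm (h *\<^sub>R u (l n) (Y (l n) x) s - h *\<^sub>R T s (A x)) \<le> e * norm h" if "e > 0" for e
    proof -
      have "\<forall>\<^sub>F n in sequentially. \<forall>s\<in>?S. dist (u (l n) (Y (l n) x) s) (T s (A x)) < e"
        using Y_u_LIMSEQ[OF assms(1), of "t+1"] assms that unfolding uniform_limit_iff by auto
      then show ?thesis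
      proof eventually_elim
        case (elim n)
        show ?case
        proof (intro ballI allI)
          fix s h assume "s \<in> ?S"
          with elim have "norm (u (l n) (Y (l n) x) s - T s (A x)) \<le> e" by (auto simp: dist_norm less_imp_le)
          then show "norm (h *\<^sub>R u (l n) (Y (l n) x) s - h *\<^sub>R T s (A x)) \<le> e * norm h"
            unfolding scaleR_diff_right[symmetric] norm_scaleR mult.commute[of e] real_norm_def
            by (intro mult_left_mono) auto
        qed
      qed
    qed
  qed (use assms in auto)
  then obtain g where g: "\<And>s. s \<in> ?S \<Longrightarrow> (\<lambda>n. u (l n) x s) \<longlonglongrightarrow> g s"
    and g': "\<And>s. s \<in> ?S \<Longrightarrow> (g has_vector_derivative T s (A x)) (at s within ?S)"
    unfolding has_vector_derivative_def by blast
  have gT: "T s x = g s" if "s \<in> ?S" for s using g[OF that] T_LIMSEQ[of s x] that LIMSEQ_unique by auto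
  have t: "t \<in> ?S" using assms by simp
  have "((\<lambda>t. T t x) has_vector_derivative T t (A x)) (at t within ?S)"
    by (rule has_vector_derivative_transform[OF t _ g'[OF t]]) (rule gT)
  moreover have "at t within {0..t+1} = at t within {0..}"
    using assms by (intro at_within_nhd[of _ "{..<t+1}"]) auto
  ultimately show ?thesis using T_in_D[OF assms] by simp
qed

subsection \<open>Weak and strong solutions\<close>

text \<open>\<phi> lies in the domain of the adjoint of A and \<psi> is its image there.\<close>

definition adjoint_pair :: "'a \<Rightarrow> 'a \<Rightarrow> bool"
  where "adjoint_pair \<phi> \<psi> \<longleftrightarrow> (\<forall>v\<in>D. inner (A v) \<phi> = inner v \<psi>)"

lemma T_weak_solution_D:
  assumes "adjoint_pair \<phi> \<psi>" "x \<in> D" "t \<ge> 0"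
  shows "((\<lambda>s. inner (T s x) \<psi>) has_integral inner (T t x) \<phi> - inner x \<phi>) {0..t}"
proof -
  have "((\<lambda>s. inner (T s x) \<phi>) has_vector_derivative inner (T s x) \<psi>) (at s within {0..t})"
    if "s \<in> {0..t}" for s
  proof -
    have "((\<lambda>s. T s x) has_vector_derivative A (T s x)) (at s within {0..t})"
      using T_has_vector_derivative[OF assms(2), of s] that by (auto intro: has_vector_derivative_within_subset)
    then have "((\<lambda>s. inner (T s x) \<phi>) has_vector_derivative inner (A (T s x)) \<phi>) (at s within {0..t})"
      by (rule bounded_linear.has_vector_derivative[OF bounded_linear_inner_left])
    moreover have "T s x \<in> D" using T_in_D[OF assms(2), of s] that by simp
    ultimately show ?thesis using assms(1) by (simp add: adjoint_pair_def)
  qed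
  from fundamental_theorem_of_calculus[OF assms(3) this] show ?thesis by (simp add: T_0)
qed

text \<open>For x in D this is the fundamental theorem of calculus. A general x is approximated from
  D; contraction makes the convergence uniform in s, so the integrals converge as well.\<close>

lemma T_weak_solution:
  assumes "adjoint_pair \<phi> \<psi>" "t \<ge> 0"
  shows "((\<lambda>s. inner (T s x) \<psi>) has_integral inner (T t x) \<phi> - inner x \<phi>) {0..t}"
proof -
  obtain y where y: "\<And>n. y n \<in> D" "y \<longlonglongrightarrow> x"
    using dense closure_sequential[of x D] by auto
  have ul: "uniform_limit {0..t} (\<lambda>n s. inner (T s (y n)) \<psi>) (\<lambda>s. inner (T s x) \<psi>) sequentially"
  proof (rule uniform_limitI)
    fix e :: real assume "e > 0"
    have "(\<lambda>n. norm (y n - x) * norm \<psi>) \<longlonglongrightarrow> norm (x - x) * norm \<psi>" by (intro tendsto_intros y)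
    then have "\<forall>\<^sub>F n in sequentially. norm (y n - x) * norm \<psi> < e"
      using \<open>e > 0\<close> by (intro order_tendstoD(2)) auto
    then show "\<forall>\<^sub>F n in sequentially. \<forall>s\<in>{0..t}. dist (inner (T s (y n)) \<psi>) (inner (T s x) \<psi>) < e"
    proof eventually_elim
      case (elim n)
      have "\<bar>inner (T s (y n - x)) \<psi>\<bar> \<le> norm (y n - x) * norm \<psi>" if "s \<in> {0..t}" for s
        using that by (intro order_trans[OF Cauchy_Schwarz_ineq2] mult_right_mono norm_T_le) auto
      then show ?case using elim by (fastforce simp: dist_real_def T_diff inner_diff_left)
    qed
  qed
  obtain I J where I: "\<And>n. ((\<lambda>s. inner (T s (y n)) \<psi>) has_integral I n) {0..t}"
    and J: "((\<lambda>s. inner (T s x) \<psi>) has_integral J) {0..t}" and IJ: "I \<longlonglongrightarrow> J"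
    by (rule uniform_limit_integral[OF ul])
       (auto intro!: continuous_intros continuous_on_subset[OF continuous_T])
  have "I = (\<lambda>n. inner (T t (y n)) \<phi> - inner (y n) \<phi>)"
    using has_integral_unique[OF I T_weak_solution_D[OF assms(1) y(1) assms(2)]] by blast
  moreover have "(\<lambda>n. T t (y n)) \<longlonglongrightarrow> T t x"
  proof (rule Lim_transform_bound[of "\<lambda>n. T t (y n) - T t x" "\<lambda>n. y n - x", THEN LIM_zero_cancel])
    show "\<forall>\<^sub>F n in sequentially. norm (T t (y n) - T t x) \<le> norm (y n - x)"
      using norm_T_le[OF assms(2)] by (simp add: T_diff[symmetric] assms)
    show "(\<lambda>n. y n - x) \<longlonglongrightarrow> 0" using y(2) by (rule LIM_zero)
  qed
  ultimately have "I \<longlonglongrightarrow> inner (T t x) \<phi> - inner x \<phi>" using y(2) by (auto intro!: tendsto_intros)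
  then have "J = inner (T t x) \<phi> - inner x \<phi>" using IJ LIMSEQ_unique by blast
  then show ?thesis using J by simp
qed

lemma dissipative_flow_zero:
  assumes "\<And>s. s \<ge> 0 \<Longrightarrow> w s \<in> D"
    and "\<And>s. s \<ge> 0 \<Longrightarrow> (w has_vector_derivative A (w s)) (at s within {0..})"
    and "w 0 = 0" "t \<ge> 0"
  shows "w t = 0"
proof -
  have "(norm (w t))\<^sup>2 \<le> (norm (w 0))\<^sup>2 + 0 * t"
  proof (rule nonincreasing_on_halfline)
    show "((\<lambda>t. (norm (w t))\<^sup>2) has_real_derivative 2 * inner (A (w s)) (w s)) (at s within {0..})"
      if "s \<ge> 0" for s
      by (rule power2_norm_has_real_derivative[OF assms(2)[OF that]])
    show "2 * inner (A (w s)) (w s) \<le> 0" if "s \<ge> 0" for s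
      using dissipative[OF assms(1)[OF that]] by simp
  qed (rule assms(4))
  then show ?thesis using assms(3) by simp
qed

lemma strong_solution_unique:
  assumes "\<And>s. s \<ge> 0 \<Longrightarrow> v s \<in> D" "\<And>s. s \<ge> 0 \<Longrightarrow> w s \<in> D"
    and "\<And>s. s \<ge> 0 \<Longrightarrow> (v has_vector_derivative A (v s)) (at s within {0..})"
    and "\<And>s. s \<ge> 0 \<Longrightarrow> (w has_vector_derivative A (w s)) (at s within {0..})"
    and "v 0 = w 0" "t \<ge> 0"
  shows "v t = w t"
proof -
  have "v t - w t = 0"
  proof (rule dissipative_flow_zero[of "\<lambda>s. v s - w s"])
    show "v s - w s \<in> D" if "s \<ge> 0" for s using assms that by (intro subspace_diff[OF subspace_D])
    show "((\<lambda>s. v s - w s) has_vector_derivative A (v s - w s)) (at s within {0..})" if "s \<ge> 0" for s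
      using has_vector_derivative_diff[OF assms(3,4)[OF that]] assms that by (simp add: A_diff)
  qed (use assms in auto)
  then show ?thesis by simp
qed

text \<open>\<phi> is the adjoint of R k applied to \<zeta>, supplied by Riesz representation. The
  relation follows from R k (A v) = k R k v - v on D.\<close>

lemma adjoint_resolvent:
  assumes "k > c"
  obtains \<phi> where "adjoint_pair \<phi> (k *\<^sub>R \<phi> - \<zeta>)" "\<And>x. inner (R k x) \<zeta> = inner x \<phi>"
proof -
  have "bounded_linear (\<lambda>x. inner (R k x) \<zeta>)"
    by (rule bounded_linear_compose[OF bounded_linear_inner_left bounded_linear_R[OF assms]])
  then obtain \<phi> where \<phi>: "\<And>x. inner (R k x) \<zeta> = inner x \<phi>" using riesz_representation by metis
  have "inner (A v) \<phi> = inner v (k *\<^sub>R \<phi> - \<zeta>)" if "v \<in> D" for v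
  proof -
    have "R k (A v) = k *\<^sub>R R k v - v"
      using K_A[OF assms that] c_nonneg assms by (simp add: K_def Y_def)
    then have "inner (A v) \<phi> = inner (k *\<^sub>R R k v - v) \<zeta>" by (simp flip: \<phi>)
    then show ?thesis
      unfolding inner_diff_left inner_diff_right inner_scaleR_left inner_scaleR_right \<phi> .
  qed
  with \<phi> that show ?thesis by (auto simp: adjoint_pair_def)
qed

text \<open>The image p = R k w lies in D, and A p = k p - w is continuous in time. Tested with
  adjoint resolvents, the weak identity says that p is the integral of A p, so p' = A p in norm.
  Dissipativity gives p = 0, and R k is injective.\<close>

lemma weak_solution_zero:
  fixes w :: "real \<Rightarrow> 'a"
  assumes cont: "continuous_on {0..} w"
    and weak: "\<And>\<phi> \<psi> t. adjoint_pair \<phi> \<psi> \<Longrightarrow> t \<ge> 0 \<Longrightarrow>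
        ((\<lambda>s. inner (w s) \<psi>) has_integral inner (w t) \<phi>) {0..t}"
    and "t \<ge> 0"
  shows "w t = 0"
proof -
  define k where "k = c + 1"
  have k: "k > c" "k > 0" using c_nonneg by (auto simp: k_def)
  interpret R: bounded_linear "R k" by (rule bounded_linear_R[OF k(1)])
  let ?p = "\<lambda>s. R k (w s)"
  have int: "((\<lambda>s. inner (A (?p s)) \<zeta>) has_integral inner (?p t) \<zeta>) {0..t}" if "t \<ge> 0" for \<zeta> t
  proof -
    obtain \<phi> where \<phi>: "adjoint_pair \<phi> (k *\<^sub>R \<phi> - \<zeta>)" "\<And>x. inner (R k x) \<zeta> = inner x \<phi>"
      using adjoint_resolvent[OF k(1)] by metis
    have "inner (A (?p s)) \<zeta> = inner (w s) (k *\<^sub>R \<phi> - \<zeta>)" for s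
      by (simp add: A_R k inner_diff \<phi>(2))
    then show ?thesis using weak[OF \<phi>(1) that] by (simp add: \<phi>(2))
  qed
  have contA: "continuous_on {0..} (\<lambda>s. A (?p s))"
    unfolding A_R[OF k(1)] by (intro continuous_intros R.continuous_on cont)
  have der: "(?p has_vector_derivative A (?p s)) (at s within {0..})" if "s \<ge> 0" for s
    by (rule has_vector_derivative_if_weak[OF contA int that])
  \<comment> \<open>At time 0 the integral runs over a single point; testing with p(0) itself gives
    |p(0)|^2 = 0.\<close>
  have "((\<lambda>s. inner (A (?p s)) (?p 0)) has_integral 0) {0..0}"
    by (rule has_integral_null_real) simp
  from has_integral_unique[OF int[of 0 "?p 0", OF order_refl] this] have p0: "?p 0 = 0" by simp
  have "?p t = 0"
    by (rule dissipative_flow_zero[of ?p, OF _ _ p0 assms(3)]) (rule R_in_D[OF k(1)], rule der)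
  then show ?thesis using R_eq[OF k(1), of "w t"] A_0 by simp
qed

end

section \<open>Bounded skew perturbations\<close>

text \<open>Solving l x - A x - B x = f means x = R l (f + B x), and this map has Lipschitz constant
  r / l < 1. Skewness of B leaves the dissipation inequality unchanged.\<close>

lemma max_dissipative_perturb:
  fixes B :: "'a::{real_inner,banach} \<Rightarrow> 'a"
  assumes "max_dissipative D A 0"
    and B: "linear B" "\<And>x. norm (B x) \<le> r * norm x" "\<And>x. inner (B x) x = 0" "r \<ge> 0"
  shows "max_dissipative D (\<lambda>x. A x + B x) r"
proof -
  interpret max_dissipative D A 0 by fact
  show ?thesis
  proof
    fix l f assume "r < l"
    then have l: "l > 0" using B(4) by simp
    have "\<exists>!x. R l (f + B x) = x"
    proof (rule banach_fix_type[of "r / l"])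
      show "\<forall>x y. dist (R l (f + B x)) (R l (f + B y)) \<le> r / l * dist x y"
      proof (intro allI)
        fix x y
        have "R l (f + B x) - R l (f + B y) = R l (B (x - y))"
          using linear_R[OF l] B(1) by (simp add: linear_diff linear_add)
        moreover have "l * norm (R l (B (x - y))) \<le> r * norm (x - y)"
          using norm_R_le[OF l] B(2) order_trans by blast
        ultimately show "dist (R l (f + B x)) (R l (f + B y)) \<le> r / l * dist x y"
          using l by (simp add: dist_norm field_simps)
      qed
    qed (use \<open>r < l\<close> l B(4) in auto)
    then obtain x where x: "R l (f + B x) = x" by blast
    then show "\<exists>x\<in>D. l *\<^sub>R x - (A x + B x) = f"
      using R_in_D[OF l, of "f + B x"] R_eq[OF l, of "f + B x"]
      by (intro bexI[of _ x]) (simp_all add: algebra_simps)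
  qed (use B subspace_D dissipative in \<open>auto simp: A_add A_scaleR linear_add linear_scale algebra_simps inner_add_left\<close>)
qed

section \<open>Square-integrable functions\<close>

definition sq_integrable :: "'a measure \<Rightarrow> ('a \<Rightarrow> complex) \<Rightarrow> bool" where
  "sq_integrable M f \<longleftrightarrow> f \<in> borel_measurable M \<and> integrable M (\<lambda>x. (cmod (f x))\<^sup>2)"

lemma sq_integrable_measurable [measurable_dest]: "sq_integrable M f \<Longrightarrow> f \<in> borel_measurable M"
  by (simp add: sq_integrable_def)

lemma sq_integrable_bound:
  assumes "f \<in> borel_measurable M" "integrable M g" "AE x in M. (cmod (f x))\<^sup>2 \<le> g x"
  shows "sq_integrable M f"
  unfolding sq_integrable_def
  by (intro conjI assms Bochner_Integration.integrable_bound[OF assms(2)])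
     (use assms in \<open>auto simp: abs_of_nonneg intro: order_trans\<close>)

lemma sq_integrable_zero [simp]: "sq_integrable M (\<lambda>_. 0)"
  by (simp add: sq_integrable_def)

lemma sq_integrable_cmult:
  assumes "sq_integrable M f" shows "sq_integrable M (\<lambda>x. c * f x)"
  using assms unfolding sq_integrable_def by (auto simp: norm_mult power_mult_distrib)

lemma sq_integrable_cnj:
  assumes "sq_integrable M f" shows "sq_integrable M (\<lambda>x. cnj (f x))"
  using assms unfolding sq_integrable_def by (auto intro: measurable_compose[OF _ borel_measurable_continuous_onI] continuous_intros)

lemma sq_integrable_add:
  assumes "sq_integrable M f" "sq_integrable M g" shows "sq_integrable M (\<lambda>x. f x + g x)"
proof (rule sq_integrable_bound)
  show "integrable M (\<lambda>x. 2 * (cmod (f x))\<^sup>2 + 2 * (cmod (g x))\<^sup>2)"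
    using assms by (auto simp: sq_integrable_def)
  show "AE x in M. (cmod (f x + g x))\<^sup>2 \<le> 2 * (cmod (f x))\<^sup>2 + 2 * (cmod (g x))\<^sup>2"
  proof (intro always_eventually allI)
    fix x
    have "(cmod (f x + g x))\<^sup>2 \<le> (cmod (f x) + cmod (g x))\<^sup>2"
      by (intro power_mono norm_triangle_ineq) simp
    also have "\<dots> \<le> 2 * (cmod (f x))\<^sup>2 + 2 * (cmod (g x))\<^sup>2"
      using zero_le_power2[of "cmod (f x) - cmod (g x)"] by (simp add: power2_sum power2_diff)
    finally show "(cmod (f x + g x))\<^sup>2 \<le> 2 * (cmod (f x))\<^sup>2 + 2 * (cmod (g x))\<^sup>2" .
  qed
qed (use assms in measurable)

lemma sq_integrable_uminus: "sq_integrable M f \<Longrightarrow> sq_integrable M (\<lambda>x. - f x)"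
  using sq_integrable_cmult[of M f "-1"] by simp

lemma sq_integrable_diff:
  assumes "sq_integrable M f" "sq_integrable M g" shows "sq_integrable M (\<lambda>x. f x - g x)"
  using sq_integrable_add[OF assms(1) sq_integrable_uminus[OF assms(2)]] by simp

lemma Re_mult_cnj_self: "Re (z * cnj z) = (cmod z)\<^sup>2"
  unfolding cmod_power2 by (simp add: power2_eq_square)

lemma integrable_mult_sq:
  assumes "sq_integrable M f" "sq_integrable M g" shows "integrable M (\<lambda>x. f x * g x)"
proof (rule Bochner_Integration.integrable_bound)
  show "integrable M (\<lambda>x. (cmod (f x))\<^sup>2 + (cmod (g x))\<^sup>2)"
    using assms by (auto simp: sq_integrable_def)
  have "cmod (f x * g x) \<le> (cmod (f x))\<^sup>2 + (cmod (g x))\<^sup>2" for x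
  proof -
    have "2 * (cmod (f x) * cmod (g x)) \<le> (cmod (f x))\<^sup>2 + (cmod (g x))\<^sup>2"
      using zero_le_power2[of "cmod (f x) - cmod (g x)"] unfolding power2_diff by linarith
    then show ?thesis
      using mult_nonneg_nonneg[of "cmod (f x)" "cmod (g x)"] by (simp add: norm_mult del: mult_nonneg_nonneg)
  qed
  then show "AE x in M. norm (f x * g x) \<le> norm ((cmod (f x))\<^sup>2 + (cmod (g x))\<^sup>2)"
    by (auto intro: order_trans[OF _ abs_ge_self])
qed (use assms in measurable)

text \<open>The discriminant argument, applied to the moduli. The pairing carries no conjugate,
  which suits the constraint given by \<open>l2_orth\<close>.\<close>

lemma Cauchy_Schwarz_integral:
  assumes "sq_integrable M f" "sq_integrable M g"
  shows "(cmod (\<integral>x. f x * g x \<partial>M))\<^sup>2 \<le> (\<integral>x. (cmod (f x))\<^sup>2 \<partial>M) * (\<integral>x. (cmod (g x))\<^sup>2 \<partial>M)"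
proof -
  define a b c where "a = (\<integral>x. (cmod (f x))\<^sup>2 \<partial>M)" and "b = (\<integral>x. (cmod (g x))\<^sup>2 \<partial>M)"
    and "c = (\<integral>x. cmod (f x) * cmod (g x) \<partial>M)"
  have fg: "integrable M (\<lambda>x. cmod (f x) * cmod (g x))"
    using integrable_norm[OF integrable_mult_sq[OF assms]] by (simp add: norm_mult)
  have q: "0 \<le> a - 2 * t * c + t\<^sup>2 * b" for t
  proof -
    have "0 \<le> (\<integral>x. (cmod (f x) - t * cmod (g x))\<^sup>2 \<partial>M)" by simp
    also have "(\<lambda>x. (cmod (f x) - t * cmod (g x))\<^sup>2) =
        (\<lambda>x. (cmod (f x))\<^sup>2 - 2 * t * (cmod (f x) * cmod (g x)) + t\<^sup>2 * (cmod (g x))\<^sup>2)"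
      by (auto simp: fun_eq_iff power2_eq_square algebra_simps)
    also have "(\<integral>x. \<dots> x \<partial>M) = a - 2 * t * c + t\<^sup>2 * b"
      using assms fg by (simp add: a_def b_def c_def sq_integrable_def)
    finally show ?thesis .
  qed
  have "c\<^sup>2 \<le> a * b"
  proof (cases "b = 0")
    case True
    have "c = 0"
    proof (rule ccontr)
      assume "c \<noteq> 0"
      \<comment> \<open>For b = 0 the expression is affine in t, and this t gives it the value
        -1.\<close>
      with q[of "(a + 1) / (2 * c)"] True show False by (simp add: field_simps)
    qed
    then show ?thesis using True by simp
  next
    case False
    then have "b > 0" using integral_nonneg_AE[of "\<lambda>x. (cmod (g x))\<^sup>2" M] by (simp add: b_def less_le)
    have "a - 2 * (c / b) * c + (c / b)\<^sup>2 * b = a - c\<^sup>2 / b"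
      using \<open>b > 0\<close> by (simp add: field_simps power2_eq_square)
    with q[of "c / b"] have "c\<^sup>2 / b \<le> a" by linarith
    then show ?thesis using \<open>b > 0\<close> by (simp add: pos_divide_le_eq)
  qed
  moreover have "cmod (\<integral>x. f x * g x \<partial>M) \<le> c"
    using integral_norm_bound[of M "\<lambda>x. f x * g x"] by (simp add: c_def norm_mult)
  ultimately show ?thesis unfolding a_def b_def
    by (meson norm_ge_zero order_trans power_mono)
qed

text \<open>A subsequence with squared distances at most 8^-k converges a.e., and Fatou's lemma
  carries the Cauchy estimate over to the limit for the full sequence. The weights 2^k stand in for
  Minkowski's inequality: the weighted squares have a finite integral in total, and a <= 2^-k + 2^k
  a^2 then gives absolute summability of the increments.\<close>

theorem Riesz_Fischer:
  fixes f :: "nat \<Rightarrow> 'a \<Rightarrow> complex"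
  assumes f: "\<And>n. sq_integrable M (f n)"
    and Cauchy: "\<And>e. e > 0 \<Longrightarrow> \<exists>N. \<forall>m\<ge>N. \<forall>n\<ge>N. (\<integral>x. (cmod (f m x - f n x))\<^sup>2 \<partial>M) \<le> e"
  obtains F where "sq_integrable M F" "(\<lambda>n. \<integral>x. (cmod (f n x - F x))\<^sup>2 \<partial>M) \<longlonglongrightarrow> 0"
proof -
  have [measurable]: "f n \<in> borel_measurable M" for n using f by (simp add: sq_integrable_def)
  define D where "D m n = (\<integral>x. (cmod (f m x - f n x))\<^sup>2 \<partial>M)" for m n
  have int: "integrable M (\<lambda>x. (cmod (f m x - f n x))\<^sup>2)" for m n
    using sq_integrable_diff[OF f f, of m n] by (simp add: sq_integrable_def)
  have D_nn: "(\<integral>\<^sup>+x. ennreal ((cmod (f m x - f n x))\<^sup>2) \<partial>M) = ennreal (D m n)" for m n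
    unfolding D_def by (rule nn_integral_eq_integral[OF int]) simp
  have "\<exists>N. \<forall>m\<ge>N. \<forall>n\<ge>N. D m n \<le> (1/8)^k" for k using Cauchy[of "(1/8)^k"] by (simp add: D_def)
  then obtain N where N: "\<And>k m n. m \<ge> N k \<Longrightarrow> n \<ge> N k \<Longrightarrow> D m n \<le> (1/8)^k" by metis
  \<comment> \<open>Summing all thresholds up to k makes both r k and r (Suc k) at least N k, and
    the summand k sends r to infinity.\<close>
  define r where "r k = k + (\<Sum>i\<le>k. N i)" for k
  have r: "r k \<ge> N k" "r (Suc k) \<ge> N k" "r k \<ge> k" for k
  proof -
    have "N k \<le> (\<Sum>i\<le>k. N i)" by (rule member_le_sum) auto
    then show "r k \<ge> N k" "r (Suc k) \<ge> N k" "r k \<ge> k" by (auto simp: r_def)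
  qed
  define a where "a k x = cmod (f (r (Suc k)) x - f (r k) x)" for k x
  have [measurable]: "a k \<in> borel_measurable M" for k unfolding a_def by measurable
  have "(\<integral>\<^sup>+x. (\<Sum>k. ennreal (2^k * (a k x)\<^sup>2)) \<partial>M) = (\<Sum>k. \<integral>\<^sup>+x. ennreal (2^k * (a k x)\<^sup>2) \<partial>M)"
    by (rule nn_integral_suminf) measurable
  also have "\<dots> = (\<Sum>k. ennreal (2^k * D (r (Suc k)) (r k)))"
    by (intro suminf_cong) (simp add: ennreal_mult' nn_integral_cmult D_nn[symmetric] a_def)
  also have "\<dots> \<le> (\<Sum>k. ennreal ((1/4)^k))"
  proof (intro suminf_le allI ennreal_leI)
    fix k
    have "2^k * D (r (Suc k)) (r k) \<le> 2^k * (1/8)^k" using r by (intro mult_left_mono N) auto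
    also have "\<dots> = (1/4::real)^k" by (simp add: power_mult_distrib[symmetric])
    finally show "2^k * D (r (Suc k)) (r k) \<le> (1/4)^k" .
  qed auto
  also have "\<dots> = ennreal (\<Sum>k. (1/4)^k)" by (rule suminf_ennreal2) (auto intro: summable_geometric)
  finally have "(\<integral>\<^sup>+x. (\<Sum>k. ennreal (2^k * (a k x)\<^sup>2)) \<partial>M) \<noteq> \<infinity>"
    by (auto simp: top_unique)
  then have "AE x in M. (\<Sum>k. ennreal (2^k * (a k x)\<^sup>2)) \<noteq> \<infinity>"
    by (intro nn_integral_PInf_AE) measurable
  then have conv: "AE x in M. convergent (\<lambda>k. f (r k) x)"
  proof eventually_elim
    case (elim x)
    then have "summable (\<lambda>k. 2^k * (a k x)\<^sup>2)" by (intro summable_suminf_not_top) auto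
    then have "summable (\<lambda>k. (1/2)^k + 2^k * (a k x)\<^sup>2)" by (intro summable_add summable_geometric) auto
    moreover have "norm (f (r (Suc k)) x - f (r k) x) \<le> (1/2)^k + 2^k * (a k x)\<^sup>2" for k
    proof -
      have "2^k * (1/2)^k = (1::real)" by (simp add: power_mult_distrib[symmetric])
      \<comment> \<open>Young's inequality as a completed square with weight 2^k.\<close>
      then have "(1/2)^k + 2^k * (a k x)\<^sup>2 - 2 * a k x = 2^k * ((1/2)^k - a k x)\<^sup>2"
        by (simp add: power2_eq_square algebra_simps)
      moreover have "0 \<le> 2^k * ((1/2)^k - a k x)\<^sup>2" by simp
      ultimately have "2 * a k x \<le> (1/2)^k + 2^k * (a k x)\<^sup>2" by linarith
      moreover have "a k x \<ge> 0" by (simp add: a_def)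
      ultimately have "a k x \<le> (1/2)^k + 2^k * (a k x)\<^sup>2" by linarith
      then show ?thesis by (simp add: a_def)
    qed
    ultimately have "summable (\<lambda>k. f (r (Suc k)) x - f (r k) x)" by (rule summable_comparison_test')
    then have "(\<lambda>n. \<Sum>k<n. f (r (Suc k)) x - f (r k) x) \<longlonglongrightarrow> (\<Sum>k. f (r (Suc k)) x - f (r k) x)"
      by (rule summable_LIMSEQ)
    then have "convergent (\<lambda>n. f (r n) x - f (r 0) x)"
      unfolding sum_lessThan_telescope[of "\<lambda>k. f (r k) x"] by (rule convergentI)
    then show ?case by (simp add: convergent_diff_const_right_iff)
  qed
  define F where "F x = lim (\<lambda>k. f (r k) x)" for x
  have [measurable]: "F \<in> borel_measurable M" unfolding F_def by measurable
  have Fatou: "(\<integral>\<^sup>+x. ennreal ((cmod (f n x - F x))\<^sup>2) \<partial>M) \<le> ennreal e"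
    if e: "e > 0" and n: "\<And>m. m \<ge> n \<Longrightarrow> D n m \<le> e" for n e
  proof -
    have "(\<integral>\<^sup>+x. ennreal ((cmod (f n x - F x))\<^sup>2) \<partial>M) =
        (\<integral>\<^sup>+x. liminf (\<lambda>k. ennreal ((cmod (f n x - f (r k) x))\<^sup>2)) \<partial>M)"
    proof (rule nn_integral_cong_AE)
      show "AE x in M. ennreal ((cmod (f n x - F x))\<^sup>2) = liminf (\<lambda>k. ennreal ((cmod (f n x - f (r k) x))\<^sup>2))"
        using conv
      proof eventually_elim
        case (elim x)
        then have "(\<lambda>k. f (r k) x) \<longlonglongrightarrow> F x" by (simp add: F_def convergent_LIMSEQ_iff)
        then have "(\<lambda>k. ennreal ((cmod (f n x - f (r k) x))\<^sup>2)) \<longlonglongrightarrow> ennreal ((cmod (f n x - F x))\<^sup>2)"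
          by (intro tendsto_intros tendsto_ennrealI)
        then show ?case by (intro lim_imp_Liminf[symmetric]) auto
      qed
    qed
    also have "\<dots> \<le> liminf (\<lambda>k. \<integral>\<^sup>+x. ennreal ((cmod (f n x - f (r k) x))\<^sup>2) \<partial>M)"
      by (rule nn_integral_liminf) measurable
    also have "\<dots> \<le> ennreal e"
    proof (rule Liminf_le)
      show "\<forall>\<^sub>F k in sequentially. (\<integral>\<^sup>+x. ennreal ((cmod (f n x - f (r k) x))\<^sup>2) \<partial>M) \<le> ennreal e"
        unfolding D_nn eventually_sequentially using n r(3) order_trans
        by (intro exI[of _ n] allI impI ennreal_leI) blast
    qed simp
    finally show ?thesis .
  qed
  have conv2: "integrable M (\<lambda>x. (cmod (f n x - F x))\<^sup>2) \<and> (\<integral>x. (cmod (f n x - F x))\<^sup>2 \<partial>M) \<le> e"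
    if "e > 0" "\<And>m. m \<ge> n \<Longrightarrow> D n m \<le> e" for n e
  proof
    show int: "integrable M (\<lambda>x. (cmod (f n x - F x))\<^sup>2)"
      using order_le_less_trans[OF Fatou[OF that] ennreal_less_top] by (intro integrableI_bounded) auto
    show "(\<integral>x. (cmod (f n x - F x))\<^sup>2 \<partial>M) \<le> e"
      using Fatou[OF that] \<open>e > 0\<close> nn_integral_eq_integral[OF int] by simp
  qed
  \<comment> \<open>The threshold for k = 0 corresponds to the bound (1/8)^0 = 1. F is then a
    square-integrable function minus this difference.\<close>
  have "sq_integrable M (\<lambda>x. f (N 0) x - F x)"
    unfolding sq_integrable_def using conv2[of 1 "N 0"] N[of 0] by auto
  from sq_integrable_diff[OF f[of "N 0"] this] have "sq_integrable M F" by simp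
  moreover have "(\<lambda>n. \<integral>x. (cmod (f n x - F x))\<^sup>2 \<partial>M) \<longlonglongrightarrow> 0"
  proof (rule LIMSEQ_I)
    fix e :: real assume "e > 0"
    then obtain L where L: "\<And>m n. m \<ge> L \<Longrightarrow> n \<ge> L \<Longrightarrow> D m n \<le> e/2"
      using Cauchy[of "e/2"] unfolding D_def by auto
    show "\<exists>L. \<forall>n\<ge>L. norm ((\<integral>x. (cmod (f n x - F x))\<^sup>2 \<partial>M) - 0) < e"
    proof (intro exI[of _ L] allI impI)
      fix n assume "n \<ge> L"
      then have "(\<integral>x. (cmod (f n x - F x))\<^sup>2 \<partial>M) \<le> e/2" using conv2[of "e/2" n] L \<open>e > 0\<close> by auto
      then show "norm ((\<integral>x. (cmod (f n x - F x))\<^sup>2 \<partial>M) - 0) < e"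
        using \<open>e > 0\<close> by (simp add: abs_of_nonneg)
    qed
  qed
  ultimately show ?thesis using that by blast
qed

section \<open>The Hilbert space \<open>L\<^sup>2\<close>\<close>

text \<open>The index type only selects a measure on the line and a function to which all
  elements are required to be orthogonal; this also covers the square-integrable functions of mean zero.\<close>

class l2_index =
  fixes l2_measure :: "'a itself \<Rightarrow> real measure"
    and l2_orth :: "'a itself \<Rightarrow> real \<Rightarrow> complex"
  assumes sq_integrable_l2_orth: "sq_integrable (l2_measure TYPE('a)) (l2_orth TYPE('a))"

definition l2_mem :: "'p::l2_index itself \<Rightarrow> (real \<Rightarrow> complex) \<Rightarrow> bool" where
  "l2_mem p f \<longleftrightarrow> sq_integrable (l2_measure p) f \<and> (\<integral>x. f x * l2_orth p x \<partial>l2_measure p) = 0"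

text \<open>One representative is selected per class of a.e. equal functions, so that the elements
  of the space are functions and equality is plain equality. The selection depends only on the
  class, by \<open>l2_canon_cong\<close>.\<close>

definition l2_canon :: "'p::l2_index itself \<Rightarrow> (real \<Rightarrow> complex) \<Rightarrow> (real \<Rightarrow> complex)" where
  "l2_canon p f = (SOME g. l2_mem p g \<and> (AE x in l2_measure p. g x = f x))"

lemma l2_mem_zero: "l2_mem p (\<lambda>_. 0)"
  by (simp add: l2_mem_def)

lemma l2_mem_add:
  "l2_mem TYPE('p::l2_index) f \<Longrightarrow> l2_mem TYPE('p) g \<Longrightarrow> l2_mem TYPE('p) (\<lambda>x. f x + g x)"
  by (simp add: l2_mem_def sq_integrable_add distrib_right integrable_mult_sq sq_integrable_l2_orth)

lemma l2_mem_cmult: "l2_mem p f \<Longrightarrow> l2_mem p (\<lambda>x. c * f x)"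
  by (simp add: l2_mem_def sq_integrable_cmult mult.assoc)

lemma l2_canon:
  assumes "l2_mem p f"
  shows "l2_mem p (l2_canon p f)" "AE x in l2_measure p. l2_canon p f x = f x"
  using someI[of "\<lambda>g. l2_mem p g \<and> (AE x in l2_measure p. g x = f x)" f] assms
  by (auto simp: l2_canon_def)

lemma l2_canon_cong:
  assumes "AE x in l2_measure p. f x = g x"
  shows "l2_canon p f = l2_canon p g"
proof -
  have "(AE x in l2_measure p. h x = f x) \<longleftrightarrow> (AE x in l2_measure p. h x = g x)" for h
  proof
    assume "AE x in l2_measure p. h x = f x"
    then show "AE x in l2_measure p. h x = g x" using assms by eventually_elim simp
  next
    assume "AE x in l2_measure p. h x = g x"
    then show "AE x in l2_measure p. h x = f x" using assms by eventually_elim simp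
  qed
  then show ?thesis unfolding l2_canon_def by (intro arg_cong[where f=Eps] ext conj_cong refl)
qed

typedef (overloaded) ('p::l2_index) l2 =
  "{f. l2_mem TYPE('p) f \<and> l2_canon TYPE('p) f = f}" morphisms rep_l2 Abs_l2
  by (intro exI CollectI conjI)
     (rule l2_canon(1)[OF l2_mem_zero], rule l2_canon_cong[OF l2_canon(2)[OF l2_mem_zero]])

definition l2_of :: "(real \<Rightarrow> complex) \<Rightarrow> 'p::l2_index l2" where
  "l2_of f = Abs_l2 (l2_canon TYPE('p) f)"

abbreviation AE_l2 :: "'p::l2_index itself \<Rightarrow> (real \<Rightarrow> bool) \<Rightarrow> bool" where
  "AE_l2 p P \<equiv> (AE x in l2_measure p. P x)"

lemma l2_mem_rep: "l2_mem TYPE('p) (rep_l2 (x :: 'p::l2_index l2))"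
  using rep_l2[of x] by simp

lemma rep_l2_of: "l2_mem TYPE('p) f \<Longrightarrow> rep_l2 (l2_of f :: 'p::l2_index l2) = l2_canon TYPE('p) f"
  unfolding l2_of_def by (intro Abs_l2_inverse CollectI conjI l2_canon_cong l2_canon)

lemma AE_rep_l2_of:
  "l2_mem TYPE('p) f \<Longrightarrow> AE_l2 TYPE('p) (\<lambda>x. rep_l2 (l2_of f :: 'p::l2_index l2) x = f x)"
  by (simp add: rep_l2_of l2_canon)

lemma l2_of_rep [simp]: "l2_of (rep_l2 x) = x"
  unfolding l2_of_def using rep_l2[of x] by (simp add: rep_l2_inverse)

lemma l2_of_cong: "AE_l2 TYPE('p) (\<lambda>x. f x = g x) \<Longrightarrow> l2_of f = (l2_of g :: 'p::l2_index l2)"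
  unfolding l2_of_def by (simp add: l2_canon_cong)

lemma l2_eqI:
  assumes "AE_l2 TYPE('p) (\<lambda>s. rep_l2 x s = rep_l2 y s)"
  shows "x = (y :: 'p::l2_index l2)"
  using l2_of_cong[OF assms] by simp

lemma l2_of_eq_iff:
  assumes "l2_mem TYPE('p) f" "l2_mem TYPE('p) g"
  shows "l2_of f = (l2_of g :: 'p::l2_index l2) \<longleftrightarrow> AE_l2 TYPE('p) (\<lambda>x. f x = g x)"
proof
  assume eq: "l2_of f = (l2_of g :: 'p l2)"
  show "AE_l2 TYPE('p) (\<lambda>x. f x = g x)"
    using AE_rep_l2_of[OF assms(1)] AE_rep_l2_of[OF assms(2)] unfolding eq
    by eventually_elim simp
qed (rule l2_of_cong)

lemma integrable_rep_l2:
  "integrable (l2_measure TYPE('p)) (\<lambda>s. rep_l2 (x :: 'p::l2_index l2) s * cnj (rep_l2 (y :: 'p l2) s))"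
  using l2_mem_rep[of x] l2_mem_rep[of y]
  by (intro integrable_mult_sq sq_integrable_cnj) (auto simp: l2_mem_def)

instantiation l2 :: (l2_index) real_vector
begin

definition zero_l2 :: "'a l2" where "zero_l2 = l2_of (\<lambda>_. 0)"
definition plus_l2 :: "'a l2 \<Rightarrow> 'a l2 \<Rightarrow> 'a l2"
  where "plus_l2 x y = l2_of (\<lambda>s. rep_l2 x s + rep_l2 y s)"
definition uminus_l2 :: "'a l2 \<Rightarrow> 'a l2" where "uminus_l2 x = l2_of (\<lambda>s. (-1) * rep_l2 x s)"
definition minus_l2 :: "'a l2 \<Rightarrow> 'a l2 \<Rightarrow> 'a l2" where "minus_l2 x y = plus x (uminus y)"
definition scaleR_l2 :: "real \<Rightarrow> 'a l2 \<Rightarrow> 'a l2"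
  where "scaleR_l2 r x = l2_of (\<lambda>s. of_real r * rep_l2 x s)"
lemma AE_zero: "AE_l2 TYPE('a) (\<lambda>s. rep_l2 (0::'a l2) s = 0)"
  unfolding zero_l2_def by (rule AE_rep_l2_of[OF l2_mem_zero])

lemma AE_plus: "AE_l2 TYPE('a) (\<lambda>s. rep_l2 (x + y :: 'a l2) s = rep_l2 x s + rep_l2 y s)"
  unfolding plus_l2_def by (rule AE_rep_l2_of[OF l2_mem_add[OF l2_mem_rep l2_mem_rep]])

lemma AE_uminus: "AE_l2 TYPE('a) (\<lambda>s. rep_l2 (- x :: 'a l2) s = - rep_l2 x s)"
  using AE_rep_l2_of[OF l2_mem_cmult[OF l2_mem_rep, of "-1" x]] unfolding uminus_l2_def by simp

lemma AE_scaleR: "AE_l2 TYPE('a) (\<lambda>s. rep_l2 (r *\<^sub>R x :: 'a l2) s = of_real r * rep_l2 x s)"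
  unfolding scaleR_l2_def by (rule AE_rep_l2_of[OF l2_mem_cmult[OF l2_mem_rep]])

instance
proof
  fix x y z :: "'a l2" and r r' :: real
  show "x + y = y + x" by (simp add: plus_l2_def add.commute)
  show "x + y + z = x + (y + z)"
    by (rule l2_eqI) (use AE_plus[of "x + y" z] AE_plus[of x y] AE_plus[of x "y + z"] AE_plus[of y z] in eventually_elim, simp)
  show "0 + x = x"
    by (rule l2_eqI) (use AE_plus[of 0 x] AE_zero in eventually_elim, simp)
  show "- x + x = 0"
    by (rule l2_eqI) (use AE_plus[of "- x" x] AE_uminus[of x] AE_zero in eventually_elim, simp)
  show "x - y = x + - y" by (rule minus_l2_def)
  show "r *\<^sub>R (x + y) = r *\<^sub>R x + r *\<^sub>R y"
    by (rule l2_eqI) (use AE_plus[of x y] AE_plus[of "r *\<^sub>R x" "r *\<^sub>R y"] AE_scaleR[of r x] AE_scaleR[of r y]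
        AE_scaleR[of r "x + y"] in eventually_elim, simp add: algebra_simps)
  show "(r + r') *\<^sub>R x = r *\<^sub>R x + r' *\<^sub>R x"
    by (rule l2_eqI) (use AE_plus[of "r *\<^sub>R x" "r' *\<^sub>R x"] AE_scaleR[of r x] AE_scaleR[of r' x]
        AE_scaleR[of "r + r'" x] in eventually_elim, simp add: algebra_simps)
  show "r *\<^sub>R r' *\<^sub>R x = (r * r') *\<^sub>R x"
    by (rule l2_eqI) (use AE_scaleR[of r "r' *\<^sub>R x"] AE_scaleR[of r' x] AE_scaleR[of "r * r'" x] in eventually_elim, simp)
  show "1 *\<^sub>R x = x"
    by (rule l2_eqI) (use AE_scaleR[of 1 x] in eventually_elim, simp)
qed

end

lemma integrable_Re_rep: "integrable (l2_measure TYPE('p)) (\<lambda>s. Re (rep_l2 (x :: 'p::l2_index l2) s * cnj (rep_l2 (y :: 'p l2) s)))"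
  using integrable_rep_l2 by (rule integrable_Re)

instantiation l2 :: (l2_index) real_inner
begin

text \<open>Taking real parts makes the complex space a real Hilbert space; imaginary parts are
  recovered later by multiplying states by i.\<close>

definition inner_l2 :: "'a l2 \<Rightarrow> 'a l2 \<Rightarrow> real"
  where "inner_l2 x y = (\<integral>s. Re (rep_l2 x s * cnj (rep_l2 y s)) \<partial>l2_measure TYPE('a))"
definition norm_l2 :: "'a l2 \<Rightarrow> real" where "norm_l2 x = sqrt (inner x x)"
definition dist_l2 :: "'a l2 \<Rightarrow> 'a l2 \<Rightarrow> real" where "dist_l2 x y = norm (x - y)"
definition sgn_l2 :: "'a l2 \<Rightarrow> 'a l2" where "sgn_l2 x = x /\<^sub>R norm x"
definition uniformity_l2 :: "('a l2 \<times> 'a l2) filter"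
  where "uniformity_l2 = (INF e\<in>{0<..}. principal {(x, y). dist x y < e})"
definition open_l2 :: "'a l2 set \<Rightarrow> bool"
  where "open_l2 U \<longleftrightarrow> (\<forall>x\<in>U. \<forall>\<^sub>F (x', y) in uniformity. x' = x \<longrightarrow> y \<in> U)"

instance
proof
  fix x y z :: "'a l2" and r r' :: real
  show "dist x y = norm (x - y)" "sgn x = x /\<^sub>R norm x"
    "uniformity = (INF e\<in>{0<..}. principal {(x :: 'a l2, y). dist x y < e})"
    "open U \<longleftrightarrow> (\<forall>x\<in>U. \<forall>\<^sub>F (x', y) in uniformity. x' = x \<longrightarrow> y \<in> U)" for U :: "'a l2 set"
    by (rule dist_l2_def sgn_l2_def uniformity_l2_def open_l2_def)+
  show "norm x = sqrt (inner x x)" by (rule norm_l2_def)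
  show "inner x y = inner y x" by (simp add: inner_l2_def mult.commute)
  show "inner (x + y) z = inner x z + inner y z"
  proof -
    have "inner (x + y) z = (\<integral>s. Re (rep_l2 x s * cnj (rep_l2 z s)) + Re (rep_l2 y s * cnj (rep_l2 z s)) \<partial>l2_measure TYPE('a))"
      unfolding inner_l2_def
    proof (rule integral_cong_AE)
      show "AE_l2 TYPE('a) (\<lambda>s. Re (rep_l2 (x + y) s * cnj (rep_l2 z s)) = Re (rep_l2 x s * cnj (rep_l2 z s)) + Re (rep_l2 y s * cnj (rep_l2 z s)))"
        using AE_plus[of x y] by eventually_elim (simp add: algebra_simps)
    qed (intro borel_measurable_add borel_measurable_integrable integrable_Re_rep)+
    then show ?thesis
      unfolding inner_l2_def Bochner_Integration.integral_add[OF integrable_Re_rep integrable_Re_rep] .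
  qed
  show "inner (r *\<^sub>R x) y = r * inner x y"
  proof -
    have "inner (r *\<^sub>R x) y = (\<integral>s. r * Re (rep_l2 x s * cnj (rep_l2 y s)) \<partial>l2_measure TYPE('a))"
      unfolding inner_l2_def
    proof (rule integral_cong_AE)
      show "AE_l2 TYPE('a) (\<lambda>s. Re (rep_l2 (r *\<^sub>R x) s * cnj (rep_l2 y s)) = r * Re (rep_l2 x s * cnj (rep_l2 y s)))"
        using AE_scaleR[of r x] by eventually_elim (simp add: algebra_simps)
    qed (intro borel_measurable_times borel_measurable_const borel_measurable_integrable integrable_Re_rep)+
    then show ?thesis unfolding inner_l2_def by simp
  qed
  have nn: "Re (rep_l2 x s * cnj (rep_l2 x s)) = (cmod (rep_l2 x s))\<^sup>2" for s
    by (rule Re_mult_cnj_self)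
  show "0 \<le> inner x x" unfolding inner_l2_def nn by simp
  show "inner x x = 0 \<longleftrightarrow> x = 0"
  proof
    assume "inner x x = 0"
    then have ae: "AE_l2 TYPE('a) (\<lambda>s. (cmod (rep_l2 x s))\<^sup>2 = 0)"
      using integrable_Re_rep[of x x] unfolding inner_l2_def nn
      by (subst (asm) integral_nonneg_eq_0_iff_AE) auto
    show "x = 0"
      by (rule l2_eqI) (use ae AE_zero in eventually_elim, simp)
  next
    assume "x = 0"
    have "AE_l2 TYPE('a) (\<lambda>s. Re (rep_l2 x s * cnj (rep_l2 x s)) = 0)"
      using AE_zero unfolding \<open>x = 0\<close> by eventually_elim simp
    then show "inner x x = 0" unfolding inner_l2_def by (rule integral_eq_zero_AE)
  qed
qed

end

lemma norm_l2_sq: "(norm (x :: 'p::l2_index l2))\<^sup>2 = (\<integral>s. (cmod (rep_l2 x s))\<^sup>2 \<partial>l2_measure TYPE('p))"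
  unfolding power2_norm_eq_inner inner_l2_def Re_mult_cnj_self ..

lemma AE_diff: "AE_l2 TYPE('p) (\<lambda>s. rep_l2 (x - y :: 'p::l2_index l2) s = rep_l2 x s - rep_l2 y s)"
  unfolding minus_l2_def using AE_plus[of x "- y"] AE_uminus[of y] by eventually_elim simp

lemma inner_l2_of:
  assumes "l2_mem TYPE('p) f" "l2_mem TYPE('p) g"
  shows "inner (l2_of f) (l2_of g :: 'p::l2_index l2) = (\<integral>s. Re (f s * cnj (g s)) \<partial>l2_measure TYPE('p))"
  unfolding inner_l2_def
proof (rule integral_cong_AE)
  show "AE_l2 TYPE('p) (\<lambda>s. Re (rep_l2 (l2_of f :: 'p l2) s * cnj (rep_l2 (l2_of g :: 'p l2) s)) = Re (f s * cnj (g s)))"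
    using AE_rep_l2_of[OF assms(1)] AE_rep_l2_of[OF assms(2)] by eventually_elim simp
  have "integrable (l2_measure TYPE('p)) (\<lambda>s. f s * cnj (g s))"
    using assms by (intro integrable_mult_sq sq_integrable_cnj) (auto simp: l2_mem_def)
  then show "(\<lambda>s. Re (f s * cnj (g s))) \<in> borel_measurable (l2_measure TYPE('p))"
    by (intro borel_measurable_integrable integrable_Re)
qed (intro borel_measurable_times borel_measurable_const borel_measurable_integrable integrable_Re_rep)+

lemma l2_of_add:
  assumes "l2_mem TYPE('p) f" "l2_mem TYPE('p) g"
  shows "l2_of (\<lambda>s. f s + g s) = (l2_of f + l2_of g :: 'p::l2_index l2)"
  unfolding plus_l2_def
  by (rule l2_of_cong) (use AE_rep_l2_of[OF assms(1)] AE_rep_l2_of[OF assms(2)] in eventually_elim, simp)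

lemma l2_of_scaleR:
  assumes "l2_mem TYPE('p) f"
  shows "l2_of (\<lambda>s. of_real r * f s) = (r *\<^sub>R l2_of f :: 'p::l2_index l2)"
  unfolding scaleR_l2_def
  by (rule l2_of_cong) (use AE_rep_l2_of[OF assms(1)] in eventually_elim, simp)

text \<open>\<open>Riesz_Fischer\<close> supplies the limit. The orthogonality constraint survives
  because, by Cauchy-Schwarz, the pairing with \<open>l2_orth\<close> is continuous in mean
  square.\<close>

instance l2 :: (l2_index) banach
proof
  fix X :: "nat \<Rightarrow> 'a l2"
  assume X: "Cauchy X"
  let ?M = "l2_measure TYPE('a)"
  have mem: "l2_mem TYPE('a) (rep_l2 (X n))" for n by (rule l2_mem_rep)
  have [measurable]: "rep_l2 x \<in> borel_measurable ?M" for x :: "'a l2"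
    using l2_mem_rep[of x] by (simp add: l2_mem_def sq_integrable_def)
  have D: "(\<integral>s. (cmod (rep_l2 (X m) s - rep_l2 (X n) s))\<^sup>2 \<partial>?M) = (norm (X m - X n))\<^sup>2" for m n
  proof -
    have "AE_l2 TYPE('a) (\<lambda>s. (cmod (rep_l2 (X m) s - rep_l2 (X n) s))\<^sup>2 = (cmod (rep_l2 (X m - X n) s))\<^sup>2)"
      using AE_diff[of "X m" "X n"] by eventually_elim simp
    then show ?thesis unfolding norm_l2_sq by (intro integral_cong_AE) measurable
  qed
  obtain F where F: "sq_integrable ?M F"
    and lim: "(\<lambda>n. \<integral>s. (cmod (rep_l2 (X n) s - F s))\<^sup>2 \<partial>?M) \<longlonglongrightarrow> 0"
  proof (rule Riesz_Fischer[of ?M "\<lambda>n. rep_l2 (X n)"])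
    show "sq_integrable ?M (rep_l2 (X n))" for n using mem by (simp add: l2_mem_def)
    fix e :: real assume "e > 0"
    then obtain N where N: "\<And>m n. m \<ge> N \<Longrightarrow> n \<ge> N \<Longrightarrow> norm (X m - X n) < sqrt e"
      using X unfolding Cauchy_def dist_norm by (meson real_sqrt_gt_zero)
    have "(norm (X m - X n))\<^sup>2 \<le> (sqrt e)\<^sup>2" if "m \<ge> N" "n \<ge> N" for m n
      by (rule power_mono[OF less_imp_le[OF N[OF that]] norm_ge_zero])
    then show "\<exists>N. \<forall>m\<ge>N. \<forall>n\<ge>N. (\<integral>s. (cmod (rep_l2 (X m) s - rep_l2 (X n) s))\<^sup>2 \<partial>?M) \<le> e"
      unfolding D using \<open>e > 0\<close> by auto
  qed
  have [measurable]: "F \<in> borel_measurable ?M" using F by measurable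
  have diff: "sq_integrable ?M (\<lambda>s. rep_l2 (X n) s - F s)" for n
    using mem F by (auto simp: l2_mem_def intro: sq_integrable_diff)
  let ?c = "\<integral>s. F s * l2_orth TYPE('a) s \<partial>?M"
  have "(cmod ?c)\<^sup>2 \<le> (\<integral>s. (cmod (rep_l2 (X n) s - F s))\<^sup>2 \<partial>?M) * (\<integral>s. (cmod (l2_orth TYPE('a) s))\<^sup>2 \<partial>?M)" for n
  proof -
    have "(\<integral>s. (rep_l2 (X n) s - F s) * l2_orth TYPE('a) s \<partial>?M) = 0 - ?c"
      using mem[of n] F integrable_mult_sq[OF _ sq_integrable_l2_orth[where 'a='a]]
      by (simp add: l2_mem_def left_diff_distrib)
    with Cauchy_Schwarz_integral[OF diff[of n] sq_integrable_l2_orth] show ?thesis by simp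
  qed
  moreover have "(\<lambda>n. (\<integral>s. (cmod (rep_l2 (X n) s - F s))\<^sup>2 \<partial>?M) * (\<integral>s. (cmod (l2_orth TYPE('a) s))\<^sup>2 \<partial>?M)) \<longlonglongrightarrow> 0"
    by (rule tendsto_mult_left_zero[OF lim])
  ultimately have "(cmod ?c)\<^sup>2 \<le> 0"
    by (intro LIMSEQ_le_const) auto
  with F have Fm: "l2_mem TYPE('a) F" by (simp add: l2_mem_def)
  have "(\<lambda>n. (norm (X n - l2_of F))\<^sup>2) = (\<lambda>n. \<integral>s. (cmod (rep_l2 (X n) s - F s))\<^sup>2 \<partial>?M)"
  proof
    fix n
    have "AE_l2 TYPE('a) (\<lambda>s. (cmod (rep_l2 (X n - l2_of F) s))\<^sup>2 = (cmod (rep_l2 (X n) s - F s))\<^sup>2)"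
      using AE_diff[of "X n" "l2_of F"] AE_rep_l2_of[OF Fm] by eventually_elim simp
    then show "(norm (X n - l2_of F))\<^sup>2 = (\<integral>s. (cmod (rep_l2 (X n) s - F s))\<^sup>2 \<partial>?M)"
      unfolding norm_l2_sq by (intro integral_cong_AE) measurable
  qed
  with lim have "(\<lambda>n. sqrt ((norm (X n - l2_of F))\<^sup>2)) \<longlonglongrightarrow> sqrt 0"
    by (intro tendsto_real_sqrt) simp
  then have "X \<longlonglongrightarrow> l2_of F"
    by (simp add: tendsto_norm_zero_iff LIM_zero_iff)
  then show "convergent X" by (auto simp: convergent_def)
qed

section \<open>Absolutely continuous functions on the unit interval\<close>

abbreviation I01 :: "real measure" where "I01 \<equiv> restrict_space lborel {0..1}"

lemma L2_iff: "S \<in> sets borel \<Longrightarrow> L2 S f \<longleftrightarrow> sq_integrable (restrict_space lborel S) f"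
  by (simp add: L2_def sq_integrable_def set_borel_measurable_def set_integrable_def
      borel_measurable_restrict_space_iff integrable_restrict_space)

lemma L2_UNIV_iff: "L2 UNIV f \<longleftrightarrow> sq_integrable lborel f"
  by (simp add: L2_def sq_integrable_def set_borel_measurable_def set_integrable_def)

lemma LINT_eq: "S \<in> sets borel \<Longrightarrow> (LINT x:S|lborel. f x) = (\<integral>x. f x \<partial>restrict_space lborel S)"
  for f :: "real \<Rightarrow> 'b::{banach, second_countable_topology}"
  by (simp add: set_lebesgue_integral_def integral_restrict_space)

lemma AE_I01_iff: "(AE x in I01. P x) \<longleftrightarrow> (AE x in lborel. x \<in> {0..1} \<longrightarrow> P x)"
  by (subst AE_restrict_space_iff) auto

lemma integrable_I01_iff: "integrable I01 f \<longleftrightarrow> set_integrable lborel {0..1} f"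
  for f :: "real \<Rightarrow> 'b::{banach, second_countable_topology}"
  by (simp add: integrable_restrict_space set_integrable_def)

lemma sq_integrable_continuous:
  assumes "continuous_on {0..1} f" shows "sq_integrable I01 f"
proof -
  have "integrable I01 f" "integrable I01 (\<lambda>x. (cmod (f x))\<^sup>2)"
    unfolding integrable_I01_iff by (intro borel_integrable_atLeastAtMost' continuous_intros assms)+
  then show ?thesis by (simp add: sq_integrable_def borel_measurable_integrable)
qed

lemma set_integrable_sq:
  assumes "sq_integrable I01 g" "A \<in> sets borel" "A \<subseteq> {0..1}"
  shows "set_integrable lborel A g"
proof -
  have "sq_integrable I01 (\<lambda>_. 1)" by (rule sq_integrable_continuous) auto
  from integrable_mult_sq[OF assms(1) this] have "set_integrable lborel {0..1} g"
    by (simp add: integrable_I01_iff)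
  then show ?thesis by (rule set_integrable_subset) (use assms in auto)
qed

lemma sq_integrable_mult_continuous:
  assumes "sq_integrable I01 f" "continuous_on {0..1} g"
  shows "sq_integrable I01 (\<lambda>x. f x * g x)"
proof -
  obtain C where "\<forall>x\<in>{0..1}. cmod (g x) \<le> C"
    using compact_imp_bounded[OF compact_continuous_image[OF assms(2) compact_Icc]]
    unfolding bounded_iff by auto
  then have C: "cmod (g x) \<le> C" if "x \<in> {0..1}" for x using that by blast
  have C0: "C \<ge> 0" using order_trans[OF norm_ge_zero C[of 0]] by simp
  show ?thesis
  proof (rule sq_integrable_bound)
    show "integrable I01 (\<lambda>x. C\<^sup>2 * (cmod (f x))\<^sup>2)" using assms(1) by (simp add: sq_integrable_def)
    show "AE x in I01. (cmod (f x * g x))\<^sup>2 \<le> C\<^sup>2 * (cmod (f x))\<^sup>2"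
      unfolding AE_I01_iff
    proof (intro always_eventually allI impI)
      fix x :: real assume "x \<in> {0..1}"
      then have "(cmod (g x))\<^sup>2 \<le> C\<^sup>2" using C C0 by (intro power_mono) auto
      then show "(cmod (f x * g x))\<^sup>2 \<le> C\<^sup>2 * (cmod (f x))\<^sup>2"
        unfolding norm_mult power_mult_distrib mult.commute[of "C\<^sup>2"] by (intro mult_left_mono) auto
    qed
    show "(\<lambda>x. f x * g x) \<in> borel_measurable I01"
      using assms(1) sq_integrable_continuous[OF assms(2)] by measurable
  qed
qed

lemma L2_01_iff: "L2 {0..1} f \<longleftrightarrow> sq_integrable I01 f"
  by (rule L2_iff) simp

lemma is_deriv01_sq: "is_deriv01 u g \<Longrightarrow> sq_integrable I01 g"
  unfolding is_deriv01_def L2_01_iff by blast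

lemma is_deriv01_at: "is_deriv01 u g \<Longrightarrow> x \<in> {0..1} \<Longrightarrow> u x = u 0 + (LINT s:{0..x}|lborel. g s)"
  unfolding is_deriv01_def by blast

lemma is_deriv01I:
  assumes "sq_integrable I01 g" "\<And>x. x \<in> {0..1} \<Longrightarrow> u x = u 0 + (LINT s:{0..x}|lborel. g s)"
  shows "is_deriv01 u g"
  unfolding is_deriv01_def L2_01_iff using assms by blast

lemma is_deriv01_set_integrable:
  "is_deriv01 u g \<Longrightarrow> x \<in> {0..1} \<Longrightarrow> set_integrable lborel {0..x} g"
  by (rule set_integrable_sq[OF is_deriv01_sq]) auto

lemma is_deriv01_integral:
  assumes "sq_integrable I01 g"
  shows "is_deriv01 (\<lambda>x. LINT s:{0..x}|lborel. g s) g"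
proof (rule is_deriv01I)
  have "set_integrable lborel {0..0} g" by (rule set_integrable_sq[OF assms]) auto
  then have "(LINT s:{0..0}|lborel. g s) = integral {0..0} g" by (rule set_borel_integral_eq_integral)
  then show "(LINT s:{0..x}|lborel. g s) = (LINT s:{0..0}|lborel. g s) + (LINT s:{0..x}|lborel. g s)" for x :: real
    by simp
qed (rule assms)

lemma is_deriv01_continuous:
  assumes "is_deriv01 u g" shows "continuous_on {0..1} u"
proof -
  have "continuous_on {0..1} (\<lambda>x. u 0 + integral {0..x} g)"
    using is_deriv01_set_integrable[OF assms, of 1]
    by (intro continuous_intros indefinite_integral_continuous_1 set_borel_integral_eq_integral) auto
  moreover have "u 0 + integral {0..x} g = u x" if "x \<in> {0..1}" for x
    using is_deriv01_at[OF assms that] set_borel_integral_eq_integral(2)[OF is_deriv01_set_integrable[OF assms that]]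
    by simp
  ultimately show ?thesis by (rule continuous_on_eq)
qed

lemma is_deriv01_cong:
  assumes "is_deriv01 u g" "\<And>x. x \<in> {0..1} \<Longrightarrow> u x = v x" "\<And>x. x \<in> {0..1} \<Longrightarrow> g x = h x"
  shows "is_deriv01 v h"
proof (rule is_deriv01I)
  have "sq_integrable I01 h \<longleftrightarrow> sq_integrable I01 g"
    unfolding sq_integrable_def using assms(3)
    by (intro conj_cong measurable_cong Bochner_Integration.integrable_cong) (auto simp: space_restrict_space)
  then show "sq_integrable I01 h" using is_deriv01_sq[OF assms(1)] by simp
  fix x :: real assume x: "x \<in> {0..1}"
  have "(LINT s:{0..x}|lborel. h s) = (LINT s:{0..x}|lborel. g s)"
    using x assms(3) by (intro set_lebesgue_integral_cong) auto
  then show "v x = v 0 + (LINT s:{0..x}|lborel. h s)"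
    using is_deriv01_at[OF assms(1) x] assms(2)[OF x] assms(2)[of 0] by simp
qed

lemma is_deriv01_add:
  assumes "is_deriv01 u g" "is_deriv01 v h"
  shows "is_deriv01 (\<lambda>x. u x + v x) (\<lambda>x. g x + h x)"
proof (rule is_deriv01I)
  show "sq_integrable I01 (\<lambda>x. g x + h x)" using assms by (intro sq_integrable_add is_deriv01_sq)
  fix x :: real assume x: "x \<in> {0..1}"
  show "u x + v x = u 0 + v 0 + (LINT s:{0..x}|lborel. g s + h s)"
    using is_deriv01_at[OF assms(1) x] is_deriv01_at[OF assms(2) x]
    by (simp add: set_integral_add is_deriv01_set_integrable[OF assms(1) x] is_deriv01_set_integrable[OF assms(2) x])
qed

lemma is_deriv01_cmult:
  assumes "is_deriv01 u g" shows "is_deriv01 (\<lambda>x. c * u x) (\<lambda>x. c * g x)"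
proof (rule is_deriv01I)
  show "sq_integrable I01 (\<lambda>x. c * g x)" using assms by (intro sq_integrable_cmult is_deriv01_sq)
  fix x :: real assume x: "x \<in> {0..1}"
  show "c * u x = c * u 0 + (LINT s:{0..x}|lborel. c * g s)"
    using is_deriv01_at[OF assms(1) x] by (simp add: algebra_simps)
qed

lemma is_deriv01_lincomb:
  assumes "is_deriv01 u g" "is_deriv01 v h"
  shows "is_deriv01 (\<lambda>x. c * u x + v x) (\<lambda>x. c * g x + h x)"
  by (intro is_deriv01_add is_deriv01_cmult assms)

lemma is_deriv01_cnj:
  assumes "is_deriv01 u g" shows "is_deriv01 (\<lambda>x. cnj (u x)) (\<lambda>x. cnj (g x))"
proof (rule is_deriv01I)
  show "sq_integrable I01 (\<lambda>x. cnj (g x))" using assms by (intro sq_integrable_cnj is_deriv01_sq)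
  fix x :: real assume x: "x \<in> {0..1}"
  have "(LINT s:{0..x}|lborel. cnj (g s)) = cnj (LINT s:{0..x}|lborel. g s)"
    unfolding set_lebesgue_integral_def by (subst Bochner_Integration.integral_cnj[symmetric]) simp
  then show "cnj (u x) = cnj (u 0) + (LINT s:{0..x}|lborel. cnj (g s))"
    using is_deriv01_at[OF assms(1) x] by simp
qed

lemma is_deriv01_FTC:
  assumes "\<And>x. x \<in> {0..1} \<Longrightarrow> (F has_vector_derivative f x) (at x within {0..1})" "continuous_on {0..1} f"
  shows "is_deriv01 F f"
proof (rule is_deriv01I)
  fix x :: real assume x: "x \<in> {0..1}"
  have "integral\<^sup>L lborel (\<lambda>s. indicator {0..x} s *\<^sub>R f s) = F x - F 0"
    using x by (intro integral_FTC_atLeastAtMost)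
      (auto intro: continuous_on_subset[OF assms(2)] has_vector_derivative_within_subset[OF assms(1)])
  then show "F x = F 0 + (LINT s:{0..x}|lborel. f s)" by (simp add: set_lebesgue_integral_def)
qed (rule sq_integrable_continuous[OF assms(2)])

subsection \<open>Uniqueness of the derivative\<close>

text \<open>For the extension of h by zero, the integrals over all half-lines vanish. Half-lines are
  stable under intersection and generate the Borel sets, so the integrals over all Borel sets
  vanish, and the integrand is zero a.e.\<close>

lemma AE_zero_if_primitive_zero:
  fixes h :: "real \<Rightarrow> complex"
  assumes int: "set_integrable lborel {0..1} h" and zero: "\<And>x. x \<in> {0..1} \<Longrightarrow> (LINT s:{0..x}|lborel. h s) = 0"
  shows "AE x in I01. h x = 0"
proof -
  define H where "H x = indicator {0..1} x *\<^sub>R h x" for x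
  have H: "integrable lborel H" using int by (simp add: H_def[abs_def] set_integrable_def)
  have H': "set_integrable lborel A H" if "A \<in> sets borel" for A
    unfolding set_integrable_def by (rule integrable_mult_indicator) (use that H in auto)
  have atMost: "(LINT x:{..a}|lborel. H x) = 0" for a :: real
  proof -
    have "(LINT x:{..a}|lborel. H x) = (LINT x:{0..min a 1}|lborel. h x)"
      unfolding set_lebesgue_integral_def H_def
      by (intro Bochner_Integration.integral_cong) (auto simp: indicator_def)
    also have "\<dots> = 0"
    proof (cases "a \<ge> 0")
      case False then show ?thesis by (simp add: set_lebesgue_integral_def)
    qed (auto intro: zero)
    finally show ?thesis .
  qed
  have total: "(LINT x:UNIV|lborel. H x) = 0"
    using zero[of 1] by (simp add: set_lebesgue_integral_def H_def)
  have "(LINT x:A|lborel. H x) = 0" if "A \<in> sigma_sets UNIV (range atMost)" for A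
  proof -
    have "Int_stable (range (atMost :: real \<Rightarrow> _))" "range (atMost :: real \<Rightarrow> _) \<subseteq> Pow UNIV"
      by (auto simp: Int_stable_def)
    then show ?thesis using that
    proof (induction rule: sigma_sets_induct_disjoint)
    case (compl A)
    then have A: "A \<in> sets borel" by (simp add: borel_eq_atMost)
    have "(LINT x:A \<union> (UNIV - A)|lborel. H x) = (LINT x:A|lborel. H x) + (LINT x:UNIV - A|lborel. H x)"
      using A by (intro set_integral_Un H') auto
    then show ?case using compl total by simp
  next
    case (union A)
    then have A: "A i \<in> sets borel" for i by (auto simp: borel_eq_atMost)
    have "(LINT x:(\<Union>i. A i)|lborel. H x) = (\<Sum>i. (LINT x:A i|lborel. H x))"
      using A union by (intro lebesgue_integral_countable_add H') (auto simp: disjoint_family_on_def)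
    then show ?case using union by simp
    qed (auto simp: atMost set_lebesgue_integral_def[of _ "{}"])
  qed
  then have "AE x in lborel. H x = 0"
    using H by (intro sigma_finite_measure.density_zero[OF sigma_finite_lborel]) (auto simp: borel_eq_atMost)
  then show ?thesis unfolding AE_I01_iff by eventually_elim (auto simp: H_def)
qed

lemma is_deriv01_unique:
  assumes "is_deriv01 u g" "is_deriv01 v h" "\<And>x. x \<in> {0..1} \<Longrightarrow> u x = v x"
  shows "AE x in I01. g x = h x"
proof -
  have d: "is_deriv01 (\<lambda>x. -1 * v x + u x) (\<lambda>x. -1 * h x + g x)"
    by (rule is_deriv01_lincomb[OF assms(2,1)])
  have "AE x in I01. -1 * h x + g x = 0"
  proof (rule AE_zero_if_primitive_zero)
    show "set_integrable lborel {0..1} (\<lambda>x. -1 * h x + g x)"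
      by (rule is_deriv01_set_integrable[OF d]) simp
    show "(LINT s:{0..x}|lborel. -1 * h s + g s) = 0" if "x \<in> {0..1}" for x
      using is_deriv01_at[OF d that] assms(3)[OF that] assms(3)[of 0] by simp
  qed
  then show ?thesis by eventually_elim simp
qed

text \<open>If the functions differed at x, they would differ on an interval inside [0,1] of
  positive length, even when x is an endpoint.\<close>

lemma continuous_AE_eq:
  fixes f g :: "real \<Rightarrow> complex"
  assumes "continuous_on {0..1} f" "continuous_on {0..1} g" "AE x in I01. f x = g x" "x \<in> {0..1}"
  shows "f x = g x"
proof (rule ccontr)
  assume ne: "f x \<noteq> g x"
  have "continuous_on {0..1} (\<lambda>x. f x - g x)" by (intro continuous_intros assms)
  then obtain d where d: "d > 0" "\<And>y. y \<in> {0..1} \<Longrightarrow> dist y x < d \<Longrightarrow> dist (f y - g y) (f x - g x) < norm (f x - g x)"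
    using assms(4) ne unfolding continuous_on_iff by (metis right_minus_eq zero_less_norm_iff)
  let ?S = "{max 0 (x - d)<..<min 1 (x + d)}"
  have "?S \<subseteq> {y. \<not> (y \<in> {0..1} \<longrightarrow> f y = g y)}"
  proof
    fix y assume "y \<in> ?S"
    then have "y \<in> {0..1}" "dist y x < d" by (auto simp: dist_real_def)
    from d(2)[OF this] this show "y \<in> {y. \<not> (y \<in> {0..1} \<longrightarrow> f y = g y)}"
      by (auto simp: dist_norm norm_minus_commute)
  qed
  moreover obtain N where "N \<in> null_sets lborel" "{y. \<not> (y \<in> {0..1} \<longrightarrow> f y = g y)} \<subseteq> N"
  proof (rule AE_E3[OF assms(3)[unfolded AE_I01_iff]])
    fix N assume "\<And>y. y \<in> space lborel - N \<Longrightarrow> y \<in> {0..1} \<longrightarrow> f y = g y" "N \<in> null_sets lborel"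
    then show thesis by (intro that[of N]) auto
  qed
  ultimately have "?S \<in> null_sets lborel"
    using null_sets_subset[of _ lborel ?S] by auto
  moreover have "emeasure lborel ?S > 0"
    using d(1) assms(4) by (subst emeasure_lborel_Ioo) auto
  ultimately show False by (simp add: null_sets_def)
qed

subsection \<open>The product rule\<close>

text \<open>Fubini: \<open>G s * H t\<close> is integrated over the triangle t <= s and over the
  complementary one, the diagonal being a null set. This is the product rule in integrated
  form.\<close>

lemma integral_triangle:
  fixes G H :: "real \<Rightarrow> complex"
  assumes G: "integrable lborel G" and H: "integrable lborel H"
  shows "(\<integral>s. G s * (\<integral>t. indicator {..s} t *\<^sub>R H t \<partial>lborel) \<partial>lborel) +
         (\<integral>t. (\<integral>s. indicator {..t} s *\<^sub>R G s \<partial>lborel) * H t \<partial>lborel) =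
         (\<integral>s. G s \<partial>lborel) * (\<integral>t. H t \<partial>lborel)"
proof -
  have [measurable]: "G \<in> borel_measurable borel" "H \<in> borel_measurable borel"
    using borel_measurable_integrable[OF G] borel_measurable_integrable[OF H] by auto
  define f where "f s t = (if t \<le> s then G s * H t else 0)" for s t
  have [measurable]: "case_prod f \<in> borel_measurable (lborel \<Otimes>\<^sub>M lborel)"
    unfolding f_def case_prod_beta' by measurable
  have sec: "integrable lborel (\<lambda>t. f s t)" for s
    by (rule Bochner_Integration.integrable_bound[OF integrable_mult_right[OF H, of "G s"]])
       (auto simp: f_def)
  have "integrable (lborel \<Otimes>\<^sub>M lborel) (\<lambda>p. G (fst p) * H (snd p))"
  proof (rule lborel_pair.Fubini_integrable)
    have "(\<lambda>x. \<integral>y. norm (G (fst (x, y)) * H (snd (x, y))) \<partial>lborel) = (\<lambda>x. norm (G x) * (\<integral>y. norm (H y) \<partial>lborel))"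
      by (simp add: norm_mult)
    then show "integrable lborel (\<lambda>x. \<integral>y. norm (G (fst (x, y)) * H (snd (x, y))) \<partial>lborel)" using G by simp
  qed (use H in auto)
  then have int: "integrable (lborel \<Otimes>\<^sub>M lborel) (case_prod f)"
    by (rule Bochner_Integration.integrable_bound) (auto simp: f_def)
  have lt: "(\<integral>s. f s t \<partial>lborel) = ((\<integral>s. G s \<partial>lborel) - (\<integral>s. indicator {..t} s *\<^sub>R G s \<partial>lborel)) * H t" for t
  proof -
    have i: "integrable lborel (\<lambda>s. indicator {..t} s *\<^sub>R G s)"
      by (rule integrable_mult_indicator) (auto simp: G)
    have "(\<integral>s. f s t \<partial>lborel) = (\<integral>s. (G s - indicator {..t} s *\<^sub>R G s) * H t \<partial>lborel)"
    proof (rule integral_cong_AE)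
      show "AE s in lborel. f s t = (G s - indicator {..t} s *\<^sub>R G s) * H t"
        using AE_lborel_singleton[of t] by eventually_elim (auto simp: f_def indicator_def)
      show "(\<lambda>s. f s t) \<in> borel_measurable lborel" unfolding f_def by measurable
    qed measurable
    also have "\<dots> = ((\<integral>s. G s \<partial>lborel) - (\<integral>s. indicator {..t} s *\<^sub>R G s \<partial>lborel)) * H t"
      using G i by simp
    finally show ?thesis .
  qed
  have rt: "(\<integral>t. f s t \<partial>lborel) = G s * (\<integral>t. indicator {..s} t *\<^sub>R H t \<partial>lborel)" for s
  proof -
    have "(\<integral>t. f s t \<partial>lborel) = (\<integral>t. G s * (indicator {..s} t *\<^sub>R H t) \<partial>lborel)"
      by (intro Bochner_Integration.integral_cong) (auto simp: f_def indicator_def)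
    then show ?thesis unfolding integral_mult_right_zero .
  qed
  have "(\<integral>t. (\<integral>s. f s t \<partial>lborel) \<partial>lborel) = (\<integral>s. (\<integral>t. f s t \<partial>lborel) \<partial>lborel)"
    by (rule lborel_pair.Fubini_integral[OF int])
  then have eq: "(\<integral>t. (\<integral>s. G s \<partial>lborel) * H t - (\<integral>s. indicator {..t} s *\<^sub>R G s \<partial>lborel) * H t \<partial>lborel) =
      (\<integral>s. G s * (\<integral>t. indicator {..s} t *\<^sub>R H t \<partial>lborel) \<partial>lborel)"
    unfolding lt rt left_diff_distrib .
  have "integrable lborel (\<lambda>t. \<integral>s. f s t \<partial>lborel)" using lborel_pair.integrable_snd[OF int] by simp
  then have "integrable lborel (\<lambda>t. (\<integral>s. G s \<partial>lborel) * H t - (\<integral>s. f s t \<partial>lborel))"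
    using H by (intro Bochner_Integration.integrable_diff integrable_mult_right)
  then have "integrable lborel (\<lambda>t. (\<integral>s. indicator {..t} s *\<^sub>R G s \<partial>lborel) * H t)"
    unfolding lt by (simp add: left_diff_distrib)
  with eq H show ?thesis by (simp add: algebra_simps)
qed

text \<open>Derivatives here are L^2 functions rather than pointwise limits, so the product rule
  comes from \<open>integral_triangle\<close> with g and h cut off at x. The inner integrals are
  then the increments u s - u 0 and v s - v 0.\<close>

lemma is_deriv01_mult:
  assumes u: "is_deriv01 u g" and v: "is_deriv01 v h"
  shows "is_deriv01 (\<lambda>x. u x * v x) (\<lambda>x. g x * v x + u x * h x)"
proof (rule is_deriv01I)
  have gv: "sq_integrable I01 (\<lambda>x. g x * v x)"
    by (rule sq_integrable_mult_continuous[OF is_deriv01_sq[OF u] is_deriv01_continuous[OF v]])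
  have uh: "sq_integrable I01 (\<lambda>x. u x * h x)"
    using sq_integrable_mult_continuous[OF is_deriv01_sq[OF v] is_deriv01_continuous[OF u]]
    by (simp add: mult.commute)
  show "sq_integrable I01 (\<lambda>x. g x * v x + u x * h x)" by (rule sq_integrable_add[OF gv uh])
  fix x :: real assume x: "x \<in> {0..1}"
  define G H where "G s = indicator {0..x} s *\<^sub>R g s" and "H s = indicator {0..x} s *\<^sub>R h s" for s
  have G: "integrable lborel G" and H: "integrable lborel H"
    using is_deriv01_set_integrable[OF u x] is_deriv01_set_integrable[OF v x]
    by (auto simp: G_def[abs_def] H_def[abs_def] set_integrable_def)
  have gv': "set_integrable lborel {0..x} (\<lambda>s. g s * v s)" and uh': "set_integrable lborel {0..x} (\<lambda>s. u s * h s)"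
    and g': "set_integrable lborel {0..x} g" and h': "set_integrable lborel {0..x} h"
    using set_integrable_sq[OF gv] set_integrable_sq[OF uh] is_deriv01_set_integrable[OF u x]
      is_deriv01_set_integrable[OF v x] x by auto
  have prim: "(\<integral>t. indicator {..s} t *\<^sub>R (indicator {0..x} t *\<^sub>R k t) \<partial>lborel) = w s - w 0"
    if "s \<in> {0..x}" "is_deriv01 w k" for s w k
  proof -
    have "(\<integral>t. indicator {..s} t *\<^sub>R (indicator {0..x} t *\<^sub>R k t) \<partial>lborel) = (LINT t:{0..s}|lborel. k t)"
      unfolding set_lebesgue_integral_def
      by (intro Bochner_Integration.integral_cong) (use that in \<open>auto simp: indicator_def\<close>)
    then show ?thesis using is_deriv01_at[OF that(2), of s] that x by auto
  qed
  have primG: "(\<integral>t. indicator {..s} t *\<^sub>R G t \<partial>lborel) = u s - u 0"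
    and primH: "(\<integral>t. indicator {..s} t *\<^sub>R H t \<partial>lborel) = v s - v 0" if "s \<in> {0..x}" for s
    unfolding G_def H_def by (rule prim[OF that u], rule prim[OF that v])
  have "G s * (\<integral>t. indicator {..s} t *\<^sub>R H t \<partial>lborel) = indicator {0..x} s *\<^sub>R (g s * (v s - v 0))" for s
    by (cases "s \<in> {0..x}") (simp_all add: primH G_def)
  then have "(\<integral>s. G s * (\<integral>t. indicator {..s} t *\<^sub>R H t \<partial>lborel) \<partial>lborel) = (LINT s:{0..x}|lborel. g s * (v s - v 0))"
    unfolding set_lebesgue_integral_def by simp
  also have "\<dots> = (LINT s:{0..x}|lborel. g s * v s) - (u x - u 0) * v 0"
    using gv' g' is_deriv01_at[OF u x] by (simp add: right_diff_distrib set_integral_diff)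
  finally have 1: "(\<integral>s. G s * (\<integral>t. indicator {..s} t *\<^sub>R H t \<partial>lborel) \<partial>lborel) = \<dots>" .
  have "(\<integral>s. indicator {..t} s *\<^sub>R G s \<partial>lborel) * H t = indicator {0..x} t *\<^sub>R ((u t - u 0) * h t)" for t
    by (cases "t \<in> {0..x}") (simp_all add: primG H_def)
  then have "(\<integral>t. (\<integral>s. indicator {..t} s *\<^sub>R G s \<partial>lborel) * H t \<partial>lborel) = (LINT s:{0..x}|lborel. (u s - u 0) * h s)"
    unfolding set_lebesgue_integral_def by simp
  also have "\<dots> = (LINT s:{0..x}|lborel. u s * h s) - u 0 * (v x - v 0)"
    using uh' h' is_deriv01_at[OF v x] by (simp add: left_diff_distrib set_integral_diff)
  finally have 2: "(\<integral>t. (\<integral>s. indicator {..t} s *\<^sub>R G s \<partial>lborel) * H t \<partial>lborel) = \<dots>" .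
  have 3: "(\<integral>s. G s \<partial>lborel) = u x - u 0" "(\<integral>s. H s \<partial>lborel) = v x - v 0"
    using is_deriv01_at[OF u x] is_deriv01_at[OF v x] by (auto simp: G_def H_def set_lebesgue_integral_def)
  have "(LINT s:{0..x}|lborel. g s * v s) + (LINT s:{0..x}|lborel. u s * h s) = u x * v x - u 0 * v 0"
    using integral_triangle[OF G H] unfolding 1 2 3 by algebra
  then show "u x * v x = u 0 * v 0 + (LINT s:{0..x}|lborel. g s * v s + u s * h s)"
    using gv' uh' by (simp add: set_integral_add)
qed

lemma integration_by_parts:
  assumes "is_deriv01 u g" "is_deriv01 v h"
  shows "(\<integral>x. g x * v x + u x * h x \<partial>I01) = u 1 * v 1 - u 0 * v 0"
  using is_deriv01_at[OF is_deriv01_mult[OF assms], of 1] by (simp add: LINT_eq)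

section \<open>Second-order boundary value problems\<close>

lemma is_deriv01_of_real:
  assumes "\<And>x. (f has_real_derivative f' x) (at x)" "continuous_on {0..1} f'"
  shows "is_deriv01 (\<lambda>x. of_real (f x)) (\<lambda>x. of_real (f' x))"
proof (rule is_deriv01_FTC)
  show "((\<lambda>x. complex_of_real (f x)) has_vector_derivative of_real (f' x)) (at x within {0..1})" for x
    using assms(1)[of x]
    by (intro has_vector_derivative_of_real has_vector_derivative_at_within)
       (simp add: has_real_derivative_iff_has_vector_derivative)
  show "continuous_on {0..1} (\<lambda>x. complex_of_real (f' x))" by (intro continuous_intros assms)
qed

lemma is_deriv01_shift:
  assumes "is_deriv01 u g" shows "is_deriv01 (\<lambda>x. u x - u 0) g"
proof (rule is_deriv01I[OF is_deriv01_sq[OF assms]])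
  fix x :: real assume "x \<in> {0..1}"
  from is_deriv01_at[OF assms this] show "u x - u 0 = u 0 - u 0 + (LINT s:{0..x}|lborel. g s)" by simp
qed

text \<open>Variation of constants: u(x) is -1/m times the integral over [0,x] of sinh(m (x - s))
  h(s). Writing sinh by exponentials gives u = (d P0 - e Q0) / (2 m), where P0 and Q0 are the
  primitives of h e and h d that vanish at 0.\<close>

lemma inhomogeneous_solution:
  assumes m: "m \<noteq> 0" and h: "sq_integrable I01 h"
  obtains u g where "is_deriv01 u g" "is_deriv01 g (\<lambda>x. of_real (m\<^sup>2) * u x - h x)" "u 0 = 0"
proof -
  define e d :: "real \<Rightarrow> complex" where "e x = of_real (exp (m * x))" and "d x = of_real (exp (- m * x))" for x
  have ed: "e x * d x = 1" for x
    by (simp add: e_def d_def exp_minus flip: of_real_mult)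
  have e': "is_deriv01 e (\<lambda>x. of_real m * e x)"
    unfolding e_def[abs_def] of_real_mult[symmetric]
    by (rule is_deriv01_of_real) (auto intro!: derivative_eq_intros continuous_intros)
  have d': "is_deriv01 d (\<lambda>x. of_real (- m) * d x)"
    unfolding d_def[abs_def] of_real_mult[symmetric]
    by (rule is_deriv01_of_real) (auto intro!: derivative_eq_intros continuous_intros)
  obtain Q where Q: "is_deriv01 Q (\<lambda>x. h x * d x)"
    by (rule that[OF is_deriv01_integral[OF sq_integrable_mult_continuous[OF h is_deriv01_continuous[OF d']]]])
  obtain P where P: "is_deriv01 P (\<lambda>x. h x * e x)"
    by (rule that[OF is_deriv01_integral[OF sq_integrable_mult_continuous[OF h is_deriv01_continuous[OF e']]]])
  define c where "c = complex_of_real (1 / (2 * m))"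
  have c: "c * of_real m = 1/2" using m by (simp add: c_def)
  define Q0 P0 where "Q0 = (\<lambda>x. Q x - Q 0)" and "P0 = (\<lambda>x. P x - P 0)"
  have Q0: "is_deriv01 Q0 (\<lambda>x. h x * d x)" and P0: "is_deriv01 P0 (\<lambda>x. h x * e x)"
    unfolding Q0_def P0_def by (rule is_deriv01_shift[OF Q], rule is_deriv01_shift[OF P])
  note eQ = is_deriv01_mult[OF e' Q0] and dP = is_deriv01_mult[OF d' P0]
  show ?thesis
  proof (rule that)
    show "is_deriv01 (\<lambda>x. c * (d x * P0 x) + - c * (e x * Q0 x)) (\<lambda>x. - (1/2) * (d x * P0 x) + - (1/2) * (e x * Q0 x))"
    proof (rule is_deriv01_cong[OF is_deriv01_add[OF is_deriv01_cmult[OF dP, of c] is_deriv01_cmult[OF eQ, of "- c"]]])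
      fix x :: real
      \<comment> \<open>The two terms with h cancel in the first derivative. In the second
        derivative they add up to -h, because e d = 1.\<close>
      have "c * (of_real (- m) * d x * P0 x + d x * (h x * e x)) + - c * (of_real m * e x * Q0 x + e x * (h x * d x)) =
          - (c * of_real m) * (d x * P0 x) - (c * of_real m) * (e x * Q0 x)"
        by (simp add: algebra_simps)
      then show "c * (of_real (- m) * d x * P0 x + d x * (h x * e x)) + - c * (of_real m * e x * Q0 x + e x * (h x * d x)) =
          - (1/2) * (d x * P0 x) + - (1/2) * (e x * Q0 x)"
        unfolding c by simp
    qed simp
    show "is_deriv01 (\<lambda>x. - (1/2) * (d x * P0 x) + - (1/2) * (e x * Q0 x))
        (\<lambda>x. of_real (m\<^sup>2) * (c * (d x * P0 x) + - c * (e x * Q0 x)) - h x)"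
    proof (rule is_deriv01_cong[OF is_deriv01_add[OF is_deriv01_cmult[OF dP, of "-(1/2)"] is_deriv01_cmult[OF eQ, of "-(1/2)"]]])
      fix x :: real
      have "of_real (m\<^sup>2) * c = of_real m * (c * of_real m)" by (simp add: power2_eq_square)
      then have mc: "of_real (m\<^sup>2) * c = of_real m / 2" unfolding c by simp
      have "-(1/2) * (of_real (- m) * d x * P0 x + d x * (h x * e x)) + -(1/2) * (of_real m * e x * Q0 x + e x * (h x * d x))
          = of_real m / 2 * (d x * P0 x) - of_real m / 2 * (e x * Q0 x) - (e x * d x) * h x"
        by (simp add: algebra_simps)
      also have "\<dots> = of_real (m\<^sup>2) * (c * (d x * P0 x) + - c * (e x * Q0 x)) - h x"
        unfolding ed mc[symmetric] by (simp add: algebra_simps)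
      finally show "-(1/2) * (of_real (- m) * d x * P0 x + d x * (h x * e x)) + -(1/2) * (of_real m * e x * Q0 x + e x * (h x * d x))
          = of_real (m\<^sup>2) * (c * (d x * P0 x) + - c * (e x * Q0 x)) - h x" .
    qed simp
    show "c * (d 0 * P0 0) + - c * (e 0 * Q0 0) = 0" by (simp add: P0_def Q0_def)
  qed
qed

text \<open>sinh(m x) solves the homogeneous equation and vanishes at 0, so adding a multiple of it
  adjusts the condition at 1 alone. Solvability is the nonvanishing of its boundary expression
  there. The coefficients p and q cover the Robin end of u and the Dirichlet end of y.\<close>

lemma boundary_value_problem:
  fixes m p q :: real and r :: complex
  assumes m: "m \<noteq> 0" and h: "sq_integrable I01 h" and pq: "p * sinh m + q * (m * cosh m) \<noteq> 0"
  obtains u g where "is_deriv01 u g" "is_deriv01 g (\<lambda>x. of_real (m\<^sup>2) * u x - h x)" "u 0 = 0"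
    "of_real p * u 1 + of_real q * g 1 = r"
proof -
  obtain u g where u: "is_deriv01 u g" "is_deriv01 g (\<lambda>x. of_real (m\<^sup>2) * u x - h x)" "u 0 = 0"
    using inhomogeneous_solution[OF m h] by blast
  let ?s = "\<lambda>x. complex_of_real (sinh (m * x))" and ?c = "\<lambda>x. complex_of_real (m * cosh (m * x))"
  have s: "is_deriv01 ?s ?c"
    by (rule is_deriv01_of_real) (auto intro!: derivative_eq_intros continuous_intros)
  have c: "is_deriv01 ?c (\<lambda>x. of_real (m * (m * sinh (m * x))))"
    by (rule is_deriv01_of_real) (auto intro!: derivative_eq_intros continuous_intros)
  define D where "D = complex_of_real (p * sinh m + q * (m * cosh m))"
  have D: "D \<noteq> 0" using pq unfolding D_def by (simp only: of_real_eq_0_iff not_False_eq_True)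
  define C where "C = (r - of_real p * u 1 - of_real q * g 1) / D"
  show ?thesis
  proof (rule that)
    show "is_deriv01 (\<lambda>x. C * ?s x + u x) (\<lambda>x. C * ?c x + g x)"
      by (rule is_deriv01_lincomb[OF s u(1)])
    show "is_deriv01 (\<lambda>x. C * ?c x + g x) (\<lambda>x. of_real (m\<^sup>2) * (C * ?s x + u x) - h x)"
      by (rule is_deriv01_cong[OF is_deriv01_lincomb[OF c u(2), of C]])
         (simp_all add: power2_eq_square algebra_simps)
    show "C * ?s 0 + u 0 = 0" using u(3) by simp
    have "of_real p * (C * ?s 1 + u 1) + of_real q * (C * ?c 1 + g 1) = C * D + of_real p * u 1 + of_real q * g 1"
      by (simp add: D_def algebra_simps)
    also have "\<dots> = r" using D by (simp add: C_def)
    finally show "of_real p * (C * ?s 1 + u 1) + of_real q * (C * ?c 1 + g 1) = r" .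
  qed
qed

section \<open>The weight of the diffusive realization\<close>

lemma integrable_lborel_if_has_integral:
  fixes f :: "real \<Rightarrow> real"
  assumes "f \<in> borel_measurable borel" "\<And>x. 0 \<le> f x" "(f has_integral r) S" "\<And>x. x \<notin> S \<Longrightarrow> f x = 0"
  shows "integrable lborel f"
proof (rule integrableI_nonneg)
  have "(f has_integral r) UNIV"
    using assms(3,4) by (intro has_integral_on_superset[OF assms(3)]) auto
  from nn_integral_has_integral_lborel[OF assms(1,2) this]
  show "(\<integral>\<^sup>+x. ennreal (f x) \<partial>lborel) < \<infinity>" by simp
qed (use assms in auto)

lemma measurable_mu [measurable]: "mu \<alpha> \<in> borel_measurable borel"
  unfolding mu_def[abs_def] by measurable

text \<open>Here mu^2 = |xi|^(2 alpha - 1). Near 0 the exponent exceeds -1 because alpha > 0; at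
  infinity, after division by xi^2, it is below -1 because alpha < 1.\<close>

lemma integrable_mu_sq:
  assumes "0 < \<alpha>" "\<alpha> < 1" "l > 0"
  shows "integrable lborel (\<lambda>\<xi>. (mu \<alpha> \<xi>)\<^sup>2 / (l + \<xi>\<^sup>2))"
proof -
  define P where "P x = (if x \<in> {0..1} then x powr (2 * \<alpha> - 1) else 0)" for x :: real
  define Q where "Q x = (if x \<in> {1..} then x powr (2 * \<alpha> - 3) else 0)" for x :: real
  have [measurable]: "P \<in> borel_measurable borel" "Q \<in> borel_measurable borel"
    unfolding P_def[abs_def] Q_def[abs_def] by measurable
  have P: "integrable lborel P"
  proof (rule integrable_lborel_if_has_integral)
    have "((\<lambda>x. x powr (2 * \<alpha> - 1)) has_integral (1 powr (2 * \<alpha> - 1 + 1) / (2 * \<alpha> - 1 + 1))) {0..1}"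
      using assms by (intro has_integral_powr_from_0) auto
    then show "(P has_integral (1 powr (2 * \<alpha> - 1 + 1) / (2 * \<alpha> - 1 + 1))) {0..1}"
      by (rule has_integral_eq[rotated]) (simp add: P_def)
  qed (auto simp: P_def)
  have Q: "integrable lborel Q"
  proof (rule integrable_lborel_if_has_integral)
    have "((\<lambda>x. x powr (2 * \<alpha> - 3)) has_integral -(1 powr (2 * \<alpha> - 3 + 1)) / (2 * \<alpha> - 3 + 1)) {1..}"
      using assms by (intro has_integral_powr_to_inf) auto
    then show "(Q has_integral -(1 powr (2 * \<alpha> - 3 + 1)) / (2 * \<alpha> - 3 + 1)) {1..}"
      by (rule has_integral_eq[rotated]) (simp add: Q_def)
  qed (auto simp: Q_def)
  have refl: "integrable lborel (\<lambda>x. f (- x))" if "integrable lborel f" for f :: "real \<Rightarrow> real"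
    using lborel_integrable_real_affine[OF that, of "-1" 0] by simp
  define W where "W x = 1/l * (P x + P (-x)) + (Q x + Q (-x))" for x
  have W: "integrable lborel W" unfolding W_def
    by (intro Bochner_Integration.integrable_add integrable_mult_right P Q refl)
  have mu2: "(mu \<alpha> \<xi>)\<^sup>2 = \<bar>\<xi>\<bar> powr (2 * \<alpha> - 1)" for \<xi>
    unfolding mu_def by (simp add: power2_eq_square flip: powr_add)
  have bound: "(mu \<alpha> \<xi>)\<^sup>2 / (l + \<xi>\<^sup>2) \<le> W \<xi>" for \<xi>
  proof (cases "\<bar>\<xi>\<bar> \<le> 1")
    case True
    have "\<bar>\<xi>\<bar> powr (2 * \<alpha> - 1) / (l + \<xi>\<^sup>2) \<le> \<bar>\<xi>\<bar> powr (2 * \<alpha> - 1) / l"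
      using assms by (intro divide_left_mono mult_pos_pos add_pos_nonneg) auto
    also have "\<dots> \<le> 1/l * (P \<xi> + P (-\<xi>))"
      using assms True by (auto simp: P_def abs_if field_simps)
    also have "\<dots> \<le> W \<xi>" by (auto simp: W_def Q_def)
    finally show ?thesis by (simp add: mu2)
  next
    case False
    have "\<bar>\<xi>\<bar> powr (2 * \<alpha> - 1) / (l + \<xi>\<^sup>2) \<le> \<bar>\<xi>\<bar> powr (2 * \<alpha> - 1) / \<xi>\<^sup>2"
      using assms False by (intro divide_left_mono mult_pos_pos add_pos_nonneg) auto
    also have "\<dots> = \<bar>\<xi>\<bar> powr (2 * \<alpha> - 1 - 2)"
      using False powr_realpow[of "\<bar>\<xi>\<bar>" 2] by (subst powr_diff) simp
    also have "\<dots> \<le> Q \<xi> + Q (-\<xi>)"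
      using False by (auto simp: Q_def)
    also have "\<dots> \<le> W \<xi>" using assms by (auto simp: W_def P_def)
    finally show ?thesis by (simp add: mu2)
  qed
  show ?thesis
  proof (rule Bochner_Integration.integrable_bound[OF W])
    show "AE x in lborel. norm ((mu \<alpha> x)\<^sup>2 / (l + x\<^sup>2)) \<le> norm (W x)"
    proof (intro always_eventually allI)
      fix x
      have "0 \<le> (mu \<alpha> x)\<^sup>2 / (l + x\<^sup>2)" using assms by (intro divide_nonneg_nonneg) auto
      then show "norm ((mu \<alpha> x)\<^sup>2 / (l + x\<^sup>2)) \<le> norm (W x)"
        using bound[of x] unfolding real_norm_def by linarith
    qed
  qed measurable
qed

lemma sq_integrable_mult_bounded:
  fixes k :: "'a \<Rightarrow> real"
  assumes f: "sq_integrable M f" and [measurable]: "k \<in> borel_measurable M"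
    and bound: "\<And>x. \<bar>k x\<bar> \<le> C"
  shows "sq_integrable M (\<lambda>x. of_real (k x) * f x)"
proof (rule sq_integrable_bound)
  show "integrable M (\<lambda>x. C\<^sup>2 * (cmod (f x))\<^sup>2)" using f by (simp add: sq_integrable_def)
  have "\<bar>k x\<bar>\<^sup>2 \<le> C\<^sup>2" for x using bound by (intro power_mono) auto
  then show "AE x in M. (cmod (of_real (k x) * f x))\<^sup>2 \<le> C\<^sup>2 * (cmod (f x))\<^sup>2"
    unfolding norm_mult norm_of_real power_mult_distrib
    by (intro always_eventually allI mult_right_mono) auto
qed (use f in measurable)

lemma sq_integrable_resolvent:
  assumes "sq_integrable lborel f" "l > 0"
  shows "sq_integrable lborel (\<lambda>\<xi>. of_real (1 / (l + \<xi>\<^sup>2)) * f \<xi>)"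
    and "sq_integrable lborel (\<lambda>\<xi>. of_real (\<bar>\<xi>\<bar> / (l + \<xi>\<^sup>2)) * f \<xi>)"
proof -
  have pos: "0 < l + \<xi>\<^sup>2" for \<xi> :: real using assms(2) by (intro add_pos_nonneg) auto
  show "sq_integrable lborel (\<lambda>\<xi>. of_real (1 / (l + \<xi>\<^sup>2)) * f \<xi>)"
    using assms pos by (intro sq_integrable_mult_bounded[where C="1/l"])
      (auto intro!: divide_left_mono mult_pos_pos simp: abs_of_pos less_imp_le)
  show "sq_integrable lborel (\<lambda>\<xi>. of_real (\<bar>\<xi>\<bar> / (l + \<xi>\<^sup>2)) * f \<xi>)"
  proof (rule sq_integrable_mult_bounded[where C="1 + 1/l"])
    fix \<xi> :: real
    have "0 \<le> (\<bar>\<xi>\<bar> - 1)\<^sup>2" by simp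
    then have "\<bar>\<xi>\<bar> \<le> 1 + \<xi>\<^sup>2" unfolding power2_diff by (simp add: power2_eq_square)
    also have "\<dots> \<le> l + \<xi>\<^sup>2 + (1 + \<xi>\<^sup>2 / l)" using assms by simp
    also have "\<dots> = (1 + 1/l) * (l + \<xi>\<^sup>2)" using assms by (simp add: field_simps)
    finally show "\<bar>\<bar>\<xi>\<bar> / (l + \<xi>\<^sup>2)\<bar> \<le> 1 + 1/l" using pos[of \<xi>] by (simp add: abs_of_pos pos_divide_le_eq)
  qed (use assms in auto)
qed

text \<open>Each square splits into the integrable factor mu^2 / (l + xi^2) and a bounded one,
  namely 1 / (l + xi^2) or xi^2 / (l + xi^2).\<close>

lemma sq_integrable_mu_resolvent:
  assumes "0 < \<alpha>" "\<alpha> < 1" "l > 0"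
  shows "sq_integrable lborel (\<lambda>\<xi>. of_real (mu \<alpha> \<xi> / (l + \<xi>\<^sup>2)))"
    and "sq_integrable lborel (\<lambda>\<xi>. of_real (\<bar>\<xi>\<bar> * (mu \<alpha> \<xi> / (l + \<xi>\<^sup>2))))"
proof -
  have pos: "0 < l + \<xi>\<^sup>2" for \<xi> :: real using assms(3) by (intro add_pos_nonneg) auto
  have eq: "((mu \<alpha> \<xi>) / (l + \<xi>\<^sup>2))\<^sup>2 = 1 / (l + \<xi>\<^sup>2) * ((mu \<alpha> \<xi>)\<^sup>2 / (l + \<xi>\<^sup>2))" for \<xi>
    by (simp add: power_divide power2_eq_square)
  have nn: "0 \<le> (mu \<alpha> \<xi>)\<^sup>2 / (l + \<xi>\<^sup>2)" for \<xi> using pos[of \<xi>] by simp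
  show "sq_integrable lborel (\<lambda>\<xi>. of_real (mu \<alpha> \<xi> / (l + \<xi>\<^sup>2)))"
  proof (rule sq_integrable_bound)
    show "integrable lborel (\<lambda>\<xi>. 1/l * ((mu \<alpha> \<xi>)\<^sup>2 / (l + \<xi>\<^sup>2)))"
      by (intro integrable_mult_right integrable_mu_sq assms)
    have "1 / (l + \<xi>\<^sup>2) \<le> 1/l" for \<xi> :: real
      using pos assms by (intro divide_left_mono mult_pos_pos) auto
    then show "AE \<xi> in lborel. (cmod (of_real (mu \<alpha> \<xi> / (l + \<xi>\<^sup>2))))\<^sup>2 \<le> 1/l * ((mu \<alpha> \<xi>)\<^sup>2 / (l + \<xi>\<^sup>2))"
      unfolding norm_of_real power2_abs eq by (intro always_eventually allI mult_right_mono nn)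
  qed measurable
  show "sq_integrable lborel (\<lambda>\<xi>. of_real (\<bar>\<xi>\<bar> * (mu \<alpha> \<xi> / (l + \<xi>\<^sup>2))))"
  proof (rule sq_integrable_bound)
    show "integrable lborel (\<lambda>\<xi>. (mu \<alpha> \<xi>)\<^sup>2 / (l + \<xi>\<^sup>2))" by (intro integrable_mu_sq assms)
    have "\<bar>\<xi>\<bar>\<^sup>2 * (1 / (l + \<xi>\<^sup>2)) \<le> 1" for \<xi> :: real
      using pos[of \<xi>] assms by simp
    then have "\<bar>\<xi>\<bar>\<^sup>2 * (1 / (l + \<xi>\<^sup>2)) * ((mu \<alpha> \<xi>)\<^sup>2 / (l + \<xi>\<^sup>2)) \<le> 1 * ((mu \<alpha> \<xi>)\<^sup>2 / (l + \<xi>\<^sup>2))" for \<xi>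
      by (intro mult_right_mono nn)
    then show "AE \<xi> in lborel. (cmod (of_real (\<bar>\<xi>\<bar> * (mu \<alpha> \<xi> / (l + \<xi>\<^sup>2)))))\<^sup>2 \<le> (mu \<alpha> \<xi>)\<^sup>2 / (l + \<xi>\<^sup>2)"
      unfolding norm_of_real power2_abs power_mult_distrib eq by (simp add: mult.assoc)
  qed measurable
qed

text \<open>Makes the boundary integral in the domain converge absolutely. With s = 1 + xi^2 one has
  2 |mu| |w| <= mu^2 / s + s |w|^2, and s |w|^2 is the sum of the two squares assumed
  integrable.\<close>

lemma integrable_mu_mult:
  assumes "0 < \<alpha>" "\<alpha> < 1" "sq_integrable lborel w" "sq_integrable lborel (\<lambda>\<xi>. of_real \<bar>\<xi>\<bar> * w \<xi>)"
  shows "integrable lborel (\<lambda>\<xi>. of_real (mu \<alpha> \<xi>) * w \<xi>)"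
proof (rule Bochner_Integration.integrable_bound)
  show "integrable lborel (\<lambda>\<xi>. (mu \<alpha> \<xi>)\<^sup>2 / (1 + \<xi>\<^sup>2) + ((cmod (w \<xi>))\<^sup>2 + (cmod (of_real \<bar>\<xi>\<bar> * w \<xi>))\<^sup>2))"
    using assms by (intro Bochner_Integration.integrable_add integrable_mu_sq) (auto simp: sq_integrable_def)
  show "AE \<xi> in lborel. norm (of_real (mu \<alpha> \<xi>) * w \<xi>) \<le>
      norm ((mu \<alpha> \<xi>)\<^sup>2 / (1 + \<xi>\<^sup>2) + ((cmod (w \<xi>))\<^sup>2 + (cmod (of_real \<bar>\<xi>\<bar> * w \<xi>))\<^sup>2))"
  proof (intro always_eventually allI)
    fix \<xi>
    define A B s where "A = \<bar>mu \<alpha> \<xi>\<bar>" and "B = cmod (w \<xi>)" and "s = 1 + \<xi>\<^sup>2"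
    have s: "s > 0" unfolding s_def by (intro add_pos_nonneg) auto
    have "0 \<le> (A - s * B)\<^sup>2 / s" using s by simp
    also have "\<dots> = A\<^sup>2 / s - 2 * (A * B) + s * B\<^sup>2"
      using s by (simp add: power2_eq_square field_simps)
    finally have "2 * (A * B) \<le> A\<^sup>2 / s + s * B\<^sup>2" by simp
    moreover have "0 \<le> A * B" by (simp add: A_def B_def)
    ultimately have "A * B \<le> A\<^sup>2 / s + s * B\<^sup>2" by linarith
    also have "\<dots> = (mu \<alpha> \<xi>)\<^sup>2 / (1 + \<xi>\<^sup>2) + ((cmod (w \<xi>))\<^sup>2 + (cmod (of_real \<bar>\<xi>\<bar> * w \<xi>))\<^sup>2)"
      by (simp add: A_def B_def s_def norm_mult power_mult_distrib algebra_simps)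
    finally have "A * B \<le> \<dots>" .
    then show "norm (of_real (mu \<alpha> \<xi>) * w \<xi>) \<le>
      norm ((mu \<alpha> \<xi>)\<^sup>2 / (1 + \<xi>\<^sup>2) + ((cmod (w \<xi>))\<^sup>2 + (cmod (of_real \<bar>\<xi>\<bar> * w \<xi>))\<^sup>2))"
      unfolding A_def B_def by (simp add: norm_mult)
  qed
qed (use assms in measurable)

section \<open>The energy space\<close>

datatype interval_ix = Interval_Ix
text \<open>Up to null sets, the derivatives of functions in H^1_0(0,1) are exactly the
  square-integrable functions of mean zero; this index describes the slot of y_x.\<close>

datatype meanzero_ix = Meanzero_Ix
datatype line_ix = Line_Ix

instantiation interval_ix :: l2_index
begin
definition "l2_measure_interval_ix (_ :: interval_ix itself) = I01"
definition "l2_orth_interval_ix (_ :: interval_ix itself) = (\<lambda>_ :: real. 0 :: complex)"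
instance by standard (simp add: l2_orth_interval_ix_def)
end

instantiation meanzero_ix :: l2_index
begin
definition "l2_measure_meanzero_ix (_ :: meanzero_ix itself) = I01"
definition "l2_orth_meanzero_ix (_ :: meanzero_ix itself) = (\<lambda>_ :: real. 1 :: complex)"
instance by standard (auto simp: l2_orth_meanzero_ix_def l2_measure_meanzero_ix_def intro: sq_integrable_continuous)
end

instantiation line_ix :: l2_index
begin
definition "l2_measure_line_ix (_ :: line_ix itself) = (lborel :: real measure)"
definition "l2_orth_line_ix (_ :: line_ix itself) = (\<lambda>_ :: real. 0 :: complex)"
instance by standard (simp add: l2_orth_line_ix_def)
end

lemmas l2_ix_defs = l2_measure_interval_ix_def l2_measure_meanzero_ix_def l2_measure_line_ix_def
  l2_orth_interval_ix_def l2_orth_meanzero_ix_def l2_orth_line_ix_def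

lemma l2_mem_interval: "l2_mem TYPE(interval_ix) f \<longleftrightarrow> sq_integrable I01 f"
  and l2_mem_meanzero: "l2_mem TYPE(meanzero_ix) f \<longleftrightarrow> sq_integrable I01 f \<and> (\<integral>x. f x \<partial>I01) = 0"
  and l2_mem_line: "l2_mem TYPE(line_ix) f \<longleftrightarrow> sq_integrable lborel f"
  by (simp_all add: l2_mem_def l2_ix_defs)

text \<open>The components are \<open>u\<^sub>x\<close>, \<open>v\<close>, \<open>a\<^sup>1\<^sup>/\<^sup>2 y\<^sub>x\<close>, \<open>z\<close> and \<open>(\<gamma> \<kappa>)\<^sup>1\<^sup>/\<^sup>2 \<omega>\<close>.\<close>

type_synonym energy_space =
  "interval_ix l2 \<times> interval_ix l2 \<times> meanzero_ix l2 \<times> interval_ix l2 \<times> line_ix l2"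

lemma H1_dx: "H1 u \<Longrightarrow> is_deriv01 u (dx u)"
  unfolding H1_def dx_def by (rule someI_ex[of "is_deriv01 u"])

lemma H1I: "is_deriv01 u g \<Longrightarrow> H1 u"
  unfolding H1_def by blast

lemma dx_AE: "is_deriv01 u g \<Longrightarrow> AE x in I01. dx u x = g x"
  by (rule is_deriv01_unique[OF H1_dx[OF H1I]]) auto

lemma H2_dxc:
  assumes "H2 u" shows "is_deriv01 u (dxc u)" "is_deriv01 (dxc u) (dxx u)"
proof -
  have *: "is_deriv01 u (dxc u) \<and> (\<exists>h. is_deriv01 (dxc u) h)"
    unfolding dxc_def
    by (rule someI_ex[of "\<lambda>g. is_deriv01 u g \<and> (\<exists>h. is_deriv01 g h)"]) (use assms in \<open>auto simp: H2_def\<close>)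
  then show "is_deriv01 u (dxc u)" by blast
  show "is_deriv01 (dxc u) (dxx u)" unfolding dxx_def
    by (rule someI_ex[of "is_deriv01 (dxc u)"]) (use * in blast)
qed

lemma H2I: "is_deriv01 u g \<Longrightarrow> is_deriv01 g h \<Longrightarrow> H2 u"
  unfolding H2_def by blast

text \<open>\<open>dxc\<close> is an arbitrary choice among the derivatives that are themselves in
  H^1. Continuity pins it down at every point of [0,1], which gives the trace at 1 in the domain a
  definite value.\<close>

lemma dxc_eq:
  assumes "is_deriv01 u g" "is_deriv01 g h" "x \<in> {0..1}"
  shows "dxc u x = g x"
proof (rule continuous_AE_eq[OF _ _ _ assms(3)])
  note d = H2_dxc[OF H2I[OF assms(1,2)]]
  show "continuous_on {0..1} (dxc u)" "continuous_on {0..1} g"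
    by (rule is_deriv01_continuous[OF d(2)], rule is_deriv01_continuous[OF assms(2)])
  show "AE x in I01. dxc u x = g x" by (rule is_deriv01_unique[OF d(1) assms(1)]) simp
qed

lemma dxx_AE:
  assumes "is_deriv01 u g" "is_deriv01 g h" shows "AE x in I01. dxx u x = h x"
  by (rule is_deriv01_unique[OF H2_dxc(2)[OF H2I[OF assms]] assms(2)]) (rule dxc_eq[OF assms])

lemma H10_integral:
  assumes "is_deriv01 y g" "y 0 = 0" "y 1 = 0" shows "(\<integral>x. g x \<partial>I01) = 0"
  using is_deriv01_at[OF assms(1), of 1] assms(2,3) by (simp add: LINT_eq)

text \<open>With a complex coefficient one operation serves for differences (c = -1), real multiples
  (second argument \<open>Hzero\<close>) and multiplication by i.\<close>

definition Hlin :: "complex \<Rightarrow> state \<Rightarrow> state \<Rightarrow> state" where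
  "Hlin c U W = (case U of (u, v, y, z, \<omega>) \<Rightarrow> case W of (u', v', y', z', \<omega>') \<Rightarrow>
     (\<lambda>x. c * u x + u' x, \<lambda>x. c * v x + v' x, \<lambda>x. c * y x + y' x, \<lambda>x. c * z x + z' x, \<lambda>x. c * \<omega> x + \<omega>' x))"

definition Hzero :: state where "Hzero = (\<lambda>_. 0, \<lambda>_. 0, \<lambda>_. 0, \<lambda>_. 0, \<lambda>_. 0)"

lemma Hsub_eq: "Hsub U W = Hlin (-1) W U"
  by (simp add: Hsub_def Hlin_def split: prod.splits)

lemma Hscale_eq: "Hscale c U = Hlin (of_real c) U Hzero"
  by (simp add: Hscale_def Hlin_def Hzero_def split: prod.splits)

lemma inH_iff: "inH (u, v, y, z, \<omega>) \<longleftrightarrow>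
  H1 u \<and> u 0 = 0 \<and> sq_integrable I01 v \<and> H1 y \<and> y 0 = 0 \<and> y 1 = 0 \<and> sq_integrable I01 z \<and> sq_integrable lborel \<omega>"
  by (auto simp: inH_def H1L_def H10_def L2_01_iff L2_UNIV_iff)

lemma H1_lincomb: "H1 u \<Longrightarrow> H1 v \<Longrightarrow> H1 (\<lambda>x. c * u x + v x)"
  using H1I[OF is_deriv01_lincomb[OF H1_dx H1_dx]] by blast

lemma sq_integrable_lincomb:
  "sq_integrable M f \<Longrightarrow> sq_integrable M g \<Longrightarrow> sq_integrable M (\<lambda>x. c * f x + g x)"
  by (intro sq_integrable_add sq_integrable_cmult)

lemma inH_Hlin: "inH U \<Longrightarrow> inH W \<Longrightarrow> inH (Hlin c U W)"
  by (cases U; cases W) (auto simp: Hlin_def inH_iff H1_lincomb sq_integrable_lincomb)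

lemma is_deriv01_zero: "is_deriv01 (\<lambda>_. 0) (\<lambda>_. 0)"
  by (rule is_deriv01I) (simp_all add: set_lebesgue_integral_def)

lemma inH_Hzero: "inH Hzero"
  using H1I[OF is_deriv01_zero] by (simp add: Hzero_def inH_iff)

locale wave_system =
  fixes \<alpha> \<eta> \<gamma> a :: real
  assumes \<alpha>: "0 < \<alpha>" "\<alpha> < 1" and \<eta>: "\<eta> \<ge> 0" and \<gamma>: "\<gamma> > 0" and a: "a > 0"
begin

abbreviation "inD \<equiv> inDA a \<gamma> \<alpha> \<eta>"
abbreviation "gen b \<equiv> Aop a b \<alpha> \<eta>"
abbreviation "ip \<equiv> Hinner a \<gamma> \<alpha>"
abbreviation "hnorm \<equiv> Hnorm a \<gamma> \<alpha>"

definition \<delta> :: real where "\<delta> = \<gamma> * kappa \<alpha>"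

lemma \<delta>_pos: "\<delta> > 0"
proof -
  have "0 < sin (\<alpha> * pi)" using \<alpha> by (intro sin_gt_zero) auto
  then show ?thesis using \<gamma> by (simp add: \<delta>_def kappa_def)
qed

text \<open>The square roots of the weights turn the energy form into the unweighted inner product
  of the product space. The map is onto but not injective: null sets and values outside [0,1] are
  forgotten.\<close>

definition emb :: "state \<Rightarrow> energy_space" where
  "emb U = (case U of (u, v, y, z, \<omega>) \<Rightarrow>
     (l2_of (dx u), l2_of v, sqrt a *\<^sub>R l2_of (dx y), l2_of z, sqrt \<delta> *\<^sub>R l2_of \<omega>))"

lemma mem_components:
  assumes "inH (u, v, y, z, \<omega>)"
  shows "l2_mem TYPE(interval_ix) (dx u)" "l2_mem TYPE(interval_ix) v" "l2_mem TYPE(meanzero_ix) (dx y)"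
    "l2_mem TYPE(interval_ix) z" "l2_mem TYPE(line_ix) \<omega>"
  using assms is_deriv01_sq[OF H1_dx] H10_integral[OF H1_dx]
  by (auto simp: inH_iff l2_mem_interval l2_mem_meanzero l2_mem_line)

lemma emb_Hlin:
  assumes "inH U" "inH W"
  shows "emb (Hlin (of_real c) U W) = c *\<^sub>R emb U + emb W"
proof -
  obtain u v y z w u' v' y' z' w' where UW: "U = (u, v, y, z, w)" "W = (u', v', y', z', w')" by (cases U; cases W)
  note m = mem_components[OF assms(1)[unfolded UW]] mem_components[OF assms(2)[unfolded UW]]
  have H: "H1 u" "H1 u'" "H1 y" "H1 y'" using assms by (auto simp: UW inH_iff)
  have u: "l2_of (dx (\<lambda>x. of_real c * u x + u' x)) = (l2_of (\<lambda>x. of_real c * dx u x + dx u' x) :: interval_ix l2)"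
    by (rule l2_of_cong) (unfold l2_ix_defs, rule dx_AE[OF is_deriv01_lincomb[OF H1_dx[OF H(1)] H1_dx[OF H(2)]]])
  have y: "l2_of (dx (\<lambda>x. of_real c * y x + y' x)) = (l2_of (\<lambda>x. of_real c * dx y x + dx y' x) :: meanzero_ix l2)"
    by (rule l2_of_cong) (unfold l2_ix_defs, rule dx_AE[OF is_deriv01_lincomb[OF H1_dx[OF H(3)] H1_dx[OF H(4)]]])
  show ?thesis
    unfolding UW Hlin_def emb_def prod.case u y
    by (simp add: l2_of_add l2_of_scaleR l2_mem_cmult m scaleR_add_right mult.commute)
qed

lemma emb_Hsub: "inH U \<Longrightarrow> inH W \<Longrightarrow> emb (Hsub U W) = emb U - emb W"
  using emb_Hlin[of W U "-1"] by (simp add: Hsub_eq)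

lemma emb_Hscale: "inH U \<Longrightarrow> emb (Hscale c U) = c *\<^sub>R emb U"
  using emb_Hlin[OF _ inH_Hzero, of U c] emb_Hlin[OF inH_Hzero inH_Hzero, of "-1"]
  by (simp add: Hscale_eq) (simp add: Hlin_def Hzero_def)

lemma inH_Hsub: "inH U \<Longrightarrow> inH W \<Longrightarrow> inH (Hsub U W)"
  by (simp add: Hsub_eq inH_Hlin)

lemma inH_Hscale: "inH U \<Longrightarrow> inH (Hscale c U)"
  by (simp add: Hscale_eq inH_Hlin inH_Hzero)

lemma inner_emb:
  assumes U: "inH (u, v, y, z, w)" and W: "inH (u', v', y', z', w')"
  shows "inner (emb (u, v, y, z, w)) (emb (u', v', y', z', w')) =
    (\<integral>x. Re (dx u x * cnj (dx u' x)) \<partial>I01) + (\<integral>x. Re (v x * cnj (v' x)) \<partial>I01)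
    + a * (\<integral>x. Re (dx y x * cnj (dx y' x)) \<partial>I01) + (\<integral>x. Re (z x * cnj (z' x)) \<partial>I01)
    + \<delta> * (\<integral>x. Re (w x * cnj (w' x)) \<partial>lborel)"
proof -
  note m = mem_components[OF U] mem_components[OF W]
  have "inner (emb (u, v, y, z, w)) (emb (u', v', y', z', w')) =
    (\<integral>x. Re (dx u x * cnj (dx u' x)) \<partial>I01) + ((\<integral>x. Re (v x * cnj (v' x)) \<partial>I01)
    + ((sqrt a * sqrt a) * (\<integral>x. Re (dx y x * cnj (dx y' x)) \<partial>I01) + ((\<integral>x. Re (z x * cnj (z' x)) \<partial>I01)
    + (sqrt \<delta> * sqrt \<delta>) * (\<integral>x. Re (w x * cnj (w' x)) \<partial>lborel))))"
    unfolding emb_def prod.case inner_Pair inner_scaleR_left inner_scaleR_right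
      inner_l2_of[OF m(1,6)] inner_l2_of[OF m(2,7)] inner_l2_of[OF m(3,8)] inner_l2_of[OF m(4,9)] inner_l2_of[OF m(5,10)]
      l2_ix_defs by (simp only: mult.assoc)
  then show ?thesis using a \<delta>_pos by simp
qed

lemma Re_Hinner:
  assumes "inH U" "inH W"
  shows "Re (ip U W) = inner (emb U) (emb W)"
proof -
  obtain u v y z w u' v' y' z' w' where UW: "U = (u, v, y, z, w)" "W = (u', v', y', z', w')" by (cases U; cases W)
  note m = mem_components[OF assms(1)[unfolded UW]] mem_components[OF assms(2)[unfolded UW]]
  have i: "integrable I01 (\<lambda>x. f x * cnj (g x))" if "sq_integrable I01 f" "sq_integrable I01 g" for f g
    by (rule integrable_mult_sq[OF that(1) sq_integrable_cnj[OF that(2)]])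
  note m' = m[unfolded l2_mem_interval l2_mem_meanzero l2_mem_line]
  have iv: "integrable I01 (\<lambda>x. v x * cnj (v' x))" and iu: "integrable I01 (\<lambda>x. dx u x * cnj (dx u' x))"
    and iz: "integrable I01 (\<lambda>x. z x * cnj (z' x))" and iy: "integrable I01 (\<lambda>x. dx y x * cnj (dx y' x))"
    and iw: "integrable lborel (\<lambda>x. w x * cnj (w' x))"
    using m' by (auto intro: i integrable_mult_sq sq_integrable_cnj)
  have "ip U W = (\<integral>x. v x * cnj (v' x) \<partial>I01) + (\<integral>x. dx u x * cnj (dx u' x) \<partial>I01)
      + (\<integral>x. z x * cnj (z' x) \<partial>I01) + of_real a * (\<integral>x. dx y x * cnj (dx y' x) \<partial>I01)
      + of_real \<delta> * (\<integral>x. w x * cnj (w' x) \<partial>lborel)"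
    unfolding UW Hinner_def prod.case LINT_eq[OF borel_closed[OF closed_atLeastAtMost]] \<delta>_def
    using iv iu iz iy by (simp add: mult.assoc)
  then have "Re (ip U W) = (\<integral>x. Re (v x * cnj (v' x)) \<partial>I01) + (\<integral>x. Re (dx u x * cnj (dx u' x)) \<partial>I01)
      + (\<integral>x. Re (z x * cnj (z' x)) \<partial>I01) + a * (\<integral>x. Re (dx y x * cnj (dx y' x)) \<partial>I01)
      + \<delta> * (\<integral>x. Re (w x * cnj (w' x)) \<partial>lborel)"
    unfolding integral_Re[OF iv] integral_Re[OF iu] integral_Re[OF iz] integral_Re[OF iy] integral_Re[OF iw]
    by simp
  then show ?thesis using inner_emb[OF assms[unfolded UW]] by (simp add: UW)
qed

lemma Hnorm_Hsub: "inH U \<Longrightarrow> inH W \<Longrightarrow> hnorm (Hsub U W) = norm (emb U - emb W)"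
  by (simp add: Hnorm_def Re_Hinner inH_Hsub emb_Hsub norm_eq_sqrt_inner)

text \<open>Multiplication by i. The energy form is conjugate linear in its second argument, so Im
  (U, W) = Re (U, iW).\<close>

definition Hi :: "state \<Rightarrow> state" where "Hi U = Hlin \<i> U Hzero"

lemma inH_Hi: "inH U \<Longrightarrow> inH (Hi U)"
  by (simp add: Hi_def inH_Hlin inH_Hzero)

lemma dx_Hi: "H1 u \<Longrightarrow> AE x in I01. dx (\<lambda>x. \<i> * u x + 0) x = \<i> * dx u x"
  using dx_AE[OF is_deriv01_cmult[OF H1_dx, of u \<i>]] by simp

lemma Hinner_Hi_right:
  assumes "inH U" "inH W" shows "ip U (Hi W) = - \<i> * ip U W"
proof -
  obtain u v y z w u' v' y' z' w' where UW: "U = (u, v, y, z, w)" "W = (u', v', y', z', w')" by (cases U; cases W)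
  have H: "H1 u'" "H1 y'" using assms by (auto simp: UW inH_iff)
  have meas: "dx u \<in> borel_measurable I01" "dx y \<in> borel_measurable I01" "dx u' \<in> borel_measurable I01" "dx y' \<in> borel_measurable I01"
    "v \<in> borel_measurable I01" "z \<in> borel_measurable I01" "v' \<in> borel_measurable I01" "z' \<in> borel_measurable I01"
    "dx (\<lambda>x. \<i> * u' x + 0) \<in> borel_measurable I01" "dx (\<lambda>x. \<i> * y' x + 0) \<in> borel_measurable I01"
    using mem_components[OF assms(1)[unfolded UW]] mem_components[OF assms(2)[unfolded UW]]
      mem_components[OF inH_Hi[OF assms(2), unfolded UW Hi_def Hlin_def Hzero_def prod.case]]
    by (auto simp: l2_mem_interval l2_mem_meanzero sq_integrable_def)
  note [measurable] = meas
  have [measurable]: "cnj \<in> borel_measurable borel" by (intro borel_measurable_continuous_onI continuous_intros)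
  have "(\<integral>x. v x * cnj (\<i> * v' x + 0) + dx u x * cnj (dx (\<lambda>x. \<i> * u' x + 0) x) + z x * cnj (\<i> * z' x + 0)
        + complex_of_real a * dx y x * cnj (dx (\<lambda>x. \<i> * y' x + 0) x) \<partial>I01)
    = (\<integral>x. - \<i> * (v x * cnj (v' x) + dx u x * cnj (dx u' x) + z x * cnj (z' x)
        + complex_of_real a * dx y x * cnj (dx y' x)) \<partial>I01)"
  proof (rule integral_cong_AE)
    show "AE x in I01. v x * cnj (\<i> * v' x + 0) + dx u x * cnj (dx (\<lambda>x. \<i> * u' x + 0) x) + z x * cnj (\<i> * z' x + 0)
        + complex_of_real a * dx y x * cnj (dx (\<lambda>x. \<i> * y' x + 0) x)
      = - \<i> * (v x * cnj (v' x) + dx u x * cnj (dx u' x) + z x * cnj (z' x)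
        + complex_of_real a * dx y x * cnj (dx y' x))"
      using dx_Hi[OF H(1)] dx_Hi[OF H(2)] by eventually_elim (simp add: algebra_simps)
  qed measurable
  moreover have "(\<integral>x. w x * cnj (\<i> * w' x + 0) \<partial>lborel) = (\<integral>x. - \<i> * (w x * cnj (w' x)) \<partial>lborel)"
    by (intro Bochner_Integration.integral_cong) (simp_all add: algebra_simps)
  ultimately show ?thesis
    unfolding UW Hinner_def Hi_def Hlin_def Hzero_def prod.case LINT_eq[OF borel_closed[OF closed_atLeastAtMost]]
      integral_mult_right_zero
    by (simp only: distrib_left mult.left_commute)
qed

lemma Im_Hinner: "inH U \<Longrightarrow> inH W \<Longrightarrow> Im (ip U W) = inner (emb U) (emb (Hi W))"
  using Re_Hinner[of U "Hi W"] by (simp add: Hinner_Hi_right inH_Hi)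

text \<open>Integration from 0 recovers u and y from their derivatives with value 0 at the left end,
  and mean zero of the third component gives y(1) = 0.\<close>

lemma emb_surj:
  obtains U where "inH U" "emb U = x"
proof -
  obtain p v q z w where x: "x = (p, v, q, z, w)" by (cases x)
  define U where "U = (\<lambda>x. LINT s:{0..x}|lborel. rep_l2 p s, rep_l2 v,
    \<lambda>x. of_real (1 / sqrt a) * (LINT s:{0..x}|lborel. rep_l2 q s), rep_l2 z, \<lambda>s. of_real (1 / sqrt \<delta>) * rep_l2 w s)"
  have p: "sq_integrable I01 (rep_l2 p)" and q: "sq_integrable I01 (rep_l2 q)" "(\<integral>x. rep_l2 q x \<partial>I01) = 0"
    and w: "sq_integrable lborel (rep_l2 w)" and vz: "sq_integrable I01 (rep_l2 v)" "sq_integrable I01 (rep_l2 z)"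
    using l2_mem_rep[of p] l2_mem_rep[of q] l2_mem_rep[of v] l2_mem_rep[of z] l2_mem_rep[of w]
    by (auto simp: l2_mem_interval l2_mem_meanzero l2_mem_line)
  have dp: "is_deriv01 (\<lambda>x. LINT s:{0..x}|lborel. rep_l2 p s) (rep_l2 p)" by (rule is_deriv01_integral[OF p])
  have dq: "is_deriv01 (\<lambda>x. of_real (1 / sqrt a) * (LINT s:{0..x}|lborel. rep_l2 q s)) (\<lambda>x. of_real (1 / sqrt a) * rep_l2 q x)"
    by (rule is_deriv01_cmult[OF is_deriv01_integral[OF q(1)]])
  have zero: "(LINT s:{0}|lborel. f s) = 0" for f :: "real \<Rightarrow> complex"
    unfolding set_lebesgue_integral_def
    by (rule integral_eq_zero_AE) (use AE_lborel_singleton[of 0] in eventually_elim, simp)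
  have inH: "inH U"
    unfolding U_def inH_iff
    by (intro conjI H1I[OF dp] H1I[OF dq] vz sq_integrable_cmult[OF w])
      (simp_all add: zero LINT_eq[of "{0..1}"] q(2))
  have "l2_of (dx (\<lambda>x. LINT s:{0..x}|lborel. rep_l2 p s)) = p"
    by (subst l2_of_rep[of p, symmetric], rule l2_of_cong) (unfold l2_ix_defs, rule dx_AE[OF dp])
  moreover have "l2_of (dx (\<lambda>x. of_real (1 / sqrt a) * (LINT s:{0..x}|lborel. rep_l2 q s))) = (1 / sqrt a) *\<^sub>R q"
  proof -
    have "l2_of (dx (\<lambda>x. of_real (1 / sqrt a) * (LINT s:{0..x}|lborel. rep_l2 q s))) =
        (l2_of (\<lambda>x. of_real (1 / sqrt a) * rep_l2 q x) :: meanzero_ix l2)"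
      by (rule l2_of_cong) (unfold l2_ix_defs, rule dx_AE[OF dq])
    then show ?thesis unfolding l2_of_scaleR[OF l2_mem_rep[of q]] l2_of_rep .
  qed
  moreover have "l2_of (\<lambda>s. of_real (1 / sqrt \<delta>) * rep_l2 w s) = (1 / sqrt \<delta>) *\<^sub>R w"
    unfolding l2_of_scaleR[OF l2_mem_rep[of w]] l2_of_rep ..
  ultimately have "emb U = x" unfolding U_def emb_def prod.case x using a \<delta>_pos by simp
  with inH that show ?thesis by blast
qed

end

section \<open>The generator\<close>

context wave_system
begin

lemma inDA_iff: "inD (u, v, y, z, w) \<longleftrightarrow> inH (u, v, y, z, w) \<and> H2 u \<and> H2 y \<and>
   H1 v \<and> v 0 = 0 \<and> H1 z \<and> z 0 = 0 \<and> z 1 = 0 \<and>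
   sq_integrable lborel (\<lambda>\<xi>. - of_real (\<xi>\<^sup>2 + \<eta>) * w \<xi> + v 1 * of_real (mu \<alpha> \<xi>)) \<and>
   sq_integrable lborel (\<lambda>\<xi>. of_real \<bar>\<xi>\<bar> * w \<xi>) \<and>
   dxc u 1 + of_real \<delta> * (\<integral>\<xi>. of_real (mu \<alpha> \<xi>) * w \<xi> \<partial>lborel) = 0"
  unfolding inDA_def prod.case L2_UNIV_iff \<delta>_def[symmetric] H1L_def H10_def
  by (auto simp: inH_iff)

lemma inDA_inH: "inD U \<Longrightarrow> inH U"
  by (cases U) (simp add: inDA_iff)

lemma inH_Aop:
  assumes "inD U" shows "inH (gen b U)"
proof -
  obtain u v y z w where U: "U = (u, v, y, z, w)" by (cases U)
  note d = assms[unfolded U inDA_iff inH_iff]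
  have "sq_integrable I01 (dxx u)" "sq_integrable I01 (dxx y)"
    using d by (auto intro: is_deriv01_sq[OF H2_dxc(2)])
  with d show ?thesis
    unfolding U Aop_def prod.case inH_iff
    by (auto intro!: sq_integrable_diff sq_integrable_add sq_integrable_cmult)
qed

lemma integrable_mu_DA:
  "inD (u, v, y, z, w) \<Longrightarrow> integrable lborel (\<lambda>\<xi>. of_real (mu \<alpha> \<xi>) * w \<xi>)"
  by (rule integrable_mu_mult[OF \<alpha>]) (simp_all add: inDA_iff inH_iff)

lemma H2_lincomb:
  assumes "H2 u" "H2 v"
  shows "H2 (\<lambda>x. c * u x + v x)" "x \<in> {0..1} \<Longrightarrow> dxc (\<lambda>x. c * u x + v x) x = c * dxc u x + dxc v x"
    "AE x in I01. dxx (\<lambda>x. c * u x + v x) x = c * dxx u x + dxx v x"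
proof -
  note d = is_deriv01_lincomb[OF H2_dxc(1)[OF assms(1)] H2_dxc(1)[OF assms(2)], of c]
    is_deriv01_lincomb[OF H2_dxc(2)[OF assms(1)] H2_dxc(2)[OF assms(2)], of c]
  show "H2 (\<lambda>x. c * u x + v x)" by (rule H2I[OF d])
  show "dxc (\<lambda>x. c * u x + v x) x = c * dxc u x + dxc v x" if "x \<in> {0..1}" by (rule dxc_eq[OF d that])
  show "AE x in I01. dxx (\<lambda>x. c * u x + v x) x = c * dxx u x + dxx v x" by (rule dxx_AE[OF d])
qed

lemma inDA_Hlin:
  assumes "inD U" "inD W"
  shows "inD (Hlin c U W)"
proof -
  obtain u v y z w u' v' y' z' w' where UW: "U = (u, v, y, z, w)" "W = (u', v', y', z', w')" by (cases U; cases W)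
  note d = assms(1)[unfolded UW inDA_iff] and d' = assms(2)[unfolded UW inDA_iff]
  have 1: "inH (Hlin c (u, v, y, z, w) (u', v', y', z', w'))" by (rule inH_Hlin) (use d d' in blast)+
  have eq: "(\<lambda>\<xi>. - complex_of_real (\<xi>\<^sup>2 + \<eta>) * (c * w \<xi> + w' \<xi>) + (c * v 1 + v' 1) * of_real (mu \<alpha> \<xi>)) =
      (\<lambda>\<xi>. c * (- of_real (\<xi>\<^sup>2 + \<eta>) * w \<xi> + v 1 * of_real (mu \<alpha> \<xi>)) + (- of_real (\<xi>\<^sup>2 + \<eta>) * w' \<xi> + v' 1 * of_real (mu \<alpha> \<xi>)))"
    by (simp add: fun_eq_iff algebra_simps)
  have eq2: "(\<lambda>\<xi>. complex_of_real \<bar>\<xi>\<bar> * (c * w \<xi> + w' \<xi>)) = (\<lambda>\<xi>. c * (of_real \<bar>\<xi>\<bar> * w \<xi>) + of_real \<bar>\<xi>\<bar> * w' \<xi>)"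
    by (simp add: fun_eq_iff algebra_simps)
  have "(\<integral>\<xi>. of_real (mu \<alpha> \<xi>) * (c * w \<xi> + w' \<xi>) \<partial>lborel) =
      (\<integral>\<xi>. c * (of_real (mu \<alpha> \<xi>) * w \<xi>) + of_real (mu \<alpha> \<xi>) * w' \<xi> \<partial>lborel)"
    by (intro Bochner_Integration.integral_cong) (simp_all add: algebra_simps)
  also have "\<dots> = c * (\<integral>\<xi>. of_real (mu \<alpha> \<xi>) * w \<xi> \<partial>lborel) + (\<integral>\<xi>. of_real (mu \<alpha> \<xi>) * w' \<xi> \<partial>lborel)"
    using integrable_mu_DA[OF assms(1)[unfolded UW]] integrable_mu_DA[OF assms(2)[unfolded UW]]
    by (subst Bochner_Integration.integral_add) simp_all
  finally have 2: "(\<integral>\<xi>. of_real (mu \<alpha> \<xi>) * (c * w \<xi> + w' \<xi>) \<partial>lborel) = \<dots>" .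
  have 3: "dxc (\<lambda>x. c * u x + u' x) 1 = c * dxc u 1 + dxc u' 1"
    using d d' by (intro H2_lincomb) auto
  have bc: "c * dxc u 1 + dxc u' 1 + of_real \<delta> * (c * (\<integral>\<xi>. of_real (mu \<alpha> \<xi>) * w \<xi> \<partial>lborel) + (\<integral>\<xi>. of_real (mu \<alpha> \<xi>) * w' \<xi> \<partial>lborel))
      = c * (dxc u 1 + of_real \<delta> * (\<integral>\<xi>. of_real (mu \<alpha> \<xi>) * w \<xi> \<partial>lborel)) + (dxc u' 1 + of_real \<delta> * (\<integral>\<xi>. of_real (mu \<alpha> \<xi>) * w' \<xi> \<partial>lborel))"
    by (simp add: algebra_simps)
  have bc0: "dxc u 1 + of_real \<delta> * (\<integral>\<xi>. of_real (mu \<alpha> \<xi>) * w \<xi> \<partial>lborel) = 0"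
    "dxc u' 1 + of_real \<delta> * (\<integral>\<xi>. of_real (mu \<alpha> \<xi>) * w' \<xi> \<partial>lborel) = 0"
    using d d' by blast+
  show ?thesis
    unfolding UW Hlin_def prod.case inDA_iff eq eq2 2 3 bc bc0
  proof (intro conjI)
    show "inH (\<lambda>x. c * u x + u' x, \<lambda>x. c * v x + v' x, \<lambda>x. c * y x + y' x, \<lambda>x. c * z x + z' x, \<lambda>x. c * w x + w' x)"
      using 1 by (simp add: Hlin_def)
  qed (use d d' in \<open>auto intro!: H2_lincomb H1_lincomb sq_integrable_lincomb\<close>)
qed

lemma emb_Aop_Hlin:
  assumes "inD U" "inD W"
  shows "emb (gen b (Hlin c U W)) = emb (Hlin c (gen b U) (gen b W))"
proof -
  obtain u v y z w u' v' y' z' w' where UW: "U = (u, v, y, z, w)" "W = (u', v', y', z', w')" by (cases U; cases W)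
  note d = assms(1)[unfolded UW inDA_iff] and d' = assms(2)[unfolded UW inDA_iff]
  have "AE x in I01. dxx (\<lambda>x. c * u x + u' x) x - of_real b * (c * z x + z' x) =
      c * (dxx u x - of_real b * z x) + (dxx u' x - of_real b * z' x)"
    using H2_lincomb(3)[of u u' c] d d' by (auto elim!: eventually_mono simp: algebra_simps)
  then have 2: "l2_of (\<lambda>x. dxx (\<lambda>x. c * u x + u' x) x - of_real b * (c * z x + z' x)) =
      (l2_of (\<lambda>x. c * (dxx u x - of_real b * z x) + (dxx u' x - of_real b * z' x)) :: interval_ix l2)"
    by (intro l2_of_cong) (simp only: l2_ix_defs)
  have "AE x in I01. of_real a * dxx (\<lambda>x. c * y x + y' x) x + of_real b * (c * v x + v' x) =
      c * (of_real a * dxx y x + of_real b * v x) + (of_real a * dxx y' x + of_real b * v' x)"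
    using H2_lincomb(3)[of y y' c] d d' by (auto elim!: eventually_mono simp: algebra_simps)
  then have 4: "l2_of (\<lambda>x. of_real a * dxx (\<lambda>x. c * y x + y' x) x + of_real b * (c * v x + v' x)) =
      (l2_of (\<lambda>x. c * (of_real a * dxx y x + of_real b * v x) + (of_real a * dxx y' x + of_real b * v' x)) :: interval_ix l2)"
    by (intro l2_of_cong) (simp only: l2_ix_defs)
  have 5: "(\<lambda>\<xi>. - complex_of_real (\<xi>\<^sup>2 + \<eta>) * (c * w \<xi> + w' \<xi>) + (c * v 1 + v' 1) * of_real (mu \<alpha> \<xi>)) =
      (\<lambda>\<xi>. c * (- of_real (\<xi>\<^sup>2 + \<eta>) * w \<xi> + v 1 * of_real (mu \<alpha> \<xi>)) + (- of_real (\<xi>\<^sup>2 + \<eta>) * w' \<xi> + v' 1 * of_real (mu \<alpha> \<xi>)))"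
    by (simp add: fun_eq_iff algebra_simps)
  show ?thesis unfolding UW Hlin_def Aop_def emb_def prod.case 2 4 5 ..
qed

subsection \<open>Dissipativity\<close>

text \<open>Integration by parts of \<open>dxc u\<close> against the conjugate of v. Under the real
  part the conjugate in the first integral may be moved to the other factor.\<close>

lemma Green:
  assumes "H2 u" "H1 v"
  shows "(\<integral>x. Re (dx v x * cnj (dx u x)) \<partial>I01) + (\<integral>x. Re (dxx u x * cnj (v x)) \<partial>I01)
    = Re (dxc u 1 * cnj (v 1) - dxc u 0 * cnj (v 0))"
proof -
  note du = H2_dxc[OF assms(1)] and dv = H1_dx[OF assms(2)]
  note s = is_deriv01_sq[OF du(1)] is_deriv01_sq[OF du(2)] is_deriv01_sq[OF dv]
    is_deriv01_sq[OF H1_dx[OF H1I[OF du(1)]]] sq_integrable_continuous[OF is_deriv01_continuous[OF dv]]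
  have i1: "integrable I01 (\<lambda>x. dxx u x * cnj (v x))" and i2: "integrable I01 (\<lambda>x. dxc u x * cnj (dx v x))"
    by (intro integrable_mult_sq sq_integrable_cnj s)+
  have i3: "integrable I01 (\<lambda>x. dx v x * cnj (dx u x))" by (intro integrable_mult_sq sq_integrable_cnj s)
  have "(\<integral>x. Re (dx v x * cnj (dx u x)) \<partial>I01) = (\<integral>x. Re (dxc u x * cnj (dx v x)) \<partial>I01)"
  proof (rule integral_cong_AE)
    show "AE x in I01. Re (dx v x * cnj (dx u x)) = Re (dxc u x * cnj (dx v x))"
      using dx_AE[OF du(1)] by eventually_elim (simp add: mult.commute)
  qed (intro borel_measurable_integrable integrable_Re i2 i3)+
  then have "(\<integral>x. Re (dx v x * cnj (dx u x)) \<partial>I01) + (\<integral>x. Re (dxx u x * cnj (v x)) \<partial>I01)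
      = Re (\<integral>x. dxx u x * cnj (v x) + dxc u x * cnj (dx v x) \<partial>I01)"
    unfolding integral_Re[OF i1] integral_Re[OF i2] Bochner_Integration.integral_add[OF i1 i2] by simp
  also have "(\<integral>x. dxx u x * cnj (v x) + dxc u x * cnj (dx v x) \<partial>I01) = dxc u 1 * cnj (v 1) - dxc u 0 * cnj (v 0)"
    by (rule integration_by_parts[OF du(2) is_deriv01_cnj[OF dv]])
  finally show ?thesis .
qed

lemma emb_dissipative:
  assumes "inD V" shows "inner (emb (gen 0 V)) (emb V) \<le> 0"
proof -
  obtain u v y z w where V: "V = (u, v, y, z, w)" by (cases V)
  note d = assms[unfolded V inDA_iff inH_iff]
  let ?k = "\<lambda>\<xi>. - complex_of_real (\<xi>\<^sup>2 + \<eta>) * w \<xi> + v 1 * complex_of_real (mu \<alpha> \<xi>)"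
  have A: "gen 0 V = (v, dxx u, z, \<lambda>x. of_real a * dxx y x, ?k)"
    by (simp add: V Aop_def)
  have uv: "(\<integral>x. Re (dx v x * cnj (dx u x)) \<partial>I01) + (\<integral>x. Re (dxx u x * cnj (v x)) \<partial>I01) = Re (dxc u 1 * cnj (v 1))"
    using Green[of u v] d by simp
  have yz: "(\<integral>x. Re (dx z x * cnj (dx y x)) \<partial>I01) + (\<integral>x. Re (dxx y x * cnj (z x)) \<partial>I01) = 0"
    using Green[of y z] d by simp
  have ay: "(\<integral>x. Re (of_real a * dxx y x * cnj (z x)) \<partial>I01) = a * (\<integral>x. Re (dxx y x * cnj (z x)) \<partial>I01)"
    unfolding integral_mult_right_zero[symmetric]
    by (intro Bochner_Integration.integral_cong) (simp_all add: algebra_simps)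
  have ik: "integrable lborel (\<lambda>\<xi>. Re (?k \<xi> * cnj (w \<xi>)))"
    using d by (intro integrable_Re integrable_mult_sq sq_integrable_cnj) auto
  have im: "integrable lborel (\<lambda>\<xi>. cnj (v 1) * (of_real (mu \<alpha> \<xi>) * w \<xi>))"
    by (intro integrable_mult_right integrable_mu_DA[OF assms[unfolded V]])
  have bc: "dxc u 1 = - (of_real \<delta> * (\<integral>\<xi>. of_real (mu \<alpha> \<xi>) * w \<xi> \<partial>lborel))"
    using d by (simp add: eq_neg_iff_add_eq_0)
  have "Re (dxc u 1 * cnj (v 1)) = - \<delta> * Re (\<integral>\<xi>. cnj (v 1) * (of_real (mu \<alpha> \<xi>) * w \<xi>) \<partial>lborel)"
    unfolding bc integral_mult_right_zero by (simp add: algebra_simps)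
  then have "Re (dxc u 1 * cnj (v 1)) + \<delta> * (\<integral>\<xi>. Re (?k \<xi> * cnj (w \<xi>)) \<partial>lborel)
      = \<delta> * ((\<integral>\<xi>. Re (?k \<xi> * cnj (w \<xi>)) \<partial>lborel) - (\<integral>\<xi>. Re (cnj (v 1) * (of_real (mu \<alpha> \<xi>) * w \<xi>)) \<partial>lborel))"
    unfolding integral_Re[OF im] by (simp add: algebra_simps)
  also have "\<dots> = \<delta> * (\<integral>\<xi>. Re (?k \<xi> * cnj (w \<xi>)) - Re (cnj (v 1) * (of_real (mu \<alpha> \<xi>) * w \<xi>)) \<partial>lborel)"
    using Bochner_Integration.integral_diff[OF ik integrable_Re[OF im]] by simp
  \<comment> \<open>Re (v(1) mu conj w) equals Re (conj v(1) mu w), so the flux terms cancel and the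
    damping -(xi^2 + eta) |w|^2 remains.\<close>
  also have "\<dots> = \<delta> * (\<integral>\<xi>. - ((\<xi>\<^sup>2 + \<eta>) * (cmod (w \<xi>))\<^sup>2) \<partial>lborel)"
    unfolding cmod_power2
    by (intro arg_cong[where f="\<lambda>x. \<delta> * x"] Bochner_Integration.integral_cong) (simp_all add: algebra_simps power2_eq_square)
  also have "\<dots> \<le> 0"
    using \<delta>_pos \<eta> by (simp add: zero_le_mult_iff)
  finally have "Re (dxc u 1 * cnj (v 1)) + \<delta> * (\<integral>\<xi>. Re (?k \<xi> * cnj (w \<xi>)) \<partial>lborel) \<le> 0" .
  moreover have "inner (emb (gen 0 V)) (emb V) =
      ((\<integral>x. Re (dx v x * cnj (dx u x)) \<partial>I01) + (\<integral>x. Re (dxx u x * cnj (v x)) \<partial>I01))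
      + a * ((\<integral>x. Re (dx z x * cnj (dx y x)) \<partial>I01) + (\<integral>x. Re (dxx y x * cnj (z x)) \<partial>I01))
      + \<delta> * (\<integral>\<xi>. Re (?k \<xi> * cnj (w \<xi>)) \<partial>lborel)"
    using inner_emb[OF inH_Aop[OF assms, of 0, unfolded A] inDA_inH[OF assms, unfolded V]] ay
    unfolding A unfolding V by (simp only: distrib_left add.assoc)
  ultimately show ?thesis unfolding uv yz by simp
qed

subsection \<open>Single-valuedness\<close>

lemma zero_if_derivative_zero:
  assumes "is_deriv01 u g" "AE x in I01. g x = 0" "u 0 = 0" "x \<in> {0..1}" shows "u x = 0"
proof -
  have "AE s in lborel. indicator {0..x} s *\<^sub>R g s = 0"
    using assms(2) unfolding AE_I01_iff by eventually_elim (use assms(4) in \<open>auto simp: indicator_def\<close>)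
  then have "(LINT s:{0..x}|lborel. g s) = 0" unfolding set_lebesgue_integral_def by (rule integral_eq_zero_AE)
  then show ?thesis using is_deriv01_at[OF assms(1,4)] assms(3) by simp
qed

lemma l2_of_eq_0_iff:
  "l2_mem TYPE('p::l2_index) f \<Longrightarrow> (l2_of f :: 'p l2) = 0 \<longleftrightarrow> AE_l2 TYPE('p) (\<lambda>x. f x = 0)"
  unfolding zero_l2_def by (rule l2_of_eq_iff) (auto intro: l2_mem_zero)

text \<open>The generator uses second derivatives and the trace v(1), which are not visibly
  functions of the classes in \<open>emb V\<close>. They are determined nevertheless: u and y vanish
  on [0,1] as primitives of null functions starting at 0, and v and z vanish there by
  continuity.\<close>

lemma emb_Aop_zero:
  assumes "inD V" "emb V = 0" shows "emb (gen b V) = 0"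
proof -
  obtain u v y z w where V: "V = (u, v, y, z, w)" by (cases V)
  note d = assms(1)[unfolded V inDA_iff]
  note m = mem_components[OF conjunct1[OF d]]
  have "AE_l2 TYPE(interval_ix) (\<lambda>x. dx u x = 0) \<and> AE_l2 TYPE(interval_ix) (\<lambda>x. v x = 0) \<and>
      AE_l2 TYPE(meanzero_ix) (\<lambda>x. dx y x = 0) \<and> AE_l2 TYPE(interval_ix) (\<lambda>x. z x = 0) \<and>
      AE_l2 TYPE(line_ix) (\<lambda>x. w x = 0)"
    using assms(2) a \<delta>_pos unfolding V emb_def prod.case
    by (simp add: zero_prod_def l2_of_eq_0_iff m)
  note ae' = this[unfolded l2_ix_defs]
  have ae: "AE x in I01. dx u x = 0" "AE x in I01. v x = 0" "AE x in I01. dx y x = 0" "AE x in I01. z x = 0"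
    "AE x in lborel. w x = 0"
    using ae' by blast+
  note h = d[unfolded inH_iff]
  have zeroD: "is_deriv01 f (\<lambda>_. 0)" if "\<And>x. x \<in> {0..1} \<Longrightarrow> f x = 0" for f
    by (rule is_deriv01_cong[OF is_deriv01_zero]) (auto simp: that)
  have u0: "u x = 0" "y x = 0" if "x \<in> {0..1}" for x
    using zero_if_derivative_zero[OF H1_dx ae(1) _ that] zero_if_derivative_zero[OF H1_dx ae(3) _ that] h by auto
  have v0: "v x = 0" "z x = 0" if "x \<in> {0..1}" for x
    using continuous_AE_eq[OF is_deriv01_continuous[OF H1_dx] continuous_on_const ae(2) that]
      continuous_AE_eq[OF is_deriv01_continuous[OF H1_dx] continuous_on_const ae(4) that] h by auto
  have xx: "AE x in I01. dxx u x = 0" "AE x in I01. dxx y x = 0"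
    by (rule dxx_AE[OF zeroD[OF u0(1)] is_deriv01_zero], simp, rule dxx_AE[OF zeroD[OF u0(2)] is_deriv01_zero], simp)
  have x1: "AE x in I01. dx v x = 0" "AE x in I01. dx z x = 0"
    by (rule dx_AE[OF zeroD[OF v0(1)]], simp, rule dx_AE[OF zeroD[OF v0(2)]], simp)
  note mA = mem_components[OF inH_Aop[OF assms(1), unfolded V Aop_def prod.case]]
  have "AE x in I01. dxx u x - of_real b * z x = 0" using xx(1) ae(4) by eventually_elim simp
  moreover have "AE x in I01. of_real a * dxx y x + of_real b * v x = 0" using xx(2) ae(2) by eventually_elim simp
  moreover have "AE \<xi> in lborel. - of_real (\<xi>\<^sup>2 + \<eta>) * w \<xi> + v 1 * of_real (mu \<alpha> \<xi>) = 0"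
    using ae(5) by eventually_elim (simp add: v0)
  ultimately show ?thesis
    using x1 unfolding V Aop_def emb_def prod.case zero_prod_def prod.inject scaleR_eq_0_iff
      l2_of_eq_0_iff[OF mA(1)] l2_of_eq_0_iff[OF mA(2)] l2_of_eq_0_iff[OF mA(3)] l2_of_eq_0_iff[OF mA(4)]
      l2_of_eq_0_iff[OF mA(5)] l2_ix_defs by blast
qed

lemma emb_Aop_cong:
  assumes "inD V" "inD W" "emb V = emb W"
  shows "emb (gen b V) = emb (gen b W)"
proof -
  have "emb (Hlin (-1) W V) = 0"
    using emb_Hlin[of W V "-1"] assms by (simp add: inDA_inH)
  then have "emb (gen b (Hlin (-1) W V)) = 0" by (intro emb_Aop_zero inDA_Hlin assms)
  then have "emb (Hlin (-1) (gen b W) (gen b V)) = 0" by (simp add: emb_Aop_Hlin assms)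
  then show ?thesis
    using emb_Hlin[of "gen b W" "gen b V" "-1"] assms by (simp add: inH_Aop)
qed

subsection \<open>The range condition\<close>

text \<open>Substituting v = l u - f1, z = l y - f3 and w = (v(1) mu + f5) / (L + xi^2) leaves one
  boundary value problem for u and one for y. The condition u_x(1) + delta (M v(1) + N) = 0 becomes
  a Robin condition for u, since v(1) = l u(1) - f1(1).\<close>

lemma emb_range:
  assumes l: "l > 0"
  shows "\<exists>V. inD V \<and> l *\<^sub>R emb V - emb (gen 0 V) = F"
proof -
  obtain Fs where Fs: "inH Fs" "emb Fs = F" by (rule emb_surj)
  obtain f1 f2 f3 f4 f5 where F: "Fs = (f1, f2, f3, f4, f5)" by (cases Fs)
  note f = Fs(1)[unfolded F inH_iff]
  have f1c: "sq_integrable I01 f1" "sq_integrable I01 f3"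
    using f by (auto intro!: sq_integrable_continuous is_deriv01_continuous[OF H1_dx])
  define L where "L = l + \<eta>"
  have L: "L > 0" using l \<eta> by (simp add: L_def)
  have pos: "L + \<xi>\<^sup>2 > 0" for \<xi> using L by (intro add_pos_nonneg) auto
  define M where "M = (\<integral>\<xi>. (mu \<alpha> \<xi>)\<^sup>2 / (L + \<xi>\<^sup>2) \<partial>lborel)"
  have M: "M \<ge> 0" unfolding M_def using pos by (intro integral_nonneg_AE always_eventually allI divide_nonneg_nonneg) (auto intro: less_imp_le)
  define N where "N = (\<integral>\<xi>. of_real (mu \<alpha> \<xi> / (L + \<xi>\<^sup>2)) * f5 \<xi> \<partial>lborel)"
  have iN: "integrable lborel (\<lambda>\<xi>. of_real (mu \<alpha> \<xi> / (L + \<xi>\<^sup>2)) * f5 \<xi>)"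
    using f by (intro integrable_mult_sq sq_integrable_mu_resolvent \<alpha> L) auto
  have h1: "sq_integrable I01 (\<lambda>x. of_real l * f1 x + f2 x)"
    using f f1c by (intro sq_integrable_lincomb) auto
  have l0: "l \<noteq> 0" using l by simp
  have "0 < 1 * (l * cosh l)" "0 \<le> (\<delta> * M * l) * sinh l" using l M \<delta>_pos by auto
  \<comment> \<open>Both summands have a favourable sign and the second is strictly positive, so the
    Robin problem is solvable.\<close>
  then have pq: "(\<delta> * M * l) * sinh l + 1 * (l * cosh l) \<noteq> 0" by linarith
  obtain u g where u: "is_deriv01 u g" "is_deriv01 g (\<lambda>x. of_real (l\<^sup>2) * u x - (of_real l * f1 x + f2 x))" "u 0 = 0"
    and bc: "of_real (\<delta> * M * l) * u 1 + of_real 1 * g 1 = of_real \<delta> * (of_real M * f1 1 - N)"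
    by (rule boundary_value_problem[OF l0 h1 pq])
  \<comment> \<open>Inserting z = l y - f3 into l z - a y_xx = f4 gives y_xx = (l^2 / a) y - (l f3 +
    f4) / a, hence m^2 = l^2 / a.\<close>
  define m where "m = l / sqrt a"
  have m: "m > 0" "m\<^sup>2 = l\<^sup>2 / a" using l a by (auto simp: m_def power_divide)
  have h2: "sq_integrable I01 (\<lambda>x. of_real (1/a) * (of_real l * f3 x + f4 x))"
    using f f1c by (intro sq_integrable_cmult sq_integrable_lincomb) auto
  have m0: "m \<noteq> 0" "1 * sinh m + 0 * (m * cosh m) \<noteq> 0" using m by auto
  obtain y k where y: "is_deriv01 y k" "is_deriv01 k (\<lambda>x. of_real (m\<^sup>2) * y x - of_real (1/a) * (of_real l * f3 x + f4 x))"
    "y 0 = 0" and y1: "of_real 1 * y 1 + of_real 0 * k 1 = 0"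
    by (rule boundary_value_problem[OF m0(1) h2 m0(2)])
  \<comment> \<open>The shape with \<open>+ 0\<close> is that of a component of
    \<open>Hlin (-1) Fs (Hscale l V)\<close>, so the resolvent equation can later be matched
    literally.\<close>
  define v where "v = (\<lambda>x. -1 * f1 x + (of_real l * u x + 0))"
  define z where "z = (\<lambda>x. -1 * f3 x + (of_real l * y x + 0))"
  define w where "w = (\<lambda>\<xi>. v 1 * of_real (mu \<alpha> \<xi> / (L + \<xi>\<^sup>2)) + of_real (1 / (L + \<xi>\<^sup>2)) * f5 \<xi>)"
  have sw: "sq_integrable lborel w"
    unfolding w_def using f by (intro sq_integrable_lincomb sq_integrable_mu_resolvent sq_integrable_resolvent \<alpha> L) auto
  have f5: "sq_integrable lborel f5" using f by blast
  have xw: "(\<lambda>\<xi>. of_real \<bar>\<xi>\<bar> * w \<xi>) =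
      (\<lambda>\<xi>. v 1 * of_real (\<bar>\<xi>\<bar> * (mu \<alpha> \<xi> / (L + \<xi>\<^sup>2))) + of_real (\<bar>\<xi>\<bar> / (L + \<xi>\<^sup>2)) * f5 \<xi>)"
    by (simp add: w_def fun_eq_iff algebra_simps)
  have sxw: "sq_integrable lborel (\<lambda>\<xi>. of_real \<bar>\<xi>\<bar> * w \<xi>)"
    unfolding xw by (intro sq_integrable_lincomb sq_integrable_mu_resolvent sq_integrable_resolvent \<alpha> L f5)
  have w5: "- of_real (\<xi>\<^sup>2 + \<eta>) * w \<xi> + v 1 * of_real (mu \<alpha> \<xi>) = -1 * f5 \<xi> + (of_real l * w \<xi> + 0)" for \<xi>
  proof -
    have "of_real (L + \<xi>\<^sup>2) * w \<xi> = v 1 * of_real ((L + \<xi>\<^sup>2) * (mu \<alpha> \<xi> / (L + \<xi>\<^sup>2))) + of_real ((L + \<xi>\<^sup>2) * (1 / (L + \<xi>\<^sup>2))) * f5 \<xi>"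
      unfolding w_def of_real_mult by (simp only: algebra_simps)
    also have "\<dots> = v 1 * of_real (mu \<alpha> \<xi>) + f5 \<xi>" using pos[of \<xi>] by simp
    finally show ?thesis by (simp add: L_def algebra_simps)
  qed
  have mw: "(\<integral>\<xi>. of_real (mu \<alpha> \<xi>) * w \<xi> \<partial>lborel) = v 1 * of_real M + N"
  proof -
    have i: "integrable lborel (\<lambda>\<xi>. complex_of_real ((mu \<alpha> \<xi>)\<^sup>2 / (L + \<xi>\<^sup>2)))"
      by (rule integrable_of_real[OF integrable_mu_sq[OF \<alpha> L]])
    have "(\<integral>\<xi>. of_real (mu \<alpha> \<xi>) * w \<xi> \<partial>lborel) =
       (\<integral>\<xi>. v 1 * of_real ((mu \<alpha> \<xi>)\<^sup>2 / (L + \<xi>\<^sup>2)) + of_real (mu \<alpha> \<xi> / (L + \<xi>\<^sup>2)) * f5 \<xi> \<partial>lborel)"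
      by (intro Bochner_Integration.integral_cong) (simp_all add: w_def algebra_simps power2_eq_square)
    also have "\<dots> = v 1 * (\<integral>\<xi>. of_real ((mu \<alpha> \<xi>)\<^sup>2 / (L + \<xi>\<^sup>2)) \<partial>lborel) + N"
      using Bochner_Integration.integral_add[OF integrable_mult_right[OF i, of "v 1"] iN]
      unfolding integral_mult_right_zero N_def .
    also have "(\<integral>\<xi>. complex_of_real ((mu \<alpha> \<xi>)\<^sup>2 / (L + \<xi>\<^sup>2)) \<partial>lborel) = of_real M"
      unfolding M_def by (rule integral_of_real[OF integrable_mu_sq[OF \<alpha> L]])
    finally show ?thesis .
  qed
  have H1v: "H1 v" "H1 z"
    unfolding v_def z_def
    by (intro H1_lincomb H1I[OF is_deriv01_zero] H1I[OF u(1)] H1I[OF y(1)]; use f in blast)+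
  have sv: "sq_integrable I01 v" "sq_integrable I01 z"
    by (rule sq_integrable_continuous[OF is_deriv01_continuous[OF H1_dx[OF H1v(1)]]],
        rule sq_integrable_continuous[OF is_deriv01_continuous[OF H1_dx[OF H1v(2)]]])
  have v0: "v 0 = 0" "z 0 = 0" "z 1 = 0" "y 1 = 0"
    using f u(3) y(3) y1 by (auto simp: v_def z_def)
  let ?V = "(u, v, y, z, w)"
  have DA: "inD ?V"
    unfolding inDA_iff inH_iff w5 mw
  proof (intro conjI)
    show "dxc u 1 + of_real \<delta> * (v 1 * of_real M + N) = 0"
      using bc unfolding dxc_eq[OF u(1,2), of 1, simplified] v_def by (simp add: algebra_simps)
    show "sq_integrable lborel (\<lambda>\<xi>. -1 * f5 \<xi> + (of_real l * w \<xi> + 0))"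
      using f sw by (intro sq_integrable_lincomb) auto
  qed (use v0 sv H1v sw sxw H1I[OF u(1)] H1I[OF y(1)] H2I[OF u(1,2)] H2I[OF y(1,2)] u(3) y(3) in auto)
  have "emb (gen 0 ?V) = emb (Hlin (-1) Fs (Hscale l ?V))"
  proof -
    have 2: "l2_of (\<lambda>x. dxx u x - of_real 0 * z x) = (l2_of (\<lambda>x. -1 * f2 x + (of_real l * v x + 0)) :: interval_ix l2)"
    proof (rule l2_of_cong, unfold l2_ix_defs)
      show "AE x in I01. dxx u x - of_real 0 * z x = -1 * f2 x + (of_real l * v x + 0)"
        using dxx_AE[OF u(1,2)] by eventually_elim (simp add: v_def algebra_simps power2_eq_square)
    qed
    have 4: "l2_of (\<lambda>x. of_real a * dxx y x + of_real 0 * v x) = (l2_of (\<lambda>x. -1 * f4 x + (of_real l * z x + 0)) :: interval_ix l2)"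
    proof (rule l2_of_cong, unfold l2_ix_defs)
      show "AE x in I01. of_real a * dxx y x + of_real 0 * v x = -1 * f4 x + (of_real l * z x + 0)"
        using dxx_AE[OF y(1,2)]
      proof eventually_elim
        case (elim x)
        have "complex_of_real a * (of_real (l\<^sup>2 / a) * y x - of_real (1/a) * (of_real l * f3 x + f4 x)) =
            of_real (a * (l\<^sup>2 / a)) * y x - of_real (a * (1/a)) * (of_real l * f3 x + f4 x)"
          unfolding of_real_mult by (simp only: algebra_simps)
        also have "\<dots> = of_real (l\<^sup>2) * y x - (of_real l * f3 x + f4 x)" using a by simp
        finally show ?case unfolding elim m(2) by (simp add: z_def algebra_simps power2_eq_square)
      qed
    qed
    show ?thesis
      unfolding Aop_def Hscale_eq Hlin_def Hzero_def F emb_def prod.case 2 4 w5 v_def[symmetric] z_def[symmetric] ..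
  qed
  also have "\<dots> = l *\<^sub>R emb ?V - F"
    using emb_Hlin[OF Fs(1) inH_Hscale[OF inDA_inH[OF DA]], of "-1" l] emb_Hscale[OF inDA_inH[OF DA], of l] Fs(2) by simp
  finally show ?thesis using DA by (intro exI[of _ ?V]) simp
qed

definition D :: "energy_space set" where "D = emb ` {V. inD V}"

text \<open>The operator on classes. Any state of the domain with image x may be chosen, because
  \<open>emb_Aop_cong\<close> makes the result independent of it.\<close>

definition A :: "real \<Rightarrow> energy_space \<Rightarrow> energy_space" where
  "A b x = emb (gen b (SOME V. inD V \<and> emb V = x))"

lemma emb_in_D: "inD V \<Longrightarrow> emb V \<in> D"
  by (auto simp: D_def)

lemma D_cases: assumes "x \<in> D" obtains V where "inD V" "emb V = x"
  using assms by (auto simp: D_def)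

lemma A_emb:
  assumes "inD V" shows "A b (emb V) = emb (gen b V)"
  unfolding A_def using someI[of "\<lambda>W. inD W \<and> emb W = emb V" V] assms
  by (intro emb_Aop_cong) auto

lemma A_lin:
  assumes "x \<in> D" "y \<in> D"
  shows "c *\<^sub>R x + y \<in> D" "A b (c *\<^sub>R x + y) = c *\<^sub>R A b x + A b y"
proof -
  obtain V W where VW: "inD V" "emb V = x" "inD W" "emb W = y"
    using assms D_cases by metis
  have eq: "c *\<^sub>R x + y = emb (Hlin (of_real c) V W)" using VW by (simp add: emb_Hlin inDA_inH)
  show "c *\<^sub>R x + y \<in> D" unfolding eq by (intro emb_in_D inDA_Hlin VW)
  show "A b (c *\<^sub>R x + y) = c *\<^sub>R A b x + A b y"
    using A_emb[OF inDA_Hlin[OF VW(1,3)], of b "of_real c"] emb_Aop_Hlin[OF VW(1,3), of b "of_real c"]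
      emb_Hlin[OF inH_Aop[OF VW(1)] inH_Aop[OF VW(3)], of c b b] A_emb[OF VW(1), of b] A_emb[OF VW(3), of b]
    by (simp add: eq VW(2,4))
qed

lemma is_deriv01_dxx_zero: "H2 (\<lambda>_. 0)" "dxc (\<lambda>_. 0) 1 = 0"
  using H2I[OF is_deriv01_zero is_deriv01_zero] dxc_eq[OF is_deriv01_zero is_deriv01_zero, of 1] by simp_all

lemma inDA_Hzero: "inD Hzero"
  using inH_Hzero is_deriv01_dxx_zero H1I[OF is_deriv01_zero] by (simp add: Hzero_def inDA_iff)

lemma emb_Hzero: "emb Hzero = 0"
  using emb_Hlin[OF inH_Hzero inH_Hzero, of "-1"] by (simp add: Hlin_def Hzero_def)

lemma max_dissipative_A0: "max_dissipative D (A 0) 0"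
proof
  have 0: "0 \<in> D" using emb_in_D[OF inDA_Hzero] by (simp add: emb_Hzero)
  have A0: "A 0 0 = 0" using A_lin(2)[OF 0 0, of 0 "-1"] by simp
  show "subspace D"
    using 0 A_lin(1)[of _ _ 1] A_lin(1)[OF _ 0] by (auto simp: subspace_def)
  fix x y r l f
  show "x \<in> D \<Longrightarrow> y \<in> D \<Longrightarrow> A 0 (x + y) = A 0 x + A 0 y" using A_lin(2)[of x y 0 1] by simp
  show "x \<in> D \<Longrightarrow> A 0 (r *\<^sub>R x) = r *\<^sub>R A 0 x" using A_lin(2)[of x 0 0 r] 0 A0 by simp
  show "x \<in> D \<Longrightarrow> inner (A 0 x) x \<le> 0" using emb_dissipative A_emb by (auto elim!: D_cases)
  show "\<exists>x\<in>D. l *\<^sub>R x - A 0 x = f" if "l > 0" using emb_range[OF that, of f] A_emb emb_in_D by metis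
qed simp

text \<open>The part of the generator carrying the coupling by b. The slots of v and z have the same
  type and the same weight, so the two contributions to \<open>inner (B b x) x\<close>
  cancel.\<close>

definition B :: "real \<Rightarrow> energy_space \<Rightarrow> energy_space" where
  "B b x = (case x of (p, v, q, z, w) \<Rightarrow> (0, (- b) *\<^sub>R z, 0, b *\<^sub>R v, 0))"

lemma A_B:
  assumes "x \<in> D" shows "A b x = A 0 x + B b x"
proof -
  obtain V where V: "inD V" "emb V = x" using assms D_cases by metis
  obtain u v y z w where Vc: "V = (u, v, y, z, w)" by (cases V)
  note m = mem_components[OF inDA_inH[OF V(1), unfolded Vc]] and m0 = mem_components[OF inH_Aop[OF V(1), of 0, unfolded Vc Aop_def prod.case]]
  have 2: "l2_of (\<lambda>x. dxx u x - of_real b * z x) = (l2_of (\<lambda>x. dxx u x - of_real 0 * z x) + (- b) *\<^sub>R l2_of z :: interval_ix l2)"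
    unfolding l2_of_scaleR[OF m(4), symmetric] l2_of_add[OF m0(2) l2_mem_cmult[OF m(4)], symmetric] by simp
  have 4: "l2_of (\<lambda>x. of_real a * dxx y x + of_real b * v x) = (l2_of (\<lambda>x. of_real a * dxx y x + of_real 0 * v x) + b *\<^sub>R l2_of v :: interval_ix l2)"
    unfolding l2_of_scaleR[OF m(2), symmetric] l2_of_add[OF m0(4) l2_mem_cmult[OF m(2)], symmetric] by simp
  show ?thesis
    unfolding V(2)[symmetric] A_emb[OF V(1)] unfolding Vc Aop_def emb_def B_def prod.case 2 4 by simp
qed

lemma max_dissipative_A: "max_dissipative D (\<lambda>x. A 0 x + B b x) \<bar>b\<bar>"
proof (rule max_dissipative_perturb[OF max_dissipative_A0])
  show "linear (B b)" by (rule linearI) (auto simp: B_def scaleR_add_right split: prod.splits)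
  show "inner (B b x) x = 0" for x by (auto simp: B_def inner_commute split: prod.splits)
  show "norm (B b x) \<le> \<bar>b\<bar> * norm x" for x
  proof -
    obtain p v q z w where x: "x = (p, v, q, z, w)" by (cases x)
    have "norm (B b x) = sqrt (b\<^sup>2 * ((norm z)\<^sup>2 + (norm v)\<^sup>2))"
      by (simp add: x B_def norm_prod_def power_mult_distrib distrib_left)
    also have "\<dots> = \<bar>b\<bar> * sqrt ((norm z)\<^sup>2 + (norm v)\<^sup>2)" by (simp add: real_sqrt_mult)
    also have "\<dots> \<le> \<bar>b\<bar> * norm x" unfolding x norm_prod_def by (intro mult_left_mono real_sqrt_le_mono) simp_all
    finally show ?thesis .
  qed
qed simp

end

section \<open>Weak and strong solutions in the energy space\<close>

context wave_system
begin

lemma Hnorm_tendsto_iff: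
  fixes U :: "real \<Rightarrow> state"
  assumes "\<forall>s\<ge>0. inH (U s)" "t \<ge> 0"
  shows "((\<lambda>s. hnorm (Hsub (U s) (U t))) \<longlongrightarrow> 0) (at t within {0..}) \<longleftrightarrow>
    continuous (at t within {0..}) (\<lambda>s. emb (U s))"
proof -
  have ev: "\<forall>\<^sub>F s in at t within {0..}. s \<in> {0::real..}" by (auto simp: eventually_at_filter)
  have "((\<lambda>s. hnorm (Hsub (U s) (U t))) \<longlongrightarrow> 0) (at t within {0..}) \<longleftrightarrow>
      ((\<lambda>s. norm (emb (U s) - emb (U t))) \<longlongrightarrow> 0) (at t within {0..})"
    by (rule tendsto_cong) (use ev in eventually_elim, simp add: Hnorm_Hsub assms)
  then show ?thesis by (simp add: tendsto_norm_zero_iff LIM_zero_iff continuous_within)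
qed

lemma continuous_on_emb_iff:
  fixes U :: "real \<Rightarrow> state"
  assumes "\<forall>s\<ge>0. inH (U s)"
  shows "(\<forall>t\<ge>0. ((\<lambda>s. hnorm (Hsub (U s) (U t))) \<longlongrightarrow> 0) (at t within {0..})) \<longleftrightarrow>
    continuous_on {0..} (\<lambda>s. emb (U s))"
  using Hnorm_tendsto_iff[OF assms] by (auto simp: continuous_on_eq_continuous_within)

text \<open>Differentiability in the energy seminorm is differentiability of the image in the
  Hilbert space. The filter at t excludes s = t, where the quotient would divide by zero.\<close>

lemma Hnorm_derivative_iff:
  fixes U :: "real \<Rightarrow> state"
  assumes "\<forall>s\<ge>0. inH (U s)" "inH X" "t \<ge> 0"
  shows "((\<lambda>s. hnorm (Hsub (Hscale (1 / (s - t)) (Hsub (U s) (U t))) X)) \<longlongrightarrow> 0) (at t within {0..}) \<longleftrightarrow>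
    ((\<lambda>s. emb (U s)) has_vector_derivative emb X) (at t within {0..})"
proof -
  have ev: "\<forall>\<^sub>F s in at t within {0..}. s \<in> {0::real..} \<and> s \<noteq> t" by (auto simp: eventually_at_filter)
  have "((\<lambda>s. hnorm (Hsub (Hscale (1 / (s - t)) (Hsub (U s) (U t))) X)) \<longlongrightarrow> 0) (at t within {0..}) \<longleftrightarrow>
      ((\<lambda>s. norm (((emb (U s) - emb (U t)) - (s - t) *\<^sub>R emb X) /\<^sub>R norm (s - t))) \<longlongrightarrow> 0) (at t within {0..})"
  proof (rule tendsto_cong)
    show "\<forall>\<^sub>F s in at t within {0..}. hnorm (Hsub (Hscale (1 / (s - t)) (Hsub (U s) (U t))) X) =
        norm (((emb (U s) - emb (U t)) - (s - t) *\<^sub>R emb X) /\<^sub>R norm (s - t))"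
      using ev
    proof eventually_elim
      case (elim s)
      have "hnorm (Hsub (Hscale (1 / (s - t)) (Hsub (U s) (U t))) X) =
          norm ((1 / (s - t)) *\<^sub>R (emb (U s) - emb (U t)) - emb X)"
        using elim assms by (simp add: Hnorm_Hsub inH_Hscale inH_Hsub emb_Hscale emb_Hsub)
      also have "(1 / (s - t)) *\<^sub>R (emb (U s) - emb (U t)) - emb X =
          (1 / (s - t)) *\<^sub>R ((emb (U s) - emb (U t)) - (s - t) *\<^sub>R emb X)"
        using elim by (simp add: scaleR_diff_right)
      finally show ?case by (simp add: divide_inverse)
    qed
  qed
  also have "\<dots> \<longleftrightarrow> ((\<lambda>s. emb (U s)) has_vector_derivative emb X) (at t within {0..})"
    unfolding tendsto_norm_zero_iff has_vector_derivative_def has_derivative_within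
    by (simp add: bounded_linear_scaleR_left diff_diff_eq add.commute divide_inverse)
  finally show ?thesis .
qed

text \<open>A complex identity amounts to two real ones, and the imaginary part is the real part for
  test states multiplied by i. Continuity of the image makes the Lebesgue and the gauge integral
  agree.\<close>

lemma Hinner_integral_iff:
  fixes U :: "real \<Rightarrow> state"
  assumes U: "\<forall>s\<ge>0. inH (U s)" and cont: "continuous_on {0..} (\<lambda>s. emb (U s))"
    and \<Phi>: "inH \<Phi>" and \<Psi>: "inH \<Psi>" and U0: "inH U0" and t: "t \<ge> 0"
  shows "ip (U t) \<Phi> = ip U0 \<Phi> + (LINT s:{0..t}|lborel. ip (U s) \<Psi>) \<longleftrightarrow>
    ((\<lambda>s. inner (emb (U s)) (emb \<Psi>)) has_integral inner (emb (U t)) (emb \<Phi>) - inner (emb U0) (emb \<Phi>)) {0..t} \<and>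
    ((\<lambda>s. inner (emb (U s)) (emb (Hi \<Psi>))) has_integral inner (emb (U t)) (emb (Hi \<Phi>)) - inner (emb U0) (emb (Hi \<Phi>))) {0..t}"
proof -
  let ?k = "\<lambda>s. ip (U s) \<Psi>"
  have ReIm: "Re (?k s) = inner (emb (U s)) (emb \<Psi>)" "Im (?k s) = inner (emb (U s)) (emb (Hi \<Psi>))" if "s \<ge> 0" for s
    using U that \<Psi> by (simp_all add: Re_Hinner Im_Hinner)
  have cont': "continuous_on {0..t} (\<lambda>s. emb (U s))" using cont by (rule continuous_on_subset) auto
  have "continuous_on {0..t} (\<lambda>s. complex_of_real (inner (emb (U s)) (emb \<Psi>)) + \<i> * of_real (inner (emb (U s)) (emb (Hi \<Psi>))))"
    by (intro continuous_intros cont')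
  moreover have "complex_of_real (inner (emb (U s)) (emb \<Psi>)) + \<i> * of_real (inner (emb (U s)) (emb (Hi \<Psi>))) = ?k s"
    if "s \<in> {0..t}" for s
    using ReIm[of s] that by (simp add: complex_eq_iff)
  ultimately have ck: "continuous_on {0..t} ?k" by (rule continuous_on_eq)
  define I where "I = (LINT s:{0..t}|lborel. ?k s)"
  have "I = integral {0..t} ?k" unfolding I_def
    by (rule set_borel_integral_eq_integral(2)[OF borel_integrable_atLeastAtMost'[OF ck]])
  then have I: "(?k has_integral I) {0..t}" using integrable_integral[OF integrable_continuous_real[OF ck]] by simp
  have hR: "((\<lambda>s. inner (emb (U s)) (emb \<Psi>)) has_integral Re I) {0..t}"
    by (rule has_integral_eq[OF _ has_integral_Re[OF I]]) (simp add: ReIm)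
  have hI: "((\<lambda>s. inner (emb (U s)) (emb (Hi \<Psi>))) has_integral Im I) {0..t}"
    by (rule has_integral_eq[OF _ has_integral_Im[OF I]]) (simp add: ReIm)
  have iff: "(f has_integral r) {0..t} \<longleftrightarrow> q = r" if "(f has_integral q) {0..t}" for f :: "real \<Rightarrow> real" and q r
    using that has_integral_unique by blast
  have eq: "(X = Y + I) = (Re I = Re X - Re Y \<and> Im I = Im X - Im Y)" for X Y
    by (auto simp: complex_eq_iff)
  show ?thesis
    unfolding I_def[symmetric] iff[OF hR] iff[OF hI] eq using U t U0 \<Phi> by (simp add: Re_Hinner Im_Hinner)
qed

lemma Hinner_commute: "ip W U = cnj (ip U W)"
proof -
  obtain u v y z w u' v' y' z' w' where UW: "U = (u, v, y, z, w)" "W = (u', v', y', z', w')" by (cases U; cases W)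
  show ?thesis
    unfolding UW Hinner_def prod.case LINT_eq[OF borel_closed[OF closed_atLeastAtMost]]
    by (simp flip: Bochner_Integration.integral_cnj) (simp add: mult.commute mult.left_commute)
qed

lemma inner_Hi_left:
  assumes "inH U" "inH W" shows "inner (emb (Hi U)) (emb W) = - inner (emb U) (emb (Hi W))"
  using Im_Hinner[OF assms] Im_Hinner[OF assms(2,1)] Hinner_commute[of W U] by (simp add: inner_commute)

lemma emb_Hlin_Hi:
  assumes "inH U" "inH W" shows "emb (Hlin \<i> U W) = emb (Hi U) + emb W"
proof -
  have "Hlin \<i> U W = Hlin (of_real 1) (Hi U) W"
    by (simp add: Hi_def Hlin_def Hzero_def split: prod.splits)
  then show ?thesis using emb_Hlin[OF inH_Hi[OF assms(1)] assms(2), of 1] by simp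
qed

context
  fixes b :: real
begin

interpretation M: max_dissipative D "\<lambda>x. A 0 x + B b x" "\<bar>b\<bar>"
  by (rule max_dissipative_A)

lemma generator_emb: "inD V \<Longrightarrow> A 0 (emb V) + B b (emb V) = emb (gen b V)"
  using A_B[OF emb_in_D, of V b] A_emb[of V b] by simp

section \<open>Complex test states versus adjoint pairs of the real operator\<close>

text \<open>The test condition inside \<open>weak_sol\<close>: \<Phi> is in the domain of the
  complex adjoint, with image \<Psi>.\<close>

definition test_pair :: "state \<Rightarrow> state \<Rightarrow> bool" where
  "test_pair \<Phi> \<Psi> \<longleftrightarrow> inH \<Phi> \<and> inH \<Psi> \<and>
    (\<forall>V. inD V \<longrightarrow> ip (gen b V) \<Phi> = ip V \<Psi>)"

lemma adjoint_pair_iff: "M.adjoint_pair \<phi> \<psi> \<longleftrightarrow>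
  (\<forall>V. inD V \<longrightarrow> inner (emb (gen b V)) \<phi> = inner (emb V) \<psi>)"
proof
  assume "M.adjoint_pair \<phi> \<psi>"
  then show "\<forall>V. inD V \<longrightarrow> inner (emb (gen b V)) \<phi> = inner (emb V) \<psi>"
    unfolding M.adjoint_pair_def by (metis emb_in_D generator_emb)
next
  assume *: "\<forall>V. inD V \<longrightarrow> inner (emb (gen b V)) \<phi> = inner (emb V) \<psi>"
  show "M.adjoint_pair \<phi> \<psi>"
    unfolding M.adjoint_pair_def
  proof
    fix x assume "x \<in> D"
    then obtain V where V: "inD V" "emb V = x" by (rule D_cases)
    then show "inner (A 0 x + B b x) \<phi> = inner x \<psi>"
      using * generator_emb[OF V(1)] by metis
  qed
qed

lemma test_pair_adjoint:
  assumes "test_pair \<Phi> \<Psi>"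
  shows "M.adjoint_pair (emb \<Phi>) (emb \<Psi>)" "M.adjoint_pair (emb (Hi \<Phi>)) (emb (Hi \<Psi>))"
proof -
  have H: "inH \<Phi>" "inH \<Psi>" and eq: "\<And>V. inD V \<Longrightarrow> ip (gen b V) \<Phi> = ip V \<Psi>"
    using assms by (auto simp: test_pair_def)
  have "inner (emb (gen b V)) (emb \<Phi>) = inner (emb V) (emb \<Psi>)"
    "inner (emb (gen b V)) (emb (Hi \<Phi>)) = inner (emb V) (emb (Hi \<Psi>))" if "inD V" for V
    using arg_cong[OF eq[OF that], of Re] arg_cong[OF eq[OF that], of Im] H inDA_inH[OF that] inH_Aop[OF that]
    by (simp_all add: Re_Hinner Im_Hinner)
  then show "M.adjoint_pair (emb \<Phi>) (emb \<Psi>)" "M.adjoint_pair (emb (Hi \<Phi>)) (emb (Hi \<Psi>))"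
    unfolding adjoint_pair_iff by blast+
qed

text \<open>The real relation implies the complex one because it can also be tested with iV: the
  domain is a complex subspace, and on classes the generator commutes with i. That gives the
  imaginary part.\<close>

lemma adjoint_test_pair:
  assumes "M.adjoint_pair (emb \<Phi>) (emb \<Psi>)" and H: "inH \<Phi>" "inH \<Psi>"
  shows "test_pair \<Phi> \<Psi>"
proof -
  have re: "inner (emb (gen b V)) (emb \<Phi>) = inner (emb V) (emb \<Psi>)" if "inD V" for V
    using assms(1) that unfolding adjoint_pair_iff by blast
  have "ip (gen b V) \<Phi> = ip V \<Psi>" if V: "inD V" for V
  proof (rule complex_eqI)
    note HV = inDA_inH[OF V] inH_Aop[OF V, of b]
    show "Re (ip (gen b V) \<Phi>) = Re (ip V \<Psi>)"
      using re[OF V] by (simp add: Re_Hinner HV H)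
    have "emb (gen b (Hi V)) = emb (Hi (gen b V)) + emb (gen b Hzero)"
      unfolding Hi_def[of V] emb_Aop_Hlin[OF V inDA_Hzero] by (rule emb_Hlin_Hi[OF HV(2) inH_Aop[OF inDA_Hzero]])
    also have "emb (gen b Hzero) = 0"
      by (rule emb_Aop_zero[OF inDA_Hzero emb_Hzero])
    finally have "emb (gen b (Hi V)) = emb (Hi (gen b V))" by simp
    moreover have "inD (Hi V)" unfolding Hi_def by (rule inDA_Hlin[OF V inDA_Hzero])
    ultimately have "inner (emb (Hi (gen b V))) (emb \<Phi>) = inner (emb (Hi V)) (emb \<Psi>)" using re by metis
    then show "Im (ip (gen b V) \<Phi>) = Im (ip V \<Psi>)"
      by (simp add: Im_Hinner inner_Hi_left HV H)
  qed
  with H show ?thesis unfolding test_pair_def by blast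
qed

lemma weak_sol_test_pair: "weak_sol a b \<gamma> \<alpha> \<eta> U U0 \<longleftrightarrow> U 0 = U0 \<and> (\<forall>t\<ge>0. inH (U t)) \<and>
    (\<forall>t\<ge>0. ((\<lambda>s. hnorm (Hsub (U s) (U t))) \<longlongrightarrow> 0) (at t within {0..})) \<and>
    (\<forall>\<Phi> \<Psi>. test_pair \<Phi> \<Psi> \<longrightarrow> (\<forall>t\<ge>0. ip (U t) \<Phi> =
      ip U0 \<Phi> + (LINT s:{0..t}|lborel. ip (U s) \<Psi>)))"
  unfolding weak_sol_def test_pair_def by (rule refl)

text \<open>Since \<open>emb\<close> is onto, testing with complex states is the same as testing
  with all adjoint pairs of the real operator, where the abstract results apply.\<close>

lemma weak_sol_iff:
  assumes U0: "inH U0" and H: "\<forall>t\<ge>0. inH (U t)"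
  shows "weak_sol a b \<gamma> \<alpha> \<eta> U U0 \<longleftrightarrow> U 0 = U0 \<and> continuous_on {0..} (\<lambda>s. emb (U s)) \<and>
    (\<forall>\<phi> \<psi> t. M.adjoint_pair \<phi> \<psi> \<longrightarrow> t \<ge> 0 \<longrightarrow>
      ((\<lambda>s. inner (emb (U s)) \<psi>) has_integral inner (emb (U t)) \<phi> - inner (emb U0) \<phi>) {0..t})"
    (is "?l \<longleftrightarrow> ?r")
proof
  assume l: ?l
  have 0: "U 0 = U0" and cont: "continuous_on {0..} (\<lambda>s. emb (U s))"
    using l unfolding weak_sol_test_pair continuous_on_emb_iff[OF H] by simp_all
  have weak: "\<And>\<Phi> \<Psi> t. test_pair \<Phi> \<Psi> \<Longrightarrow> t \<ge> 0 \<Longrightarrow>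
      ip (U t) \<Phi> = ip U0 \<Phi> + (LINT s:{0..t}|lborel. ip (U s) \<Psi>)"
    using l[unfolded weak_sol_test_pair, THEN conjunct2, THEN conjunct2, THEN conjunct2, THEN spec, THEN spec, THEN mp, THEN spec, THEN mp] .
  have "((\<lambda>s. inner (emb (U s)) \<psi>) has_integral inner (emb (U t)) \<phi> - inner (emb U0) \<phi>) {0..t}"
    if "M.adjoint_pair \<phi> \<psi>" "t \<ge> 0" for \<phi> \<psi> t
  proof -
    obtain \<Phi> where \<Phi>: "inH \<Phi>" "emb \<Phi> = \<phi>" by (rule emb_surj)
    obtain \<Psi> where \<Psi>: "inH \<Psi>" "emb \<Psi> = \<psi>" by (rule emb_surj)
    have "test_pair \<Phi> \<Psi>" using that(1) \<Phi> \<Psi> by (intro adjoint_test_pair) auto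
    from weak[OF this that(2)] show ?thesis
      unfolding Hinner_integral_iff[OF H cont \<Phi>(1) \<Psi>(1) U0 that(2)] \<Phi>(2) \<Psi>(2) by blast
  qed
  with 0 cont show ?r by blast
next
  assume r: ?r
  have "ip (U t) \<Phi> = ip U0 \<Phi> + (LINT s:{0..t}|lborel. ip (U s) \<Psi>)"
    if "test_pair \<Phi> \<Psi>" "t \<ge> 0" for \<Phi> \<Psi> t
  proof -
    have \<Phi>\<Psi>: "inH \<Phi>" "inH \<Psi>" using that(1) by (auto simp: test_pair_def)
    have cont: "continuous_on {0..} (\<lambda>s. emb (U s))" using r by blast
    show ?thesis
      unfolding Hinner_integral_iff[OF H cont \<Phi>\<Psi> U0 that(2)]
      using r test_pair_adjoint[OF that(1)] that(2) by blast
  qed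
  then show ?l
    unfolding weak_sol_test_pair continuous_on_emb_iff[OF H] using r H by simp
qed

section \<open>Existence and uniqueness of weak and strong solutions for states\<close>

lemma weak_solution_exists:
  assumes "inH U0" shows "\<exists>U. weak_sol a b \<gamma> \<alpha> \<eta> U U0"
proof -
  have "\<exists>V. inH V \<and> emb V = M.T t (emb U0)" for t
    by (rule emb_surj[of "M.T t (emb U0)"]) blast
  then have "\<exists>W. \<forall>t. inH (W t) \<and> emb (W t) = M.T t (emb U0)" by (intro choice allI)
  then obtain W where W: "\<And>t. inH (W t)" "\<And>t. emb (W t) = M.T t (emb U0)" by blast
  \<comment> \<open>The chosen \<open>W 0\<close> only has the same class as \<open>U0\<close>,
    whereas a solution must start at the tuple of functions \<open>U0\<close> itself.\<close>
  define U where "U = W(0 := U0)"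
  have U: "emb (U t) = M.T t (emb U0)" for t
    using W by (simp add: U_def M.T_0)
  have H: "\<forall>t\<ge>0. inH (U t)" using W assms by (simp add: U_def)
  have "weak_sol a b \<gamma> \<alpha> \<eta> U U0"
    unfolding weak_sol_iff[OF assms H] U
    by (intro conjI allI impI M.continuous_T M.T_weak_solution) (simp_all add: U_def)
  then show ?thesis by blast
qed

lemma weak_solution_unique:
  assumes U: "weak_sol a b \<gamma> \<alpha> \<eta> U U0" and V: "weak_sol a b \<gamma> \<alpha> \<eta> V U0" and "t \<ge> 0"
  shows "hnorm (Hsub (U t) (V t)) = 0"
proof -
  have HU: "\<forall>s\<ge>0. inH (U s)" and HV: "\<forall>s\<ge>0. inH (V s)" and "U 0 = U0"
    using U V unfolding weak_sol_test_pair by simp_all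
  then have U0: "inH U0" by auto
  note wU = U[unfolded weak_sol_iff[OF U0 HU]] and wV = V[unfolded weak_sol_iff[OF U0 HV]]
  have "emb (U t) - emb (V t) = 0"
  proof (rule M.weak_solution_zero[of "\<lambda>s. emb (U s) - emb (V s)"])
    show "continuous_on {0..} (\<lambda>s. emb (U s) - emb (V s))" using wU wV by (intro continuous_on_diff) auto
    fix \<phi> \<psi> :: energy_space and t :: real assume *: "M.adjoint_pair \<phi> \<psi>" "t \<ge> 0"
    then have "((\<lambda>s. inner (emb (U s)) \<psi>) has_integral inner (emb (U t)) \<phi> - inner (emb U0) \<phi>) {0..t}"
      "((\<lambda>s. inner (emb (V s)) \<psi>) has_integral inner (emb (V t)) \<phi> - inner (emb U0) \<phi>) {0..t}"
      using wU wV by blast+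
    from has_integral_diff[OF this]
    show "((\<lambda>s. inner (emb (U s) - emb (V s)) \<psi>) has_integral inner (emb (U t) - emb (V t)) \<phi>) {0..t}"
      by (simp add: inner_diff_left)
  qed (rule assms(3))
  then show ?thesis using HU HV assms(3) by (simp add: Hnorm_Hsub)
qed

lemma strong_sol_iff:
  assumes DA: "\<forall>t\<ge>0. inD (U t)"
  shows "strong_sol a b \<gamma> \<alpha> \<eta> U U0 \<longleftrightarrow> U 0 = U0 \<and> continuous_on {0..} (\<lambda>s. emb (U s)) \<and>
    continuous_on {0..} (\<lambda>s. emb (gen b (U s))) \<and>
    (\<forall>t\<ge>0. ((\<lambda>s. emb (U s)) has_vector_derivative emb (gen b (U t))) (at t within {0..}))"
proof -
  have H: "\<forall>t\<ge>0. inH (U t)" "\<forall>t\<ge>0. inH (gen b (U t))"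
    using DA by (auto intro: inDA_inH inH_Aop)
  have "(\<forall>t\<ge>0. ((\<lambda>s. hnorm (Hsub (Hscale (1 / (s - t)) (Hsub (U s) (U t))) (gen b (U t)))) \<longlongrightarrow> 0)
      (at t within {0..})) \<longleftrightarrow> (\<forall>t\<ge>0. ((\<lambda>s. emb (U s)) has_vector_derivative emb (gen b (U t))) (at t within {0..}))"
    using Hnorm_derivative_iff[OF H(1)] H(2) by simp
  then show ?thesis
    unfolding strong_sol_def continuous_on_emb_iff[OF H(1)] continuous_on_emb_iff[OF H(2)]
    using DA by simp
qed

text \<open>The semigroup preserves D, so representatives can be chosen inside the operator domain;
  continuity of the image under the generator follows because the semigroup commutes with
  it.\<close>

lemma strong_solution_exists:
  assumes "inD U0" shows "\<exists>U. strong_sol a b \<gamma> \<alpha> \<eta> U U0"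
proof -
  let ?x = "emb U0" and ?A = "\<lambda>x. A 0 x + B b x"
  have x: "?x \<in> D" by (rule emb_in_D[OF assms])
  have "\<exists>V. t \<ge> 0 \<longrightarrow> inD V \<and> emb V = M.T t ?x" for t
  proof (cases "t \<ge> 0")
    case True
    show ?thesis by (rule D_cases[OF conjunct1[OF M.T_in_D[OF x True]]]) blast
  qed simp
  then have "\<exists>W. \<forall>t. t \<ge> 0 \<longrightarrow> inD (W t) \<and> emb (W t) = M.T t ?x" by (intro choice allI)
  then obtain W where W: "\<And>t. t \<ge> 0 \<Longrightarrow> inD (W t)" "\<And>t. t \<ge> 0 \<Longrightarrow> emb (W t) = M.T t ?x"
    by blast
  define U where "U = W(0 := U0)"
  have DA: "inD (U t)" and U: "emb (U t) = M.T t ?x" if "t \<ge> 0" for t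
    using W that assms by (auto simp: U_def M.T_0)
  have AU: "emb (gen b (U t)) = M.T t (?A ?x)" "emb (gen b (U t)) = ?A (M.T t ?x)" if "t \<ge> 0" for t
    using generator_emb[OF DA[OF that]] M.T_in_D[OF x that] by (simp_all add: U that)
  have DA': "\<forall>t\<ge>0. inD (U t)" using DA by blast
  have "strong_sol a b \<gamma> \<alpha> \<eta> U U0"
    unfolding strong_sol_iff[OF DA']
  proof (intro conjI allI impI)
    show "U 0 = U0" by (simp add: U_def)
    show "continuous_on {0..} (\<lambda>s. emb (U s))"
      by (rule continuous_on_eq[OF M.continuous_T[of ?x]]) (simp add: U)
    show "continuous_on {0..} (\<lambda>s. emb (gen b (U s)))"
      by (rule continuous_on_eq[OF M.continuous_T[of "?A ?x"]]) (simp add: AU(1))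
    fix t :: real assume t: "t \<ge> 0"
    show "((\<lambda>s. emb (U s)) has_vector_derivative emb (gen b (U t))) (at t within {0..})"
      unfolding AU(2)[OF t]
      by (rule has_vector_derivative_transform[OF _ _ M.T_has_vector_derivative[OF x t]]) (use t U in auto)
  qed
  then show ?thesis by blast
qed

lemma strong_solution_unique:
  assumes U: "strong_sol a b \<gamma> \<alpha> \<eta> U U0" and V: "strong_sol a b \<gamma> \<alpha> \<eta> V U0" and t: "t \<ge> 0"
  shows "hnorm (Hsub (U t) (V t)) = 0"
proof -
  have DU': "\<forall>s\<ge>0. inD (U s)" and DV': "\<forall>s\<ge>0. inD (V s)"
    using U V unfolding strong_sol_def by blast+
  then have DU: "inD (U s)" and DV: "inD (V s)" if "s \<ge> 0" for s
    using that by blast+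
  note sU = U[unfolded strong_sol_iff[OF DU']] and sV = V[unfolded strong_sol_iff[OF DV']]
  have "emb (U t) = emb (V t)"
  proof (rule M.strong_solution_unique[of "\<lambda>s. emb (U s)" "\<lambda>s. emb (V s)"])
    show "emb (U s) \<in> D" "emb (V s) \<in> D" if "s \<ge> 0" for s by (intro emb_in_D DU DV that)+
    show "((\<lambda>s. emb (U s)) has_vector_derivative A 0 (emb (U s)) + B b (emb (U s))) (at s within {0..})"
      "((\<lambda>s. emb (V s)) has_vector_derivative A 0 (emb (V s)) + B b (emb (V s))) (at s within {0..})" if "s \<ge> 0" for s
      using sU sV that by (auto simp: generator_emb DU DV)
    show "emb (U 0) = emb (V 0)" using sU sV by simp
  qed (rule t)
  then show ?thesis using DU DV t by (simp add: Hnorm_Hsub inDA_inH)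
qed

end

end

text \<open>Uniqueness is expressed by a vanishing \<open>Hnorm\<close> because states are tuples of
  functions, whose values on null sets or outside [0,1] the equation does not determine.\<close>

theorem theorem2p3:
  fixes \<alpha> \<eta> \<gamma> a b :: real
  assumes "0 < \<alpha>" "\<alpha> < 1" "\<eta> \<ge> 0" "\<gamma> > 0" "a > 0" "b \<noteq> 0"
  shows "(\<forall>U0. inH U0 \<longrightarrow>
            (\<exists>U. weak_sol a b \<gamma> \<alpha> \<eta> U U0) \<and>
            (\<forall>U V. weak_sol a b \<gamma> \<alpha> \<eta> U U0 \<and> weak_sol a b \<gamma> \<alpha> \<eta> V U0 \<longrightarrow>
                   (\<forall>t\<ge>0. Hnorm a \<gamma> \<alpha> (Hsub (U t) (V t)) = 0))) \<and>
         (\<forall>U0. inDA a \<gamma> \<alpha> \<eta> U0 \<longrightarrow>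
            (\<exists>U. strong_sol a b \<gamma> \<alpha> \<eta> U U0) \<and>
            (\<forall>U V. strong_sol a b \<gamma> \<alpha> \<eta> U U0 \<and> strong_sol a b \<gamma> \<alpha> \<eta> V U0 \<longrightarrow>
                   (\<forall>t\<ge>0. Hnorm a \<gamma> \<alpha> (Hsub (U t) (V t)) = 0)))"
proof -
  interpret wave_system \<alpha> \<eta> \<gamma> a
    using assms by unfold_locales
  show ?thesis
    using weak_solution_exists[of _ b] weak_solution_unique[of b]
      strong_solution_exists[of _ b] strong_solution_unique[of b] by blast
qed

end
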